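(* Let $(\Omega,\mathcal F)$ be a measurable space, $\mathcal G\subseteq\mathcal F$ a sub-$\sigma$-algebra, $\mathbb P:\mathcal G\to[0,1]$ an atomless probability measure, and let $\succsim$ be a preference relation on the set $\mathcal X$ of acts. Then $\succsim$ satisfies Axioms (RC), (M), (SRM), (C), (RS) and (SCI) if and only if there exist a continuous strictly increasing function $u:\mathbb R\to\mathbb R$, a strictly increasing continuous distortion function $g:[0,1]\to[0,1]$, and a continuous risk-conforming capacity $\nu$ on $\mathcal F$ such that $$X\succsim Y\iff \int u(X)\,\mathrm d(g\circ\nu)\ \ge\ \int u(Y)\,\mathrm d(g\circ\nu),\qquad X,Y\in\mathcal X .$$
   Context: Setting. $(\Omega,\mathcal F)$ is a measurable space, $\mathcal G\subseteq\mathcal F$ is a sub-$\sigma$-algebra, and $\mathbb P:\mathcal G\to[0,1]$ is a (countably additive) probability measure that is atomless: $\{\mathbb P(B):B\in\mathcal G,\,B\subseteq A\}=[0,\mathbb P(A)]$ for every $A\in\mathcal G$. An act is a bounded $\mathcal F$-measurable function $X:\Omega\to\mathbb R$; $\mathcal X$ is the set of acts, $\mathcal X(\mathcal G)$ the set of $\mathcal G$-measurable acts; constants are identified with constant acts. A preference relation $\succsim$ is a total preorder (complete, transitive) on $\mathcal X$; $\succ$ and $\simeq$ are its strict and symmetric parts. For $x,y\in\mathbb R$, $A\in\mathcal F$, $xAy$ is the act equal to $x$ on $A$ and $y$ on $A^c$. Capacities. A capacity is $\nu:\mathcal F\to\mathbb R$ with $\nu(\varnothing)=0$, $\nu(\Omega)=1$,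 and $\nu(A)\le\nu(B)$ whenever $A\subseteq B$. It is continuous if $\nu(A_n)\to\nu(\bigcup_n A_n)$ for increasing sequences and $\nu(A_n)\to\nu(\bigcap_n A_n)$ for decreasing sequences in $\mathcal F$. It is risk conforming if $\nu|_{\mathcal G}=\mathbb P$. A distortion function is an increasing (non-strict) $g:[0,1]\to[0,1]$ with $g(0)=0$, $g(1)=1$. The Choquet integral is $\int X\,\mathrm d\nu=\int_0^\infty\nu(X>x)\,\mathrm dx+\int_{-\infty}^0(\nu(X>x)-1)\,\mathrm dx$. Acts $X,Y$ are comonotonic if $(X(\omega)-X(\tilde\omega))(Y(\omega)-Y(\tilde\omega))\ge0$ for all $\omega,\tilde\omega\in\Omega$. Axioms. (RC) If $X,Y\in\mathcal X(\mathcal G)$ and $\mathbb P(X>x)=\mathbb P(Y>x)$ for all $x\in\mathbb R$, then $X\simeq Y$. (M) If $X,Y\in\mathcal X$ and $X(\omega)\ge Y(\omega)$ for all $\omega$, then $X\succsim Y$. (SRM) If $X,Y\in\mathcal X(\mathcal G)$, $\mathbb P(X\ge Y)=1$ and $\mathbb P(X>Y)>0$, then $X\succ Y$. (C) For all $X\in\mathcal X$, the sets $\{Y\in\mathcal X:X\succsim Y\}$ and $\{Y\in\mathcal X:Y\succsim X\}$ are B-closed, where $\mathcal S\subseteq\mathcal X$ is B-closed if whenever $(X_n)_{n\in\mathbb N}\subseteq\mathcal S$ satisfies $\sup_n\sup_\omega|X_n(\omega)|<\infty$ and $X_n\to X\in\mathcal X$ pointwise, then $X\in\mathcal S$. The next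 notions and axioms presuppose (RC), (M), (SRM), (C). Under these, each $X\in\mathcal X$ has a unique certainty equivalent $c_X\in\mathbb R$ with $X\simeq c_X$. Let $\mathcal G_{\mathrm{cf}}=\{R\in\mathcal G:\mathbb P(R)=1/2\}$. Under these axioms, for $R\in\mathcal G_{\mathrm{cf}}$ and $x\ge y$ there is a unique $z\in[y,x]$ with $xRy\simeq c_{xRz}Rc_{zRy}$, and $z$ does not depend on the choice of $R\in\mathcal G_{\mathrm{cf}}$; this $z$ is denoted $(1/2)x\oplus(1/2)y$ (and also $(1/2)y\oplus(1/2)x$). For acts, $[(1/2)X\oplus(1/2)Y](\omega)=(1/2)X(\omega)\oplus(1/2)Y(\omega)$, which is again an act. (RS) For all $R\in\mathcal G_{\mathrm{cf}}$ and $x,y,z,z'\in\mathbb R$ with $x\ge y$ and $z,z'\in[y,x]$: $c_{xRz}Rc_{z'Ry}\simeq c_{xRz'}Rc_{zRy}$. (SCI) For all pairwise comonotonic $X,Y,Z\in\mathcal X$: $X\simeq Y$ implies $(1/2)X\oplus(1/2)Z\simeq(1/2)Y\oplus(1/2)Z$. *)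

theory Defs
  imports "HOL-Probability.Probability"
begin

text \<open>
  \<open>F\<close> is used only as a measurable space; its measure plays no role. The probability space \<open>P\<close>
  carries the sub-sigma-algebra as \<open>sets P\<close>. Preferences are binary predicates on functions
  and are only ever evaluated at acts.
\<close>

definition atomless :: "'a measure \<Rightarrow> bool" where
  "atomless P \<longleftrightarrow>
     (\<forall>A \<in> sets P. {measure P B | B. B \<in> sets P \<and> B \<subseteq> A} = {0..measure P A})"


section \<open>Acts\<close>

text \<open>
  Acts are functions on \<open>space M\<close> rather than on the whole type, hence the extensionality
  requirement and the restricted abstractions below.
\<close>

definition acts :: "'a measure \<Rightarrow> ('a \<Rightarrow> real) set" where
  "acts M = {X. X \<in> borel_measurable M \<and> X \<in> extensional (space M) \<and> bounded (X ` space M)}"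

definition const_act :: "'a measure \<Rightarrow> real \<Rightarrow> ('a \<Rightarrow> real)" where
  "const_act M c = (\<lambda>\<omega>\<in>space M. c)"

definition binary_act :: "'a measure \<Rightarrow> real \<Rightarrow> 'a set \<Rightarrow> real \<Rightarrow> ('a \<Rightarrow> real)" where
  "binary_act M x A y = (\<lambda>\<omega>\<in>space M. if \<omega> \<in> A then x else y)"

definition comonotonic :: "'a measure \<Rightarrow> ('a \<Rightarrow> real) \<Rightarrow> ('a \<Rightarrow> real) \<Rightarrow> bool" where
  "comonotonic M X Y \<longleftrightarrow>
     (\<forall>\<omega>\<in>space M. \<forall>\<omega>'\<in>space M. (X \<omega> - X \<omega>') * (Y \<omega> - Y \<omega>') \<ge> 0)"


section \<open>Capacities and the Choquet integral\<close>

definition capacity :: "'a measure \<Rightarrow> ('a set \<Rightarrow> real) \<Rightarrow> bool" where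
  "capacity F \<nu> \<longleftrightarrow> \<nu> {} = 0 \<and> \<nu> (space F) = 1 \<and>
     (\<forall>A\<in>sets F. \<forall>B\<in>sets F. A \<subseteq> B \<longrightarrow> \<nu> A \<le> \<nu> B)"

definition continuous_capacity :: "'a measure \<Rightarrow> ('a set \<Rightarrow> real) \<Rightarrow> bool" where
  "continuous_capacity F \<nu> \<longleftrightarrow> capacity F \<nu> \<and>
     (\<forall>A :: nat \<Rightarrow> 'a set. range A \<subseteq> sets F \<longrightarrow> incseq A \<longrightarrow>
        (\<lambda>n. \<nu> (A n)) \<longlonglongrightarrow> \<nu> (\<Union>n. A n)) \<and>
     (\<forall>A :: nat \<Rightarrow> 'a set. range A \<subseteq> sets F \<longrightarrow> decseq A \<longrightarrow>
        (\<lambda>n. \<nu> (A n)) \<longlonglongrightarrow> \<nu> (\<Inter>n. A n))"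

definition risk_conforming :: "'a measure \<Rightarrow> ('a set \<Rightarrow> real) \<Rightarrow> bool" where
  "risk_conforming P \<nu> \<longleftrightarrow> (\<forall>A\<in>sets P. \<nu> A = measure P A)"

definition distortion :: "(real \<Rightarrow> real) \<Rightarrow> bool" where
  "distortion g \<longleftrightarrow> g \<in> {0..1} \<rightarrow> {0..1} \<and> mono_on {0..1} g \<and> g 0 = 0 \<and> g 1 = 1"

definition choquet :: "'a measure \<Rightarrow> ('a set \<Rightarrow> real) \<Rightarrow> ('a \<Rightarrow> real) \<Rightarrow> real" where
  "choquet F \<nu> X =
     (LINT x:{0..}|lborel. \<nu> {\<omega>\<in>space F. X \<omega> > x}) +
     (LINT x:{..0}|lborel. (\<nu> {\<omega>\<in>space F. X \<omega> > x} - 1))"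


section \<open>Preferences\<close>

type_synonym 'a pref = "('a \<Rightarrow> real) \<Rightarrow> ('a \<Rightarrow> real) \<Rightarrow> bool"

definition preference :: "'a measure \<Rightarrow> 'a pref \<Rightarrow> bool" where
  "preference F R \<longleftrightarrow> (\<forall>X\<in>acts F. \<forall>Y\<in>acts F. R X Y \<or> R Y X) \<and> transp_on (acts F) R"

definition strictly :: "'a pref \<Rightarrow> 'a pref" where
  "strictly R X Y \<longleftrightarrow> R X Y \<and> \<not> R Y X"

definition indiff :: "'a pref \<Rightarrow> 'a pref" where
  "indiff R X Y \<longleftrightarrow> R X Y \<and> R Y X"

definition axiom_RC :: "'a measure \<Rightarrow> 'a pref \<Rightarrow> bool" where
  "axiom_RC P R \<longleftrightarrow>
     (\<forall>X\<in>acts P. \<forall>Y\<in>acts P.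
        (\<forall>x. measure P {\<omega>\<in>space P. X \<omega> > x} = measure P {\<omega>\<in>space P. Y \<omega> > x}) \<longrightarrow>
        indiff R X Y)"

definition axiom_M :: "'a measure \<Rightarrow> 'a pref \<Rightarrow> bool" where
  "axiom_M F R \<longleftrightarrow>
     (\<forall>X\<in>acts F. \<forall>Y\<in>acts F. (\<forall>\<omega>\<in>space F. X \<omega> \<ge> Y \<omega>) \<longrightarrow> R X Y)"

definition axiom_SRM :: "'a measure \<Rightarrow> 'a pref \<Rightarrow> bool" where
  "axiom_SRM P R \<longleftrightarrow>
     (\<forall>X\<in>acts P. \<forall>Y\<in>acts P.
        measure P {\<omega>\<in>space P. X \<omega> \<ge> Y \<omega>} = 1 \<longrightarrow>
        measure P {\<omega>\<in>space P. X \<omega> > Y \<omega>} > 0 \<longrightarrow>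
        strictly R X Y)"

definition B_closed :: "'a measure \<Rightarrow> ('a \<Rightarrow> real) set \<Rightarrow> bool" where
  "B_closed F S \<longleftrightarrow>
     (\<forall>(Xs :: nat \<Rightarrow> 'a \<Rightarrow> real). \<forall>X\<in>acts F.
        (\<forall>n. Xs n \<in> S) \<longrightarrow>
        (\<exists>K. \<forall>n. \<forall>\<omega>\<in>space F. \<bar>Xs n \<omega>\<bar> \<le> K) \<longrightarrow>
        (\<forall>\<omega>\<in>space F. (\<lambda>n. Xs n \<omega>) \<longlonglongrightarrow> X \<omega>) \<longrightarrow>
        X \<in> S)"

definition axiom_C :: "'a measure \<Rightarrow> 'a pref \<Rightarrow> bool" where
  "axiom_C F R \<longleftrightarrow>
     (\<forall>X\<in>acts F. B_closed F {Y\<in>acts F. R X Y} \<and> B_closed F {Y\<in>acts F. R Y X})"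


section \<open>Certainty equivalents and subjective mixtures\<close>

text \<open>
  The definite descriptions in \<open>cert_equiv\<close> and \<open>half_mix\<close> are meaningful when the axioms RC, M,
  SRM and C hold: these yield existence and uniqueness, and the mixture point does not depend
  on the event of probability one half.
\<close>

definition cert_equiv :: "'a measure \<Rightarrow> 'a pref \<Rightarrow> ('a \<Rightarrow> real) \<Rightarrow> real" where
  "cert_equiv F R X = (THE c. indiff R X (const_act F c))"

definition coin_flips :: "'a measure \<Rightarrow> 'a set set" where
  "coin_flips P = {A \<in> sets P. measure P A = 1/2}"

text \<open>
  \<open>half_mix_ordered F P R x y\<close> is the mixture of \<open>x\<close> and \<open>y\<close> for \<open>x \<ge> y\<close>; \<open>half_mix\<close> is its
  symmetric extension.
\<close>

definition half_mix_ordered :: "'a measure \<Rightarrow> 'a measure \<Rightarrow> 'a pref \<Rightarrow> real \<Rightarrow> real \<Rightarrow> real" where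
  "half_mix_ordered F P R x y =
     (THE z. z \<in> {y..x} \<and>
        (\<forall>A\<in>coin_flips P.
           indiff R (binary_act F x A y)
             (binary_act F (cert_equiv F R (binary_act F x A z)) A
                           (cert_equiv F R (binary_act F z A y)))))"

definition half_mix :: "'a measure \<Rightarrow> 'a measure \<Rightarrow> 'a pref \<Rightarrow> real \<Rightarrow> real \<Rightarrow> real" where
  "half_mix F P R x y =
     (if x \<ge> y then half_mix_ordered F P R x y else half_mix_ordered F P R y x)"

definition half_mix_act ::
    "'a measure \<Rightarrow> 'a measure \<Rightarrow> 'a pref \<Rightarrow> ('a \<Rightarrow> real) \<Rightarrow> ('a \<Rightarrow> real) \<Rightarrow> ('a \<Rightarrow> real)" where
  "half_mix_act F P R X Y = (\<lambda>\<omega>\<in>space F. half_mix F P R (X \<omega>) (Y \<omega>))"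

definition axiom_RS :: "'a measure \<Rightarrow> 'a measure \<Rightarrow> 'a pref \<Rightarrow> bool" where
  "axiom_RS F P R \<longleftrightarrow>
     (\<forall>A\<in>coin_flips P. \<forall>x y z z'. x \<ge> y \<longrightarrow> z \<in> {y..x} \<longrightarrow> z' \<in> {y..x} \<longrightarrow>
        indiff R
          (binary_act F (cert_equiv F R (binary_act F x A z)) A
                        (cert_equiv F R (binary_act F z' A y)))
          (binary_act F (cert_equiv F R (binary_act F x A z')) A
                        (cert_equiv F R (binary_act F z A y))))"

definition axiom_SCI :: "'a measure \<Rightarrow> 'a measure \<Rightarrow> 'a pref \<Rightarrow> bool" where
  "axiom_SCI F P R \<longleftrightarrow>
     (\<forall>X\<in>acts F. \<forall>Y\<in>acts F. \<forall>Z\<in>acts F.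
        comonotonic F X Y \<longrightarrow> comonotonic F X Z \<longrightarrow> comonotonic F Y Z \<longrightarrow>
        indiff R X Y \<longrightarrow>
        indiff R (half_mix_act F P R X Z) (half_mix_act F P R Y Z))"

end

theory Submission
  imports Defs
begin

text \<open>
  Write \<open>c X\<close> for the certainty equivalent of \<open>X\<close> and \<open>x \<oplus> y\<close> for the subjective mixture.

  From the axioms to the representation: applying SCI twice, with constants in place of \<open>X\<close> and then
  of \<open>Z\<close>, gives \<open>c (X \<oplus> Z) = c X \<oplus> c Z\<close> for comonotonic \<open>X\<close>, \<open>Z\<close>. Applied to bets on a coin flip this makes
  \<open>\<oplus>\<close> strictly increasing and medial, \<open>(x \<oplus> y) \<oplus> (z \<oplus> w) = (x \<oplus> z) \<oplus> (y \<oplus> w)\<close>. A continuous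
  medial mean is \<open>u (x \<oplus> y) = (u x + u y) / 2\<close>: on an interval \<open>[a, b]\<close> the binary digits of \<open>u x\<close>
  are read off by repeatedly inverting \<open>\<lambda>y. y \<oplus> a\<close> or \<open>\<lambda>y. y \<oplus> b\<close>, and every defect of
  \<open>u\<close> (of the midpoint equation, of monotonicity, of uniqueness) is bounded by half of its own supremum,
  hence vanishes. So \<open>u X \<mapsto> u (c X)\<close> extends to a monotone comonotonically additive functional, which is the
  Choquet integral of its values \<open>\<mu> A\<close> on indicators. On the sub-sigma-algebra \<open>\<mu> = g \<circ> P\<close>, and
  \<open>\<nu> = g\<^sup>-\<^sup>1 \<circ> \<mu>\<close>.

  Conversely, the representation turns \<open>\<oplus>\<close> into the midpoint in utilities, and SCI becomes
  comonotonic additivity of the Choquet integral, which holds because comonotonic \<open>X\<close>, \<open>Z\<close> are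
  nondecreasing functions of \<open>X + Z\<close>, whose Choquet integrals are integrals over one and the same
  distribution.
\<close>

section \<open>Continuous medial means\<close>

text \<open>Two obstacles shape the forward direction. SCI speaks only of comonotonic acts, so it
  controls bets on a coin flip only when all of them pay more on the same side. Monotonicity and
  mediality of the mixture are therefore first found in ordered situations, the former even only
  locally, and extended afterwards by a maximum argument and by permuting the four arguments. The
  other obstacle is that \<open>u\<close> may have a bounded range: a sum of utility profiles need
  not be the utility of an act. Profiles are scaled by powers of two, the scalars that mixing
  provides; for the same reason step functions have dyadic heights. Atomlessness does more than
  supply coin flips: it gives events of every probability, so that \<open>g\<close> is defined on
  all of [0, 1], and chains of such events, along which continuity of the capacity becomes
  continuity of \<open>g\<close>. In the converse direction RS and SCI mention certainty
  equivalents, so RC, M, SRM and C have to be derived first.\<close>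

text \<open>Repeated halving of one initial bound squeezes \<open>D\<close> below
  \<open>C / 2 ^ n\<close> for all \<open>n\<close>. It serves defects that reproduce themselves at
  half size elsewhere in \<open>S\<close>.\<close>

lemma halving_imp_nonpos:
  fixes D :: "'b \<Rightarrow> real"
  assumes bound: "\<And>x. x \<in> S \<Longrightarrow> D x \<le> B"
    and half: "\<And>C. (\<And>x. x \<in> S \<Longrightarrow> D x \<le> C) \<Longrightarrow> 0 \<le> C \<Longrightarrow> (\<And>x. x \<in> S \<Longrightarrow> D x \<le> C / 2)"
    and "x \<in> S"
  shows "D x \<le> 0"
proof -
  \<comment> \<open>The halving hypothesis accepts only nonnegative bounds, hence the maximum with
    0.\<close>
  define C where "C = max B 0"
  have "\<forall>x\<in>S. D x \<le> C * (1/2)^n" for n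
  proof (induction n)
    case 0
    then show ?case using bound by (auto simp: C_def intro: le_max_iff_disj[THEN iffD2])
  next
    case (Suc n)
    have "0 \<le> C * (1/2)^n" by (simp add: C_def)
    with Suc half[of "C * (1/2)^n"] show ?case by auto
  qed
  then have "\<And>n. D x \<le> C * (1/2)^n" using \<open>x \<in> S\<close> by blast
  moreover have "(\<lambda>n. C * (1/2)^n) \<longlonglongrightarrow> C * 0"
    by (intro tendsto_mult tendsto_const LIMSEQ_power_zero) simp
  ultimately show ?thesis
    by (intro LIMSEQ_le_const[of "\<lambda>n. C * (1/2)^n"]) auto
qed

text \<open>The axioms of a bisymmetric mean in the sense of Aczel. Continuity and strictness in the
  first argument carry over to the second by \<open>commute\<close>.\<close>

locale real_mean =
  fixes m :: "real \<Rightarrow> real \<Rightarrow> real"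
  assumes commute: "m x y = m y x"
    and idem: "m x x = x"
    and strict: "x < x' \<Longrightarrow> m x y < m x' y"
    and cont: "continuous_on UNIV (\<lambda>x. m x y)"
    and medial: "m (m x y) (m z w) = m (m x z) (m y w)"
begin

lemma strict2: "y < y' \<Longrightarrow> m x y < m x y'"
  using strict[of y y' x] by (simp add: commute)

lemma less_iff [simp]: "m x y < m x' y \<longleftrightarrow> x < x'"
  using strict[of x x' y] strict[of x' x y] by (cases x x' rule: linorder_cases) auto

lemma le_iff [simp]: "m x y \<le> m x' y \<longleftrightarrow> x \<le> x'"
  by (simp add: linorder_not_less[symmetric])

lemma less_iff2 [simp]: "m x y < m x y' \<longleftrightarrow> y < y'"
  by (metis commute less_iff)

lemma le_iff2 [simp]: "m x y \<le> m x y' \<longleftrightarrow> y \<le> y'"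
  by (simp add: linorder_not_less[symmetric])

lemma mono: "x \<le> x' \<Longrightarrow> y \<le> y' \<Longrightarrow> m x y \<le> m x' y'"
  by (meson le_iff le_iff2 order_trans)

lemma in_interval: "x \<in> {a..b} \<Longrightarrow> y \<in> {a..b} \<Longrightarrow> m x y \<in> {a..b}"
  using mono[of a x a y] mono[of x b y b] by (auto simp: idem)

lemma internal: assumes "x < y" shows "x < m x y" "m x y < y"
  using strict2[OF assms, of x] strict[OF assms, of y] by (auto simp: idem)

text \<open>The midpoint equation with \<open>m\<close> in place of the arithmetic mean; a
  continuous strictly increasing solution exhibits \<open>m\<close> as a quasi-arithmetic
  mean.\<close>

definition jensen_on :: "real set \<Rightarrow> (real \<Rightarrow> real) \<Rightarrow> bool" where
  "jensen_on S s \<longleftrightarrow> (\<forall>x\<in>S. \<forall>y\<in>S. s (m x y) = (s x + s y) / 2)"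

lemma jensen_onD: "jensen_on S s \<Longrightarrow> x \<in> S \<Longrightarrow> y \<in> S \<Longrightarrow> s (m x y) = (s x + s y) / 2"
  by (auto simp: jensen_on_def)

lemma preimage_low: assumes "a \<le> b" "x \<in> {a..m a b}"
  shows "\<exists>y\<in>{a..b}. m y a = x"
proof -
  have "\<exists>y\<ge>a. y \<le> b \<and> m y a = x"
    by (rule IVT') (use assms cont[of a] in \<open>auto simp: idem commute intro: continuous_on_subset\<close>)
  then show ?thesis by auto
qed

lemma preimage_high: assumes "a \<le> b" "x \<in> {m a b..b}"
  shows "\<exists>y\<in>{a..b}. m y b = x"
proof -
  have "\<exists>y\<ge>a. y \<le> b \<and> m y b = x"
    by (rule IVT') (use assms cont[of b] in \<open>auto simp: idem commute intro: continuous_on_subset\<close>)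
  then show ?thesis by auto
qed

text \<open>The maps taking \<open>y\<close> to \<open>m y a\<close> and to \<open>m y b\<close>
  send \<open>{a..b}\<close> onto the two halves that meet at \<open>m a b\<close>. This
  self-similarity, the analogue of reading one binary digit, drives the halving arguments
  below.\<close>

lemma preimage_cases:
  assumes "a \<le> b" "x \<in> {a..b}"
  obtains (low) y where "x \<le> m a b" "y \<in> {a..b}" "x = m y a"
    | (high) y where "m a b \<le> x" "y \<in> {a..b}" "x = m y b"
proof (cases "x \<le> m a b")
  case True
  then obtain y where "y \<in> {a..b}" "m y a = x" using preimage_low[of a b x] assms by auto
  with True show ?thesis by (intro low) auto
next
  case False
  then have "x \<in> {m a b..b}" using assms by simp
  then obtain y where "y \<in> {a..b}" "m y b = x" using preimage_high[of a b x] assms by blast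
  with False show ?thesis by (intro high) auto
qed

text \<open>Both solutions agree at the ends, so their difference at \<open>m y a\<close> or
  \<open>m y b\<close> is half of their difference at \<open>y\<close>. Boundedness is what starts
  the halving.\<close>

lemma jensen_unique:
  assumes ab: "a \<le> b"
    and s: "jensen_on {a..b} s" and t: "jensen_on {a..b} t"
    and ends: "s a = t a" "s b = t b"
    and bound: "\<And>x. x \<in> {a..b} \<Longrightarrow> \<bar>s x - t x\<bar> \<le> B"
    and x: "x \<in> {a..b}"
  shows "s x = t x"
proof -
  have "\<bar>s x - t x\<bar> \<le> 0"
  proof (rule halving_imp_nonpos[of "{a..b}" "\<lambda>x. \<bar>s x - t x\<bar>"])
    fix C x assume C: "\<And>x. x \<in> {a..b} \<Longrightarrow> \<bar>s x - t x\<bar> \<le> C" and x: "x \<in> {a..b}"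
    from ab x show "\<bar>s x - t x\<bar> \<le> C / 2"
    proof (cases rule: preimage_cases)
      case (low y)
      then have "s x - t x = (s y - t y) / 2"
        using ends jensen_onD[OF s, of y a] jensen_onD[OF t, of y a] ab by (auto simp: field_simps)
      then have "\<bar>s x - t x\<bar> = \<bar>s y - t y\<bar> / 2" by (simp only: abs_divide abs_numeral)
      also have "\<dots> \<le> C / 2" using C[of y] low by simp
      finally show ?thesis .
    next
      case (high y)
      then have "s x - t x = (s y - t y) / 2"
        using ends jensen_onD[OF s, of y b] jensen_onD[OF t, of y b] ab by (auto simp: field_simps)
      then have "\<bar>s x - t x\<bar> = \<bar>s y - t y\<bar> / 2" by (simp only: abs_divide abs_numeral)
      also have "\<dots> \<le> C / 2" using C[of y] high by simp
      finally show ?thesis .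
    qed
  qed (use bound x in auto)
  then show ?thesis by simp
qed

section \<open>Existence of a utility on a compact interval\<close>

text \<open>Here \<open>T\<close> plays the role of the doubling map, and \<open>s\<close> sums the
  binary digits read off along its orbit. Only mixing with an end point is controlled at this stage;
  arbitrary pairs are left to \<open>jensen_exists\<close>.\<close>

lemma binary_expansion_exists:
  assumes ab: "a < b"
  shows "\<exists>s. (\<forall>x\<in>{a..b}. s x \<in> {0..1} \<and> s (m x a) = s x / 2 \<and> s (m x b) = (s x + 1) / 2) \<and>
    s a = 0 \<and> s b = (1::real)"
proof -
  define h where "h = m a b"
  have h: "a < h" "h < b" using internal[OF ab] by (auto simp: h_def)
  \<comment> \<open>The tie \<open>x = h\<close> goes to the upper branch, so \<open>h\<close> has
    the digits 1, 0, 0, ... This is why \<open>T_low\<close> leaves out \<open>x = b\<close>, where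
    \<open>m b a = h\<close>.\<close>
  define T where "T x = (SOME y. y \<in> {a..b} \<and> (if x < h then m y a = x else m y b = x))" for x
  have T_low: "T (m x a) = x" if "x \<in> {a..b}" "x < b" for x
  proof -
    have lt: "m x a < h" using that strict2[of x b a] by (simp add: h_def commute)
    have "T (m x a) \<in> {a..b} \<and> (if m x a < h then m (T (m x a)) a = m x a else m (T (m x a)) b = m x a)"
      unfolding T_def by (rule someI[of _ x]) (use that lt in auto)
    then have "m (T (m x a)) a = m x a" using lt by auto
    then show ?thesis by (metis le_iff order_antisym order_refl)
  qed
  have T_high: "T (m x b) = x" if "x \<in> {a..b}" for x
  proof -
    have ge: "\<not> m x b < h" using that by (simp add: h_def)
    have "T (m x b) \<in> {a..b} \<and> (if m x b < h then m (T (m x b)) a = m x b else m (T (m x b)) b = m x b)"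
      unfolding T_def by (rule someI[of _ x]) (use that ge in auto)
    then have "m (T (m x b)) b = m x b" using ge by auto
    then show ?thesis by (metis le_iff order_antisym order_refl)
  qed
  \<comment> \<open>Digit number \<open>k\<close> has weight \<open>(1/2)^(k+1)\<close>; dropping
    the first digit produces the recursion \<open>rec\<close>.\<close>
  define c :: "real \<Rightarrow> nat \<Rightarrow> real" where "c x k = (1/2)^k * ((1/2) * of_bool (h \<le> (T ^^ k) x))" for x and k :: nat
  have geom: "(\<lambda>k. (1/2)^k * (1/2)) sums (1::real)"
    using sums_mult2[OF geometric_sums[of "1/2::real"], of "1/2"] by simp
  have summ: "summable (c x)" for x
    by (rule summable_comparison_test'[OF sums_summable[OF geom], of 0]) (auto simp: c_def)
  define s where "s x = suminf (c x)" for x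
  have s01: "s x \<in> {0..1}" for x
  proof -
    have "s x \<le> (\<Sum>k. (1/2)^k * (1/2))" unfolding s_def
      by (rule suminf_le[OF _ summ sums_summable[OF geom]]) (auto simp: c_def)
    moreover have "0 \<le> s x" unfolding s_def by (rule suminf_nonneg[OF summ]) (auto simp: c_def)
    ultimately show ?thesis using sums_unique[OF geom] by auto
  qed
  have rec: "s x = of_bool (h \<le> x) / 2 + s (T x) / 2" for x
  proof -
    have "c x (Suc k) = (1/2) * c (T x) k" for k
      by (simp add: c_def funpow_swap1)
    then have "(\<Sum>k. c x (Suc k)) = (1/2) * s (T x)"
      using suminf_mult[OF summ[of "T x"], of "1/2"] by (simp only: s_def)
    moreover have "c x 0 = of_bool (h \<le> x) / 2" by (simp add: c_def)
    ultimately show ?thesis using suminf_split_head[OF summ, of x] by (simp add: s_def[of x])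
  qed
  have sa: "s a = 0" using rec[of a] T_low[of a] ab h by (simp add: idem)
  have sb: "s b = 1" using rec[of b] T_high[of b] ab h by (simp add: idem)
  have sh: "s h = 1/2" using rec[of h] T_high[of a] ab sa by (simp add: h_def)
  have low: "s (m x a) = s x / 2" if "x \<in> {a..b}" for x
  proof (cases "x = b")
    case True
    then show ?thesis using sh sb by (simp add: h_def commute)
  next
    case False
    then have "\<not> h \<le> m x a" using that by (simp add: h_def commute[of a b])
    then show ?thesis using rec[of "m x a"] T_low[of x] that False by simp
  qed
  have high: "s (m x b) = (s x + 1) / 2" if "x \<in> {a..b}" for x
  proof -
    have "h \<le> m x b" using that by (simp add: h_def)
    then show ?thesis using rec[of "m x b"] T_high[of x] that by simp
  qed
  show ?thesis using s01 low high sa sb by blast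
qed

text \<open>The end point equations make the defect of the midpoint equation at a pair half of the
  defect at the pair of preimages. If the preimages belong to different branches, mediality moves
  the mixture to \<open>m (m x' y') h\<close>, which is why mixing with \<open>h\<close> is settled
  first.\<close>

lemma jensen_exists:
  assumes ab: "a < b"
  shows "\<exists>s. jensen_on {a..b} s \<and> (\<forall>x\<in>{a..b}. s x \<in> {0..1}) \<and> s a = 0 \<and> s b = 1"
proof -
  obtain s where s01: "\<And>x. x \<in> {a..b} \<Longrightarrow> s x \<in> {0..1}"
    and low: "\<And>x. x \<in> {a..b} \<Longrightarrow> s (m x a) = s x / 2"
    and high: "\<And>x. x \<in> {a..b} \<Longrightarrow> s (m x b) = (s x + 1) / 2"
    and ends: "s a = 0" "s b = (1::real)"
    using binary_expansion_exists[OF ab] by blast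
  define h where "h = m a b"
  \<comment> \<open>Since \<open>h\<close> is in both branches, it can be written with the same end
    point as \<open>w\<close>; mediality then pulls that end point out.\<close>
  have mid: "s (m w h) = (s w + s h) / 2" if w: "w \<in> {a..b}" for w
  proof -
    have sh: "s h = 1/2" using high[of a] ab ends by (simp add: h_def)
    from ab w have "a \<le> b" "w \<in> {a..b}" by auto
    then show ?thesis
    proof (cases rule: preimage_cases)
      case w1: (low y)
      have "m w h = m (m y b) a"
        using medial[of y a b a] w1 by (simp add: h_def idem commute[of a b])
      then show ?thesis
        using low[of y] low[of "m y b"] high[of y] w1 sh in_interval[of y a b b] ab by auto
    next
      case w1: (high y)
      have "m w h = m (m y a) b"
        using medial[of y b a b] w1 by (simp add: h_def idem)
      then show ?thesis
        using high[of y] high[of "m y a"] low[of y] w1 sh in_interval[of y a b a] ab by auto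
    qed
  qed
  define D where "D = (\<lambda>(x, y). \<bar>s (m x y) - (s x + s y) / 2\<bar>)"
  have "D p \<le> 0" if p: "p \<in> {a..b} \<times> {a..b}" for p
  proof (rule halving_imp_nonpos[of "{a..b} \<times> {a..b}" D])
    fix p assume "p \<in> {a..b} \<times> {a..b}"
    then obtain x y where "p = (x, y)" "x \<in> {a..b}" "y \<in> {a..b}" by auto
    then have "0 \<le> s x" "s x \<le> 1" "0 \<le> s y" "s y \<le> 1" "0 \<le> s (m x y)" "s (m x y) \<le> 1"
      using s01[of x] s01[of y] s01[OF in_interval[of x a b y]] by auto
    then have "\<bar>s (m x y) - (s x + s y) / 2\<bar> \<le> 1"
      by (simp add: abs_le_iff field_simps)
    then show "D p \<le> 1" by (simp add: D_def \<open>p = (x, y)\<close>)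
  next
    fix C p assume C: "\<And>p. p \<in> {a..b} \<times> {a..b} \<Longrightarrow> D p \<le> C" and "p \<in> {a..b} \<times> {a..b}"
    then obtain x y where p: "p = (x, y)" and x: "x \<in> {a..b}" and y: "y \<in> {a..b}" by auto
    have ab': "a \<le> b" using ab by simp
    have key: "D (x, y) \<le> C / 2"
      if "s (m x y) - (s x + s y) / 2 = (s (m x' y') - (s x' + s y') / 2) / 2"
        and "x' \<in> {a..b}" "y' \<in> {a..b}" for x y x' y'
    proof -
      have "D (x, y) = D (x', y') / 2" by (simp only: D_def prod.case that(1) abs_divide abs_numeral)
      then show ?thesis using C[of "(x', y')"] that(2,3) by simp
    qed
    have mix: "D (m x' a, m y' b) \<le> C / 2" if "x' \<in> {a..b}" "y' \<in> {a..b}" for x' y'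
    proof (rule key)
      have "m (m x' a) (m y' b) = m (m x' y') h" using medial[of x' a y' b] by (simp add: h_def)
      moreover have "s h = 1/2" using high[of a] ab ends by (simp add: h_def)
      ultimately show "s (m (m x' a) (m y' b)) - (s (m x' a) + s (m y' b)) / 2 =
        (s (m x' y') - (s x' + s y') / 2) / 2"
        using mid[OF in_interval[OF that]] low[OF that(1)] high[OF that(2)]
        by (simp add: field_simps)
    qed (use that in auto)
    from ab' x show "D p \<le> C / 2"
    proof (cases rule: preimage_cases)
      case x1: (low x')
      from ab' y show ?thesis
      proof (cases rule: preimage_cases)
        case y1: (low y')
        have "m (m x' a) (m y' a) = m (m x' y') a" using medial[of x' a y' a] by (simp add: idem)
        then show ?thesis unfolding p
          using x1 y1 low[OF x1(2)] low[OF y1(2)] low[OF in_interval[OF x1(2) y1(2)]]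
          by (intro key[of x y x' y']) (auto simp: field_simps)
      next
        case y1: (high y')
        then show ?thesis using x1 mix by (simp add: p)
      qed
    next
      case x1: (high x')
      from ab' y show ?thesis
      proof (cases rule: preimage_cases)
        case y1: (low y')
        have "D (x, y) = D (y, x)" by (simp add: D_def commute add.commute)
        then show ?thesis using x1 y1 mix[of y' x'] by (simp add: p)
      next
        case y1: (high y')
        have "m (m x' b) (m y' b) = m (m x' y') b" using medial[of x' b y' b] by (simp add: idem)
        then show ?thesis unfolding p
          using x1 y1 high[OF x1(2)] high[OF y1(2)] high[OF in_interval[OF x1(2) y1(2)]]
          by (intro key[of x y x' y']) (auto simp: field_simps)
      qed
    qed
  qed (use p in auto)
  then have "jensen_on {a..b} s" by (fastforce simp: jensen_on_def D_def)
  then show ?thesis using s01 ends by blast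
qed


section \<open>Regularity of solutions of the midpoint equation\<close>

text \<open>On ordered pairs \<open>s x - s y\<close> halves when both points have preimages in the
  same branch. Across branches the value \<open>(s a + s b) / 2\<close> separates them, because
  \<open>s\<close> stays between its end values.\<close>

lemma jensen_mono_on:
  assumes ab: "a \<le> b" and s: "jensen_on {a..b} s" and bound: "\<And>x. x \<in> {a..b} \<Longrightarrow> s x \<in> {s a..s b}"
  shows "mono_on {a..b} s"
proof -
  define D where "D = (\<lambda>(x, y). s x - s y)"
  define T where "T = {(x, y). x \<in> {a..b} \<and> y \<in> {a..b} \<and> x \<le> y}"
  have sab: "s a \<le> s b" using bound[of a] ab by auto
  have "D p \<le> 0" if p: "p \<in> T" for p
  proof (rule halving_imp_nonpos[of T D])
    fix p assume "p \<in> T"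
    then obtain x y where "p = (x, y)" "x \<in> {a..b}" "y \<in> {a..b}" by (auto simp: T_def)
    then show "D p \<le> s b - s a" using bound[of x] bound[of y] by (simp add: D_def)
  next
    fix C p assume C: "\<And>p. p \<in> T \<Longrightarrow> D p \<le> C" "0 \<le> C" and "p \<in> T"
    then obtain x y where p: "p = (x, y)" and x: "x \<in> {a..b}" and y: "y \<in> {a..b}" and xy: "x \<le> y"
      by (auto simp: T_def)
    have a: "a \<in> {a..b}" and b: "b \<in> {a..b}" using ab by auto
    from ab x show "D p \<le> C / 2"
    proof (cases rule: preimage_cases)
      case x1: (low x')
      from ab y show ?thesis
      proof (cases rule: preimage_cases)
        case y1: (low y')
        have "D (x', y') \<le> C" using xy x1 y1 by (intro C) (auto simp: T_def)
        then show ?thesis using jensen_onD[OF s x1(2) a] jensen_onD[OF s y1(2) a]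
          by (simp add: p D_def x1 y1 field_simps)
      next
        case y1: (high y')
        have "s x \<le> (s a + s b) / 2" "(s a + s b) / 2 \<le> s y"
          using jensen_onD[OF s x1(2) a] jensen_onD[OF s y1(2) b] bound[OF x1(2)] bound[OF y1(2)]
          by (auto simp: x1 y1)
        then show ?thesis using C(2) by (simp add: p D_def)
      qed
    next
      case x1: (high x')
      from ab y show ?thesis
      proof (cases rule: preimage_cases)
        case y1: (low y')
        then have "y = x" using x1(1) y1(1) xy by linarith
        then show ?thesis using C(2) by (simp add: p D_def)
      next
        case y1: (high y')
        have "D (x', y') \<le> C" using xy x1 y1 by (intro C) (auto simp: T_def)
        then show ?thesis using jensen_onD[OF s x1(2) b] jensen_onD[OF s y1(2) b]
          by (simp add: p D_def x1 y1 field_simps)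
      qed
    qed
  qed (use p in auto)
  then show ?thesis by (auto intro!: mono_onI simp: D_def T_def)
qed

text \<open>A flat piece cannot end: if \<open>s\<close> is constant from \<open>x\<close> up to
  \<open>c\<close>, a point \<open>z\<close> beyond \<open>c\<close> with \<open>m x z\<close> still
  before \<open>c\<close> satisfies \<open>s (m x z) = s x\<close>, and the midpoint equation gives
  \<open>s z = s x\<close>. So flatness spreads to both ends, against
  \<open>s a < s b\<close>.\<close>

lemma jensen_strict_mono_on:
  assumes s: "jensen_on {a..b} s" and mono: "mono_on {a..b} s" and ab: "a < b" "s a < s b"
  shows "strict_mono_on {a..b} s"
proof (rule strict_mono_onI, rule ccontr)
  fix x y assume x: "x \<in> {a..b}" and y: "y \<in> {a..b}" and xy: "x < y" and "\<not> s x < s y"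
  then have eq: "s x = s y" using mono_onD[OF mono x y] by simp
  have "s b = s x"
  proof -
    define Y where "Y = {y \<in> {a..b}. s y = s x}"
    define c where "c = Sup Y"
    have bdd: "bdd_above Y" by (auto simp: Y_def)
    have "y \<in> Y" using y eq by (simp add: Y_def)
    have "c \<le> b" unfolding c_def by (rule cSup_least) (use \<open>y \<in> Y\<close> in \<open>auto simp: Y_def\<close>)
    moreover have "y \<le> c" unfolding c_def by (rule cSup_upper[OF \<open>y \<in> Y\<close> bdd])
    ultimately have c: "x < c" "c \<le> b" using xy by simp_all
    \<comment> \<open>At \<open>c = b\<close> nothing lies beyond, and \<open>z = b\<close> serves;
      otherwise \<open>z\<close> exists by continuity of the mean, as
      \<open>m x c < c\<close>.\<close>
    obtain z where z: "c \<le> z" "z \<le> b" "m x z < c" "z = b \<or> c < z"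
    proof (cases "c = b")
      case True
      then show ?thesis using that[of b] internal[OF c(1)] by auto
    next
      case False
      have "((\<lambda>z. m x z) \<longlongrightarrow> m x c) (at c)"
        using cont[of x] by (simp add: commute[of x] continuous_on_eq_continuous_at isCont_def)
      then have "eventually (\<lambda>z. m x z < c) (at c)"
        by (rule order_tendstoD) (rule internal[OF c(1)])
      then have "eventually (\<lambda>z. m x z < c) (at_right c)" by (simp add: eventually_at_split)
      moreover have "eventually (\<lambda>z. z \<in> {c<..<b}) (at_right c)"
        using False c by (intro eventually_at_rightI[of c b]) auto
      ultimately have "eventually (\<lambda>z. m x z < c \<and> z \<in> {c<..<b}) (at_right c)" by eventually_elim simp
      then obtain z where "m x z < c \<and> z \<in> {c<..<b}"
        using eventually_happens'[OF trivial_limit_at_right_real] by blast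
      then show ?thesis using that[of z] by auto
    qed
    \<comment> \<open>The supremum \<open>c\<close> need not be attained, so
      \<open>s (m x z)\<close> is bounded by \<open>s w\<close> for some \<open>w\<close> in
      \<open>Y\<close> above \<open>m x z\<close>.\<close>
    obtain w where w: "w \<in> Y" "m x z < w"
      using less_cSup_iff[OF _ bdd, of "m x z"] \<open>y \<in> Y\<close> z(3) unfolding c_def by blast
    have zi: "z \<in> {a..b}" and "x < z" using c z x by auto
    then have mi: "m x z \<in> {a..b}" "x < m x z" using in_interval[OF x zi] internal by auto
    then have "s (m x z) = s x"
      using mono_onD[OF mono x mi(1)] mono_onD[OF mono mi(1), of w] w by (auto simp: Y_def)
    then have sz: "s z = s x" using jensen_onD[OF s x zi] by simp
    then have "z \<in> Y" using zi by (simp add: Y_def)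
    then have "z \<le> c" unfolding c_def by (rule cSup_upper[OF _ bdd])
    then show ?thesis using z sz by auto
  qed
  \<comment> \<open>The same argument at the infimum, spreading flatness down to
    \<open>a\<close>.\<close>
  moreover have "s a = s y"
  proof -
    define Y where "Y = {x \<in> {a..b}. s x = s y}"
    define c where "c = Inf Y"
    have bdd: "bdd_below Y" by (auto simp: Y_def)
    have "x \<in> Y" using x eq by (simp add: Y_def)
    have "a \<le> c" unfolding c_def by (rule cInf_greatest) (use \<open>x \<in> Y\<close> in \<open>auto simp: Y_def\<close>)
    moreover have "c \<le> x" unfolding c_def by (rule cInf_lower[OF \<open>x \<in> Y\<close> bdd])
    ultimately have c: "c < y" "a \<le> c" using xy by simp_all
    obtain z where z: "z \<le> c" "a \<le> z" "c < m y z" "z = a \<or> z < c"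
    proof (cases "c = a")
      case True
      then show ?thesis using that[of a] internal[OF c(1)] by (auto simp: commute)
    next
      case False
      have "((\<lambda>z. m y z) \<longlongrightarrow> m y c) (at c)"
        using cont[of y] by (simp add: commute[of y] continuous_on_eq_continuous_at isCont_def)
      then have "eventually (\<lambda>z. c < m y z) (at c)"
        by (rule order_tendstoD) (use internal[OF c(1)] in \<open>simp add: commute\<close>)
      then have "eventually (\<lambda>z. c < m y z) (at_left c)" by (simp add: eventually_at_split)
      moreover have "eventually (\<lambda>z. z \<in> {a<..<c}) (at_left c)"
        using False c by (intro eventually_at_leftI[of a c]) auto
      ultimately have "eventually (\<lambda>z. c < m y z \<and> z \<in> {a<..<c}) (at_left c)" by eventually_elim simp
      then obtain z where "c < m y z \<and> z \<in> {a<..<c}"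
        using eventually_happens'[OF trivial_limit_at_left_real] by blast
      then show ?thesis using that[of z] by auto
    qed
    obtain w where w: "w \<in> Y" "w < m y z"
      using cInf_less_iff[OF _ bdd, of "m y z"] \<open>x \<in> Y\<close> z(3) unfolding c_def by blast
    have zi: "z \<in> {a..b}" and "z < y" using c z y by auto
    then have mi: "m y z \<in> {a..b}" "m y z < y"
      using in_interval[OF y zi] internal(2)[of z y] by (simp_all add: commute[of y z])
    then have "s (m y z) = s y"
      using mono_onD[OF mono mi(1) y] mono_onD[OF mono _ mi(1), of w] w by (auto simp: Y_def)
    then have sz: "s z = s y" using jensen_onD[OF s y zi] by simp
    then have "z \<in> Y" using zi by (simp add: Y_def)
    then have "c \<le> z" unfolding c_def by (rule cInf_lower[OF _ bdd])
    then show ?thesis using z sz by auto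
  qed
  ultimately show False using ab eq by simp
qed

text \<open>A one-sided limit \<open>L\<close> at \<open>x\<close> satisfies \<open>L = (s x + L) / 2\<close>, so there are no jumps.\<close>

lemma jensen_isCont:
  assumes s: "jensen_on UNIV s" and mono: "mono s"
  shows "isCont s x"
proof -
  define L where "L = Inf (s ` {x<..})"
  define U where "U = Sup (s ` {..<x})"
  have ne: "s ` {x<..} \<noteq> {}" "s ` {..<x} \<noteq> {}" by auto
  have bb: "bdd_below (s ` {x<..})" by (rule bdd_belowI[of _ "s x"]) (auto intro: monoD[OF mono])
  have ba: "bdd_above (s ` {..<x})" by (rule bdd_aboveI[of _ "s x"]) (auto intro: monoD[OF mono])
  have "2 * L - s x \<le> s y" if "x < y" for y
  proof -
    have "L \<le> s (m x y)" using bb internal[OF that] by (auto simp: L_def intro: cInf_lower)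
    then show ?thesis using jensen_onD[OF s, of x y] by simp
  qed
  then have "2 * L - s x \<le> Inf (s ` {x<..})" using ne(1) by (intro cInf_greatest) auto
  then have L: "L \<le> s x" by (simp add: L_def[symmetric])
  have "s y \<le> 2 * U - s x" if "y < x" for y
  proof -
    have "s (m y x) \<le> U" using ba internal[OF that] by (auto simp: U_def intro: cSup_upper)
    then show ?thesis using jensen_onD[OF s, of y x] by simp
  qed
  then have "Sup (s ` {..<x}) \<le> 2 * U - s x" using ne(2) by (intro cSup_least) auto
  then have U: "s x \<le> U" by (simp add: U_def[symmetric])
  show ?thesis unfolding isCont_def
  proof (rule order_tendstoI)
    fix c assume "c < s x"
    then have "c < U" using U by simp
    then obtain z where "z < x" "c < s z"
      using less_cSup_iff[OF ne(2) ba, of c] by (auto simp: U_def)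
    then have "eventually (\<lambda>y. z < y) (at x)" by (auto intro: order_tendstoD tendsto_ident_at)
    then show "eventually (\<lambda>y. c < s y) (at x)"
      by eventually_elim (use \<open>c < s z\<close> monoD[OF mono] in \<open>meson less_le_trans less_imp_le\<close>)
  next
    fix c assume "s x < c"
    then have "L < c" using L by simp
    then obtain z where "x < z" "s z < c"
      using cInf_less_iff[OF ne(1) bb, of c] by (auto simp: L_def)
    then have "eventually (\<lambda>y. y < z) (at x)" by (auto intro: order_tendstoD tendsto_ident_at)
    then show "eventually (\<lambda>y. s y < c) (at x)"
      by eventually_elim (use \<open>s z < c\<close> monoD[OF mono] in \<open>meson le_less_trans less_imp_le\<close>)
  qed
qed

section \<open>A utility on the whole line\<close>

text \<open>Solutions on growing intervals become compatible once they are normalised at 0 and 1,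
  because \<open>jensen_unique\<close> leaves only the freedom of the two end values.\<close>

lemma jensen_utility:
  obtains u where "strict_mono u" "continuous_on UNIV u" "jensen_on UNIV u" "u 0 = 0"
proof -
  \<comment> \<open>\<open>Suc n\<close> keeps 0 and 1 inside every interval, as the normalisation
    below requires.\<close>
  define I :: "nat \<Rightarrow> real set" where "I n = {- real (Suc n)..real (Suc n)}" for n
  have "\<exists>s. jensen_on (I n) s \<and> strict_mono_on (I n) s \<and> (\<forall>x\<in>I n. s x \<in> {0..1})
      \<and> s (- real (Suc n)) = 0 \<and> s (real (Suc n)) = 1" for n
  proof -
    have lt: "- real (Suc n) < real (Suc n)" by simp
    obtain s where s: "jensen_on (I n) s" "\<And>x. x \<in> I n \<Longrightarrow> s x \<in> {0..1}"
      "s (- real (Suc n)) = 0" "s (real (Suc n)) = 1"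
      using jensen_exists[OF lt] unfolding I_def by blast
    have "mono_on (I n) s" unfolding I_def
      by (rule jensen_mono_on) (use s lt in \<open>auto simp: I_def\<close>)
    then have "strict_mono_on (I n) s" using s lt unfolding I_def
      by (intro jensen_strict_mono_on) auto
    with s show ?thesis by blast
  qed
  then obtain S where J: "\<And>n. jensen_on (I n) (S n)" and M: "\<And>n. strict_mono_on (I n) (S n)"
    and B: "\<And>n x. x \<in> I n \<Longrightarrow> S n x \<in> {0..1}"
    and E: "\<And>n. S n (- real (Suc n)) = 0" "\<And>n. S n (real (Suc n)) = 1"
    by metis
  have I01: "0 \<in> I n" "1 \<in> I n" for n by (auto simp: I_def)
  have pos: "0 < S n 1 - S n 0" for n using strict_mono_onD[OF M I01] by simp
  define U where "U n x = (S n x - S n 0) / (S n 1 - S n 0)" for n x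
  have U_agree: "U k x = U n x" if "n \<le> k" "x \<in> I n" for n k x
  proof -
    have sub: "I n \<subseteq> I k" using that by (auto simp: I_def)
    define p q where "p = - real (Suc n)" and "q = real (Suc n)"
    have pq: "p \<in> I n" "q \<in> I n" "p < q" by (auto simp: I_def p_def q_def)
    define d where "d = S k q - S k p"
    have d: "0 < d" using strict_mono_onD[OF M, of p k q] pq sub by (auto simp: d_def)
    \<comment> \<open>\<open>t\<close> is the solution on the larger interval, rescaled to the
      values 0 and 1 at the ends of the smaller one, where \<open>S n\<close> has them too.\<close>
    define t where "t x = (S k x - S k p) / d" for x
    have "jensen_on (I n) t" unfolding jensen_on_def
    proof (intro ballI)
      fix x y assume "x \<in> I n" "y \<in> I n"
      then have "S k (m x y) = (S k x + S k y) / 2" using jensen_onD[OF J] sub by blast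
      then show "t (m x y) = (t x + t y) / 2" by (simp add: t_def diff_divide_distrib add_divide_distrib)
    qed
    have eq: "S n y = t y" if "y \<in> I n" for y
    proof (rule jensen_unique[of p q "S n" t 1 y])
      show "jensen_on {p..q} (S n)" "jensen_on {p..q} t" "y \<in> {p..q}"
        using \<open>jensen_on (I n) t\<close> J[of n] that by (auto simp: I_def p_def q_def)
      show "S n p = t p" "S n q = t q" using E d by (auto simp: t_def p_def q_def d_def)
      fix x assume "x \<in> {p..q}"
      then have xn: "x \<in> I n" by (auto simp: I_def p_def q_def)
      then have "S k p \<le> S k x" "S k x \<le> S k q"
        using strict_mono_on_leD[OF M, of p k x] strict_mono_on_leD[OF M, of x k q] pq sub
        by (auto simp: I_def p_def q_def)
      then have "t x \<in> {0..1}" using d by (auto simp: t_def d_def)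
      then show "\<bar>S n x - t x\<bar> \<le> 1" using B[OF xn] by auto
    qed (use pq in auto)
    have "S n x - S n 0 = (S k x - S k 0) / d" "S n 1 - S n 0 = (S k 1 - S k 0) / d"
      using eq[OF that(2)] eq[OF I01(1)] eq[OF I01(2)] by (simp_all add: t_def diff_divide_distrib)
    then show ?thesis unfolding U_def using d by simp
  qed
  define u where "u x = U (nat \<lceil>\<bar>x\<bar>\<rceil>) x" for x
  have u_eq: "u x = U n x" if "x \<in> I n" for n x
  proof -
    define k where "k = nat \<lceil>\<bar>x\<bar>\<rceil>"
    have "\<bar>x\<bar> \<le> real k" unfolding k_def by (rule real_nat_ceiling_ge)
    then have "x \<in> I k" by (auto simp: I_def)
    then show ?thesis using U_agree[of n k x] U_agree[of k n x] that
      by (cases "n \<le> k") (simp_all add: u_def flip: k_def)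
  qed
  have common: "\<exists>n. x \<in> I n \<and> y \<in> I n" for x y
  proof -
    obtain n where "max \<bar>x\<bar> \<bar>y\<bar> \<le> real n" using real_arch_simple by blast
    then have "\<bar>x\<bar> \<le> real (Suc n)" "\<bar>y\<bar> \<le> real (Suc n)" by simp_all
    then have "x \<in> I n \<and> y \<in> I n" unfolding I_def atLeastAtMost_iff by linarith
    then show ?thesis ..
  qed
  have "strict_mono u"
  proof (rule strict_monoI)
    fix x y :: real assume "x < y"
    obtain n where n: "x \<in> I n" "y \<in> I n" using common by blast
    then have "S n x < S n y" using strict_mono_onD[OF M] \<open>x < y\<close> by blast
    then show "u x < u y" using u_eq n pos[of n] by (simp add: U_def divide_strict_right_mono)
  qed
  moreover have "jensen_on UNIV u" unfolding jensen_on_def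
  proof (intro ballI)
    fix x y :: real
    obtain n where n: "x \<in> I n" "y \<in> I n" using common by blast
    then have "m x y \<in> I n" unfolding I_def by (rule in_interval)
    moreover define d where "d = S n 1 - S n 0"
    ultimately have "u z = (S n z - S n 0) / d" if "z \<in> {x, y, m x y}" for z
      using that n u_eq by (auto simp: U_def)
    then show "u (m x y) = (u x + u y) / 2"
      by (simp add: jensen_onD[OF J n] diff_divide_distrib add_divide_distrib)
  qed
  moreover have "u 0 = 0" using u_eq[of 0 0] I01 by (simp add: U_def)
  moreover have "continuous_on UNIV u"
    using jensen_isCont[OF \<open>jensen_on UNIV u\<close> strict_mono_mono[OF \<open>strict_mono u\<close>]]
    by (simp add: continuous_on_eq_continuous_at)
  ultimately show ?thesis using that by blast
qed

end

section \<open>The Choquet integral\<close>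

lemma integrable_indicator_Icc: "integrable lborel (indicator {a..b} :: real \<Rightarrow> real)"
  by (intro integrable_real_indicator) (auto simp: emeasure_lborel_Icc_eq)

lemma integrable_indicator_Ico: "integrable lborel (indicator {a..<b} :: real \<Rightarrow> real)"
proof -
  have "emeasure lborel {a..<b} \<le> emeasure lborel {a..b}" by (rule emeasure_mono) auto
  also have "\<dots> < \<infinity>" by (simp add: emeasure_lborel_Icc_eq)
  finally show ?thesis by (intro integrable_real_indicator) auto
qed

text \<open>Acts without the extensionality condition, so that sums and compositions need no
  restriction to the space.\<close>

definition bounded_measurable :: "'a measure \<Rightarrow> ('a \<Rightarrow> real) \<Rightarrow> bool" where
  "bounded_measurable F X \<longleftrightarrow> X \<in> borel_measurable F \<and> bounded (X ` space F)"

lemma bounded_measurableD: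
  assumes "bounded_measurable F X"
  obtains K where "0 < K" "\<And>\<omega>. \<omega> \<in> space F \<Longrightarrow> \<bar>X \<omega>\<bar> \<le> K"
  using assms by (auto simp: bounded_measurable_def bounded_pos)

lemma bounded_measurableI:
  assumes "X \<in> borel_measurable F" "\<And>\<omega>. \<omega> \<in> space F \<Longrightarrow> \<bar>X \<omega>\<bar> \<le> K"
  shows "bounded_measurable F X"
  using assms by (auto simp: bounded_measurable_def bounded_iff)

lemma bounded_measurable_add:
  assumes "bounded_measurable F X" "bounded_measurable F Y"
  shows "bounded_measurable F (\<lambda>\<omega>. X \<omega> + Y \<omega>)"
proof -
  obtain K where K: "\<And>\<omega>. \<omega> \<in> space F \<Longrightarrow> \<bar>X \<omega>\<bar> \<le> K" by (rule bounded_measurableD[OF assms(1)]) blast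
  obtain L where L: "\<And>\<omega>. \<omega> \<in> space F \<Longrightarrow> \<bar>Y \<omega>\<bar> \<le> L" by (rule bounded_measurableD[OF assms(2)]) blast
  have "\<bar>X \<omega> + Y \<omega>\<bar> \<le> K + L" if "\<omega> \<in> space F" for \<omega>
    using K[OF that] L[OF that] by linarith
  then show ?thesis using assms
    by (intro bounded_measurableI) (auto simp: bounded_measurable_def)
qed

lemma bounded_measurable_compose:
  assumes X: "bounded_measurable F X" and u: "continuous_on UNIV u"
  shows "bounded_measurable F (u \<circ> X)"
proof -
  have "u \<in> borel_measurable borel" using u by (rule borel_measurable_continuous_onI)
  moreover have "bounded ((u \<circ> X) ` space F)"
  proof -
    have "compact (u ` closure (X ` space F))"
      using X u by (intro compact_continuous_image)
        (auto simp: bounded_measurable_def intro: continuous_on_subset)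
    moreover have "(u \<circ> X) ` space F \<subseteq> u ` closure (X ` space F)"
      using closure_subset[of "X ` space F"] by auto
    ultimately show ?thesis using bounded_subset compact_imp_bounded by blast
  qed
  ultimately show ?thesis using X by (auto simp: bounded_measurable_def comp_def)
qed

locale monotone_capacity =
  fixes F :: "'a measure" and \<mu> :: "'a set \<Rightarrow> real"
  assumes capacity: "capacity F \<mu>"
begin

definition survival :: "('a \<Rightarrow> real) \<Rightarrow> real \<Rightarrow> real" where
  "survival X t = \<mu> {\<omega> \<in> space F. X \<omega> > t}"

lemma mu_empty [simp]: "\<mu> {} = 0" and mu_space [simp]: "\<mu> (space F) = 1"
  using capacity by (auto simp: capacity_def)

lemma mu_mono: "A \<in> sets F \<Longrightarrow> B \<in> sets F \<Longrightarrow> A \<subseteq> B \<Longrightarrow> \<mu> A \<le> \<mu> B"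
  using capacity by (auto simp: capacity_def)

lemma mu_01: "A \<in> sets F \<Longrightarrow> \<mu> A \<in> {0..1}"
  using mu_mono[of "{}" A] mu_mono[of A "space F"] sets.sets_into_space by auto

lemma survival_sets [measurable]:
  fixes X :: "'a \<Rightarrow> real"
  assumes "X \<in> borel_measurable F"
  shows "{\<omega> \<in> space F. t < X \<omega>} \<in> sets F"
  using assms by (simp add: borel_measurable_iff_greater)

lemma survival_01: "X \<in> borel_measurable F \<Longrightarrow> survival X t \<in> {0..1}"
  unfolding survival_def by (intro mu_01 survival_sets)

lemma survival_antimono: "X \<in> borel_measurable F \<Longrightarrow> antimono (survival X)"
  unfolding survival_def by (intro antimonoI mu_mono survival_sets) auto

lemma survival_mono:
  assumes "X \<in> borel_measurable F" "Y \<in> borel_measurable F" "\<And>\<omega>. \<omega> \<in> space F \<Longrightarrow> X \<omega> \<le> Y \<omega>"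
  shows "survival X t \<le> survival Y t"
  unfolding survival_def using assms by (intro mu_mono survival_sets) (auto intro: less_le_trans)

lemma survival_1: "(\<And>\<omega>. \<omega> \<in> space F \<Longrightarrow> t < X \<omega>) \<Longrightarrow> survival X t = 1"
  by (simp add: survival_def cong: conj_cong)

lemma survival_0: "(\<And>\<omega>. \<omega> \<in> space F \<Longrightarrow> X \<omega> \<le> t) \<Longrightarrow> survival X t = 0"
  by (simp add: survival_def not_less[symmetric] cong: conj_cong)

lemma survival_measurable:
  assumes "X \<in> borel_measurable F" shows "survival X \<in> borel_measurable borel"
proof -
  have "mono (\<lambda>t. - survival X t)" using survival_antimono[OF assms] by (auto simp: mono_def antimono_def)
  then have "(\<lambda>t. - (- survival X t)) \<in> borel_measurable borel"
    by (intro borel_measurable_uminus borel_measurable_mono)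
  then show ?thesis by simp
qed

lemma survival_integrable:
  assumes "X \<in> borel_measurable F" shows "set_integrable lborel {a..b} (survival X)"
  unfolding set_integrable_def
proof (rule Bochner_Integration.integrable_bound[of lborel "indicator {a..b} :: real \<Rightarrow> real"])
  show "integrable lborel (indicator {a..b} :: real \<Rightarrow> real)" by (rule integrable_indicator_Icc)
  show "(\<lambda>t. indicator {a..b} t *\<^sub>R survival X t) \<in> borel_measurable lborel"
    using survival_measurable[OF assms] by simp
  show "AE t in lborel. norm (indicator {a..b} t *\<^sub>R survival X t) \<le> norm (indicator {a..b} t :: real)"
    using survival_01[OF assms] by (auto simp: indicator_def)
qed

text \<open>Survival is 1 below \<open>-K\<close> and 0 from \<open>K\<close> on, so the two
  improper integrals merge into one over a compact interval. Later estimates start from this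
  form.\<close>

lemma choquet_eq:
  assumes X: "X \<in> borel_measurable F" and K: "\<And>\<omega>. \<omega> \<in> space F \<Longrightarrow> \<bar>X \<omega>\<bar> \<le> K" and "0 \<le> K"
  shows "choquet F \<mu> X = (LINT t:{-K..K}|lborel. survival X t) - K"
proof -
  have hi: "survival X t = 0" if "K \<le> t" for t
    using K that by (intro survival_0) force
  have lo: "survival X t = 1" if "t < -K" for t
    using K that by (intro survival_1) force
  let ?f = "\<lambda>t. indicator {0..} t *\<^sub>R survival X t" and ?g = "\<lambda>t. indicator {..0} t *\<^sub>R (survival X t - 1)"
  let ?h = "\<lambda>t. indicator {-K..K} t *\<^sub>R survival X t" and ?k = "\<lambda>t. indicator {-K..0} t :: real"
  have f: "?f = (\<lambda>t. indicator {0..K} t *\<^sub>R survival X t)"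
    using hi by (auto simp: fun_eq_iff indicator_def)
  have g: "?g = (\<lambda>t. indicator {-K..0} t *\<^sub>R survival X t - indicator {-K..0} t)"
    using lo by (auto simp: fun_eq_iff indicator_def)
  have int: "integrable lborel (\<lambda>t. indicator {a..b} t *\<^sub>R survival X t)" for a b
    using survival_integrable[OF X] unfolding set_integrable_def .
  have intk: "integrable lborel ?k" by (rule integrable_indicator_Icc)
  have intf: "integrable lborel ?f" unfolding f by (rule int)
  have intg: "integrable lborel ?g" unfolding g by (intro Bochner_Integration.integrable_diff int intk)
  have "choquet F \<mu> X = integral\<^sup>L lborel ?f + integral\<^sup>L lborel ?g"
    by (simp add: choquet_def set_lebesgue_integral_def survival_def)
  also have "\<dots> = integral\<^sup>L lborel (\<lambda>t. ?f t + ?g t)"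
    by (rule Bochner_Integration.integral_add[OF intf intg, symmetric])
  also have "\<dots> = integral\<^sup>L lborel (\<lambda>t. ?h t - ?k t)"
  \<comment> \<open>The point 0 belongs to both half-lines in the definition, hence equality only
    almost everywhere.\<close>
  proof (rule integral_cong_AE)
    show "(\<lambda>t. ?f t + ?g t) \<in> borel_measurable lborel" "(\<lambda>t. ?h t - ?k t) \<in> borel_measurable lborel"
      using survival_measurable[OF X] by auto
    have "AE t in lborel. t \<noteq> (0::real)" by (rule AE_lborel_singleton)
    then show "AE t in lborel. ?f t + ?g t = ?h t - ?k t"
      by eventually_elim (use hi lo \<open>0 \<le> K\<close> in \<open>auto simp: indicator_def\<close>)
  qed
  also have "\<dots> = integral\<^sup>L lborel ?h - K"
    using \<open>0 \<le> K\<close> by (simp only: Bochner_Integration.integral_diff[OF int intk]) simp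
  finally show ?thesis by (simp add: set_lebesgue_integral_def)
qed

lemma choquet_cong:
  assumes "\<And>\<omega>. \<omega> \<in> space F \<Longrightarrow> X \<omega> = Y \<omega>"
  shows "choquet F \<mu> X = choquet F \<mu> Y"
proof -
  have "{\<omega> \<in> space F. X \<omega> > t} = {\<omega> \<in> space F. Y \<omega> > t}" for t using assms by auto
  then show ?thesis by (simp add: choquet_def)
qed

text \<open>The extra parameter \<open>L\<close> lets \<open>choquet_strict\<close> enlarge the
  bound until it covers the interval of the gap.\<close>

lemma common_bound:
  assumes "bounded_measurable F X" "bounded_measurable F Y"
  obtains K where "0 < K" "\<And>\<omega>. \<omega> \<in> space F \<Longrightarrow> \<bar>X \<omega>\<bar> \<le> K" "\<And>\<omega>. \<omega> \<in> space F \<Longrightarrow> \<bar>Y \<omega>\<bar> \<le> K" "L \<le> K"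
proof -
  obtain K1 where 1: "0 < K1" "\<And>\<omega>. \<omega> \<in> space F \<Longrightarrow> \<bar>X \<omega>\<bar> \<le> K1" by (rule bounded_measurableD[OF assms(1)]) blast
  obtain K2 where 2: "0 < K2" "\<And>\<omega>. \<omega> \<in> space F \<Longrightarrow> \<bar>Y \<omega>\<bar> \<le> K2" by (rule bounded_measurableD[OF assms(2)]) blast
  show ?thesis
  proof (rule that[of "max L (max K1 K2)"])
    show "0 < max L (max K1 K2)" "L \<le> max L (max K1 K2)" using 1(1) by auto
    show "\<bar>X \<omega>\<bar> \<le> max L (max K1 K2)" "\<bar>Y \<omega>\<bar> \<le> max L (max K1 K2)" if "\<omega> \<in> space F" for \<omega>
      using 1(2)[OF that] 2(2)[OF that] by auto
  qed
qed

text \<open>Only the survival functions enter the integral. This form also serves acts that are not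
  ordered pointwise, as in RC.\<close>

lemma choquet_mono_survival:
  assumes X: "bounded_measurable F X" and Y: "bounded_measurable F Y"
    and le: "\<And>t. survival X t \<le> survival Y t"
  shows "choquet F \<mu> X \<le> choquet F \<mu> Y"
proof -
  obtain K where K: "0 < K" "\<And>\<omega>. \<omega> \<in> space F \<Longrightarrow> \<bar>X \<omega>\<bar> \<le> K" "\<And>\<omega>. \<omega> \<in> space F \<Longrightarrow> \<bar>Y \<omega>\<bar> \<le> K"
    by (rule common_bound[OF X Y, of 0]) blast
  have m: "X \<in> borel_measurable F" "Y \<in> borel_measurable F" using X Y by (auto simp: bounded_measurable_def)
  have "(LINT t:{-K..K}|lborel. survival X t) \<le> (LINT t:{-K..K}|lborel. survival Y t)"
    by (intro set_integral_mono survival_integrable m le)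
  then show ?thesis using choquet_eq[OF m(1), of K] choquet_eq[OF m(2), of K] K by simp
qed

lemma choquet_mono:
  assumes X: "bounded_measurable F X" and Y: "bounded_measurable F Y"
    and le: "\<And>\<omega>. \<omega> \<in> space F \<Longrightarrow> X \<omega> \<le> Y \<omega>"
  shows "choquet F \<mu> X \<le> choquet F \<mu> Y"
  using assms by (intro choquet_mono_survival survival_mono) (auto simp: bounded_measurable_def)

text \<open>A gap of at least \<open>e\<close> over an interval of length \<open>q - p\<close> adds
  at least \<open>e * (q - p)\<close> to the integral; a gap at a single level would be
  lost.\<close>

lemma choquet_strict:
  assumes X: "bounded_measurable F X" and Y: "bounded_measurable F Y"
    and le: "\<And>t. survival X t \<le> survival Y t"
    and gap: "p < q" "0 < e" "\<And>t. p \<le> t \<Longrightarrow> t \<le> q \<Longrightarrow> survival X t + e \<le> survival Y t"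
  shows "choquet F \<mu> X < choquet F \<mu> Y"
proof -
  obtain K where K: "0 < K" "\<And>\<omega>. \<omega> \<in> space F \<Longrightarrow> \<bar>X \<omega>\<bar> \<le> K" "\<And>\<omega>. \<omega> \<in> space F \<Longrightarrow> \<bar>Y \<omega>\<bar> \<le> K"
    "max \<bar>p\<bar> \<bar>q\<bar> \<le> K"
    by (rule common_bound[OF X Y, of "max \<bar>p\<bar> \<bar>q\<bar>"]) blast
  have m: "X \<in> borel_measurable F" "Y \<in> borel_measurable F" using X Y by (auto simp: bounded_measurable_def)
  have int: "integrable lborel (\<lambda>t. indicator {-K..K} t *\<^sub>R survival X t)"
     "integrable lborel (\<lambda>t. indicator {-K..K} t *\<^sub>R survival Y t)"
     "integrable lborel (\<lambda>t. e * indicator {p..q} t)"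
    using survival_integrable[OF m(1)] survival_integrable[OF m(2)] integrable_indicator_Icc[of p q]
    unfolding set_integrable_def by auto
  have "(LINT t:{-K..K}|lborel. survival X t) + e * (q - p)
      = integral\<^sup>L lborel (\<lambda>t. indicator {-K..K} t *\<^sub>R survival X t + e * indicator {p..q} t)"
    unfolding set_lebesgue_integral_def using int gap
    by (subst Bochner_Integration.integral_add) auto
  also have "\<dots> \<le> (LINT t:{-K..K}|lborel. survival Y t)"
    unfolding set_lebesgue_integral_def
  proof (intro integral_mono Bochner_Integration.integrable_add int)
    fix t
    have "t \<in> {p..q} \<Longrightarrow> t \<in> {-K..K}" using K(4) by auto
    then show "indicator {-K..K} t *\<^sub>R survival X t + e * indicator {p..q} t
        \<le> indicator {-K..K} t *\<^sub>R survival Y t"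
      using le[of t] gap(3)[of t] by (auto simp: indicator_def)
  qed
  finally have "(LINT t:{-K..K}|lborel. survival X t) + e * (q - p) \<le> (LINT t:{-K..K}|lborel. survival Y t)" .
  moreover have "0 < e * (q - p)" using gap by simp
  ultimately show ?thesis using choquet_eq[OF m(1), of K] choquet_eq[OF m(2), of K] K by simp
qed

lemma choquet_binary:
  assumes A: "A \<in> sets F" and xy: "y \<le> x"
  shows "choquet F \<mu> (\<lambda>\<omega>. if \<omega> \<in> A then x else y) = y + (x - y) * \<mu> A"
proof -
  define K where "K = max \<bar>x\<bar> \<bar>y\<bar>"
  let ?X = "\<lambda>\<omega>. if \<omega> \<in> A then x else y"
  have m: "?X \<in> borel_measurable F" using A by measurable
  have K: "\<bar>?X \<omega>\<bar> \<le> K" for \<omega> by (auto simp: K_def)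
  have "survival ?X t = (if t < y then 1 else if t < x then \<mu> A else 0)" for t
  proof -
    consider "t < y" | "y \<le> t" "t < x" | "x \<le> t" by linarith
    then show ?thesis
    proof cases
      case 1
      then show ?thesis using xy survival_1[of t ?X] by auto
    next
      case 2
      then have "{\<omega> \<in> space F. t < ?X \<omega>} = A" using sets.sets_into_space[OF A] by auto
      then show ?thesis using 2 by (simp add: survival_def)
    next
      case 3
      then show ?thesis using xy survival_0[of ?X t] by auto
    qed
  qed
  \<comment> \<open>Half-open intervals match the strict inequality in the survival
    function.\<close>
  then have "indicator {-K..K} t *\<^sub>R survival ?X t = indicator {-K..<y} t + \<mu> A * indicator {y..<x} t" for t
    using xy by (auto simp: indicator_def K_def)
  then have "(LINT t:{-K..K}|lborel. survival ?X t) =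
     integral\<^sup>L lborel (\<lambda>t. indicator {-K..<y} t + \<mu> A * indicator {y..<x} t)"
    by (simp add: set_lebesgue_integral_def)
  also have "\<dots> = (y + K) + \<mu> A * (x - y)"
  proof -
    have "-K \<le> y" by (auto simp: K_def)
    then show ?thesis using xy
      by (subst Bochner_Integration.integral_add) (auto intro: integrable_indicator_Ico)
  qed
  finally have "(LINT t:{-K..K}|lborel. survival ?X t) = (y + K) + \<mu> A * (x - y)" .
  moreover have "0 \<le> K" by (simp add: K_def)
  ultimately show ?thesis using choquet_eq[OF m K] by (simp add: algebra_simps)
qed

lemma choquet_const: "choquet F \<mu> (\<lambda>\<omega>. c) = c"
  using choquet_binary[of "space F" c c] by simp

end

section \<open>Limits under a continuous capacity\<close>

locale continuous_capacity_space =
  fixes F :: "'a measure" and \<mu> :: "'a set \<Rightarrow> real"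
  assumes continuous_capacity: "continuous_capacity F \<mu>"
begin

sublocale monotone_capacity
  using continuous_capacity by unfold_locales (simp add: continuous_capacity_def)

lemma mu_incseq: "range A \<subseteq> sets F \<Longrightarrow> incseq A \<Longrightarrow> (\<lambda>n::nat. \<mu> (A n)) \<longlonglongrightarrow> \<mu> (\<Union>n. A n)"
  and mu_decseq: "range A \<subseteq> sets F \<Longrightarrow> decseq A \<Longrightarrow> (\<lambda>n::nat. \<mu> (A n)) \<longlonglongrightarrow> \<mu> (\<Inter>n. A n)"
  using continuous_capacity by (auto simp: continuous_capacity_def)

text \<open>Continuity from below, applied to the lower limit of the events, gives the lower bound.
  The upper limit of the events \<open>t < Xs n\<close> is only contained in the event that
  \<open>X\<close> is at least \<open>t\<close>, so the upper bound passes through a level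
  \<open>s < t\<close>, where continuity of the survival function at \<open>t\<close> keeps the
  value below \<open>c\<close>.\<close>

lemma survival_tendsto:
  assumes Xs: "\<And>n::nat. Xs n \<in> borel_measurable F" and X: "X \<in> borel_measurable F"
    and lim: "\<And>\<omega>. \<omega> \<in> space F \<Longrightarrow> (\<lambda>n. Xs n \<omega>) \<longlonglongrightarrow> X \<omega>"
    and cont: "isCont (survival X) t"
  shows "(\<lambda>n. survival (Xs n) t) \<longlonglongrightarrow> survival X t"
proof (rule order_tendstoI)
  fix c assume c: "c < survival X t"
  define B where "B n = (\<Inter>k\<in>{n..}. {\<omega> \<in> space F. t < Xs k \<omega>})" for n
  have B: "range B \<subseteq> sets F" unfolding B_def by (auto intro!: sets.countable_INT' survival_sets Xs)
  have "incseq B" unfolding incseq_def B_def by auto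
  have "{\<omega> \<in> space F. t < X \<omega>} \<subseteq> (\<Union>n. B n)"
  proof
    fix \<omega> assume \<omega>: "\<omega> \<in> {\<omega> \<in> space F. t < X \<omega>}"
    then have "eventually (\<lambda>n. t < Xs n \<omega>) sequentially" using lim order_tendstoD(1) by blast
    then obtain n where "\<forall>k\<ge>n. t < Xs k \<omega>" unfolding eventually_sequentially by blast
    then show "\<omega> \<in> (\<Union>n. B n)" using \<omega> by (auto simp: B_def intro!: exI[of _ n])
  qed
  then have "survival X t \<le> \<mu> (\<Union>n. B n)" unfolding survival_def
    using B by (intro mu_mono survival_sets X) auto
  then have "eventually (\<lambda>n. c < \<mu> (B n)) sequentially"
    using order_tendstoD(1)[OF mu_incseq[OF B \<open>incseq B\<close>], of c] c by simp
  then show "eventually (\<lambda>n. c < survival (Xs n) t) sequentially"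
  proof eventually_elim
    case (elim n)
    have "\<mu> (B n) \<le> survival (Xs n) t" unfolding survival_def
      using B by (intro mu_mono survival_sets Xs) (auto simp: B_def)
    with elim show ?case by simp
  qed
next
  fix c assume c: "survival X t < c"
  have "eventually (\<lambda>s. survival X s < c) (at t)"
    using cont c unfolding isCont_def by (rule order_tendstoD(2))
  then have "eventually (\<lambda>s. survival X s < c) (at_left t)" by (simp add: eventually_at_split)
  then have "eventually (\<lambda>s. survival X s < c \<and> s < t) (at_left t)"
    by (rule eventually_conj) (auto intro: eventually_at_leftI[of "t - 1"])
  then obtain s where s: "survival X s < c" "s < t"
    using eventually_happens'[OF trivial_limit_at_left_real] by blast
  define B where "B n = (\<Union>k\<in>{n..}. {\<omega> \<in> space F. t < Xs k \<omega>})" for n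
  have B: "range B \<subseteq> sets F" unfolding B_def by (auto intro!: sets.countable_UN' survival_sets Xs)
  have "decseq B" unfolding decseq_def B_def by (intro allI impI UN_mono) auto
  have "(\<Inter>n. B n) \<subseteq> {\<omega> \<in> space F. s < X \<omega>}"
  proof
    fix \<omega> assume \<omega>: "\<omega> \<in> (\<Inter>n. B n)"
    then have sp: "\<omega> \<in> space F" by (auto simp: B_def)
    have "s < X \<omega>"
    proof (rule ccontr)
      assume "\<not> s < X \<omega>"
      then have "X \<omega> < t" using s by simp
      then have "eventually (\<lambda>n. Xs n \<omega> < t) sequentially" using lim[OF sp] order_tendstoD(2) by blast
      then obtain n where "\<forall>k\<ge>n. Xs k \<omega> < t" unfolding eventually_sequentially by blast
      moreover have "\<omega> \<in> B n" using \<omega> by auto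
      ultimately show False by (force simp: B_def)
    qed
    with sp show "\<omega> \<in> {\<omega> \<in> space F. s < X \<omega>}" by simp
  qed
  then have "\<mu> (\<Inter>n. B n) \<le> survival X s" unfolding survival_def
    using B by (intro mu_mono survival_sets X sets.countable_INT) auto
  then have "eventually (\<lambda>n. \<mu> (B n) < c) sequentially"
    using order_tendstoD(2)[OF mu_decseq[OF B \<open>decseq B\<close>], of c] s by simp
  then show "eventually (\<lambda>n. survival (Xs n) t < c) sequentially"
  proof eventually_elim
    case (elim n)
    have "survival (Xs n) t \<le> \<mu> (B n)" unfolding survival_def
      using B by (intro mu_mono survival_sets Xs) (auto simp: B_def)
    with elim show ?case by simp
  qed
qed

lemma survival_AE_isCont:
  assumes X: "X \<in> borel_measurable F"
  shows "AE t in lborel. isCont (survival X) t"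
proof -
  have "mono (\<lambda>t. - survival X t)" using survival_antimono[OF X] by (auto simp: mono_def antimono_def)
  then have "countable {t. \<not> isCont (\<lambda>t. - survival X t) t}" by (rule mono_ctble_discont)
  moreover have "isCont (\<lambda>t. - survival X t) t \<longleftrightarrow> isCont (survival X) t" for t
    using continuous_minus[of "at t" "\<lambda>t. - survival X t"] continuous_minus[of "at t" "survival X"] by auto
  ultimately have "countable {t. \<not> isCont (survival X) t}" by simp
  then have "{t. \<not> isCont (survival X) t} \<in> null_sets lborel" by (rule countable_imp_null_set_lborel)
  then show ?thesis by (rule AE_I') auto
qed

text \<open>A monotone survival function has at most countably many discontinuities, so the
  integrands converge almost everywhere, and all of them are dominated on one compact
  interval.\<close>

lemma choquet_tendsto:
  assumes Xs: "\<And>n::nat. Xs n \<in> borel_measurable F" and X: "X \<in> borel_measurable F"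
    and lim: "\<And>\<omega>. \<omega> \<in> space F \<Longrightarrow> (\<lambda>n. Xs n \<omega>) \<longlonglongrightarrow> X \<omega>"
    and bound: "\<And>n \<omega>. \<omega> \<in> space F \<Longrightarrow> \<bar>Xs n \<omega>\<bar> \<le> K"
  shows "(\<lambda>n. choquet F \<mu> (Xs n)) \<longlonglongrightarrow> choquet F \<mu> X"
proof -
  define L where "L = max K 0"
  have L: "0 \<le> L" "\<And>n \<omega>. \<omega> \<in> space F \<Longrightarrow> \<bar>Xs n \<omega>\<bar> \<le> L"
    using bound by (auto simp: L_def le_max_iff_disj)
  have LX: "\<bar>X \<omega>\<bar> \<le> L" if "\<omega> \<in> space F" for \<omega>
    by (rule LIMSEQ_le_const2[OF tendsto_rabs[OF lim[OF that]]]) (use L that in auto)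
  have "(\<lambda>n. LINT t|lborel. indicator {-L..L} t *\<^sub>R survival (Xs n) t)
      \<longlonglongrightarrow> (LINT t|lborel. indicator {-L..L} t *\<^sub>R survival X t)"
  proof (rule integral_dominated_convergence[where w = "indicator {-L..L}"])
    show "AE t in lborel. (\<lambda>n. indicator {-L..L} t *\<^sub>R survival (Xs n) t)
        \<longlonglongrightarrow> indicator {-L..L} t *\<^sub>R survival X t"
      using survival_AE_isCont[OF X]
      by eventually_elim (intro tendsto_scaleR tendsto_const survival_tendsto Xs X lim)
    show "AE t in lborel. norm (indicator {-L..L} t *\<^sub>R survival (Xs n) t) \<le> indicator {-L..L} t" for n
      using survival_01[OF Xs] by (auto simp: indicator_def)
  qed (use survival_measurable[OF X] survival_measurable[OF Xs] in \<open>auto intro: integrable_indicator_Icc\<close>)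
  then show ?thesis
    using choquet_eq[OF X LX L(1)] choquet_eq[OF Xs L(2) L(1)]
    by (auto simp: set_lebesgue_integral_def intro: tendsto_diff)
qed

end

section \<open>Comonotonic additivity of the Choquet integral\<close>

context continuous_capacity_space
begin

text \<open>The events at level \<open>t + 1 / (n + 1)\<close> increase to the event at level
  \<open>t\<close>, and continuity from below excludes a jump. This makes
  \<open>1 - survival X t\<close> a distribution function in \<open>t\<close>.\<close>

lemma survival_right_continuous:
  assumes X: "X \<in> borel_measurable F"
  shows "(survival X \<longlongrightarrow> survival X t) (at_right t)"
proof (rule order_tendstoI)
  fix c assume c: "survival X t < c"
  have "eventually (\<lambda>s. t < s) (at_right t)" by (simp add: eventually_at_right_less)
  then show "eventually (\<lambda>s. survival X s < c) (at_right t)"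
    by eventually_elim (use c antimonoD[OF survival_antimono[OF X]] in \<open>meson le_less_trans less_imp_le\<close>)
next
  fix c assume c: "c < survival X t"
  define B where "B n = {\<omega> \<in> space F. t + inverse (real (Suc n)) < X \<omega>}" for n
  have B: "range B \<subseteq> sets F" unfolding B_def by (auto intro: survival_sets X)
  have inc: "incseq B"
  proof (rule incseq_SucI)
    fix n
    have "inverse (real (Suc (Suc n))) \<le> inverse (real (Suc n))" by (intro le_imp_inverse_le) auto
    then have "t + inverse (real (Suc (Suc n))) < X \<omega>" if "t + inverse (real (Suc n)) < X \<omega>" for \<omega>
      using that by linarith
    then show "B n \<subseteq> B (Suc n)" unfolding B_def by blast
  qed
  have "(\<Union>n. B n) = {\<omega> \<in> space F. t < X \<omega>}"
  proof (intro set_eqI iffI)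
    fix \<omega> assume \<omega>: "\<omega> \<in> {\<omega> \<in> space F. t < X \<omega>}"
    then obtain n where "inverse (real (Suc n)) < X \<omega> - t" using reals_Archimedean[of "X \<omega> - t"] by auto
    then show "\<omega> \<in> (\<Union>n. B n)" using \<omega> by (auto simp: B_def intro!: exI[of _ n])
  next
    fix \<omega> assume "\<omega> \<in> (\<Union>n. B n)"
    then obtain n where n: "\<omega> \<in> space F" "t + inverse (real (Suc n)) < X \<omega>" by (auto simp: B_def)
    moreover have "0 < inverse (real (Suc n))" by simp
    ultimately have "t < X \<omega>" by linarith
    then show "\<omega> \<in> {\<omega> \<in> space F. t < X \<omega>}" using n by simp
  qed
  then have "eventually (\<lambda>n. c < \<mu> (B n)) sequentially"
    using order_tendstoD(1)[OF mu_incseq[OF B inc], of c] c by (simp add: survival_def)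
  then obtain n where n: "c < \<mu> (B n)" using eventually_happens'[OF sequentially_bot] by blast
  have "eventually (\<lambda>s. s < t + inverse (real (Suc n))) (at_right t)"
    by (rule eventually_at_rightI[of t "t + inverse (real (Suc n))"]) auto
  then show "eventually (\<lambda>s. c < survival X s) (at_right t)"
  proof eventually_elim
    case (elim s)
    then have "survival X (t + inverse (real (Suc n))) \<le> survival X s"
      using antimonoD[OF survival_antimono[OF X]] by simp
    then show ?case using n by (simp add: B_def survival_def)
  qed
qed

text \<open>A capacity need not be additive, but the survival function of a single act is the tail
  of a genuine probability measure on the line. Through it, additivity of the Lebesgue integral
  becomes available.\<close>

definition distribution :: "('a \<Rightarrow> real) \<Rightarrow> real measure" where
  "distribution X = interval_measure (\<lambda>t. 1 - survival X t)"

lemma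
  assumes X: "bounded_measurable F X"
  shows real_distribution_distribution: "real_distribution (distribution X)"
    and measure_distribution_greaterThan: "measure (distribution X) {t<..} = survival X t"
proof -
  let ?G = "\<lambda>t. 1 - survival X t"
  have m: "X \<in> borel_measurable F" using X by (simp add: bounded_measurable_def)
  obtain K where K: "\<And>\<omega>. \<omega> \<in> space F \<Longrightarrow> \<bar>X \<omega>\<bar> \<le> K" by (rule bounded_measurableD[OF X]) blast
  have mono: "?G s \<le> ?G t" if "s \<le> t" for s t
    using antimonoD[OF survival_antimono[OF m] that] by simp
  have rc: "continuous (at_right a) ?G" for a
    unfolding continuous_within by (intro tendsto_diff tendsto_const survival_right_continuous m)
  have bot: "(?G \<longlongrightarrow> 0) at_bot"
  proof (rule tendsto_eventually)
    show "eventually (\<lambda>t. ?G t = 0) at_bot" using eventually_gt_at_bot[of "-K"]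
    proof eventually_elim
      case (elim t)
      have "survival X t = 1"
        using elim K by (intro survival_1) force
      then show ?case by simp
    qed
  qed
  have top: "(?G \<longlongrightarrow> 1) at_top"
  proof (rule tendsto_eventually)
    show "eventually (\<lambda>t. ?G t = 1) at_top" using eventually_ge_at_top[of K]
    proof eventually_elim
      case (elim t)
      have "survival X t = 0"
        using elim K by (intro survival_0) force
      then show ?case by simp
    qed
  qed
  show rd: "real_distribution (distribution X)"
    unfolding distribution_def by (rule real_distribution_interval_measure[OF mono rc bot top])
  interpret real_distribution "distribution X" by (rule rd)
  have "measure (distribution X) {..t} = ?G t"
    using cdf_interval_measure[of ?G, OF mono rc bot] by (simp add: distribution_def cdf_def fun_eq_iff)
  moreover have "{t<..} = space (distribution X) - {..t}" by auto
  ultimately show "measure (distribution X) {t<..} = survival X t"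
    by (simp only: prob_compl[of "{..t}"] events_eq_borel borel_closed closed_atMost)
qed

text \<open>For nondecreasing continuous \<open>f\<close> the set where \<open>t < f s\<close> is
  open and closed upwards, so it is empty, everything or an open right half-line, and on these the
  distribution reproduces the capacity.\<close>

lemma measure_distribution_mono:
  assumes X: "bounded_measurable F X" and f: "mono f" "continuous_on UNIV f"
  shows "measure (distribution X) {s. t < f s} = survival (f \<circ> X) t"
proof -
  interpret real_distribution "distribution X" by (rule real_distribution_distribution[OF X])
  define S where "S = {s. t < f s}"
  have up: "r \<in> S" if "s \<in> S" "s \<le> r" for s r
    using that monoD[OF f(1), of s r] by (auto simp: S_def)
  have "open S" unfolding S_def using f(2) by (intro open_Collect_less) auto
  have "measure (distribution X) S = survival (f \<circ> X) t"
  proof (cases "S = {} \<or> S = UNIV")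
    case True
    then show ?thesis
    proof
      assume "S = {}"
      then have "survival (f \<circ> X) t = 0" by (intro survival_0) (auto simp: S_def not_less)
      then show ?thesis using \<open>S = {}\<close> by simp
    next
      assume "S = UNIV"
      then have "survival (f \<circ> X) t = 1" by (intro survival_1) (auto simp: S_def)
      then show ?thesis using \<open>S = UNIV\<close> prob_space by simp
    qed
  next
    case False
    then obtain r where "r \<notin> S" by auto
    then have bdd: "bdd_below S" using up by (intro bdd_belowI[of _ r]) (meson linear)
    define c where "c = Inf S"
    have "c \<notin> S"
    proof
      assume "c \<in> S"
      then obtain e where e: "0 < e" "\<And>y. dist y c < e \<Longrightarrow> y \<in> S"
        using \<open>open S\<close> unfolding open_dist by blast
      then have "c - e / 2 \<in> S" by (simp add: dist_real_def)
      then have "c \<le> c - e / 2" unfolding c_def by (rule cInf_lower[OF _ bdd])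
      then show False using e by simp
    qed
    have "S = {c<..}"
    proof (intro set_eqI iffI)
      fix s assume s: "s \<in> S"
      then have "c \<le> s" unfolding c_def by (rule cInf_lower[OF _ bdd])
      then show "s \<in> {c<..}" using s \<open>c \<notin> S\<close> by (cases "s = c") auto
    next
      fix s assume "s \<in> {c<..}"
      then obtain r where "r \<in> S" "r < s" using cInf_less_iff[OF _ bdd] False by (auto simp: c_def)
      then show "s \<in> S" using up by simp
    qed
    moreover have "survival (f \<circ> X) t = survival X c"
    proof -
      have "t < f (X \<omega>) \<longleftrightarrow> c < X \<omega>" for \<omega>
        using \<open>S = {c<..}\<close> by (auto simp: S_def set_eq_iff)
      then show ?thesis by (simp add: survival_def)
    qed
    ultimately show ?thesis using measure_distribution_greaterThan[OF X] by simp
  qed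
  then show ?thesis by (simp add: S_def)
qed

text \<open>A layer-cake argument: Fubini on the region \<open>E\<close> between the height
  \<open>-K\<close> and the graph of \<open>f\<close>. Its vertical sections have length
  \<open>f s + K\<close>; its horizontal section at a height \<open>t\<close> in
  \<open>{-K..K}\<close> has measure \<open>survival (f o X) t\<close>.\<close>

lemma choquet_eq_integral_distribution:
  assumes X: "bounded_measurable F X" and f: "mono f" "continuous_on UNIV f" and K: "\<And>s. \<bar>f s\<bar> \<le> K"
  shows "integrable (distribution X) f" "choquet F \<mu> (f \<circ> X) = integral\<^sup>L (distribution X) f"
proof -
  interpret real_distribution "distribution X" by (rule real_distribution_distribution[OF X])
  have K0: "0 \<le> K" using K[of 0] by simp
  have fm[measurable]: "f \<in> borel_measurable borel" using f(2) by (rule borel_measurable_continuous_onI)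
  show intf: "integrable (distribution X) f"
    by (rule integrable_const_bound[of _ K]) (use K in auto)
  have fX: "f \<circ> X \<in> borel_measurable F" using X by (auto simp: bounded_measurable_def)
  define E where "E = {p :: real \<times> real. - K \<le> snd p \<and> snd p < f (fst p)}"
  have E: "E \<in> sets (distribution X \<Otimes>\<^sub>M lborel)"
  proof -
    have "Measurable.pred (borel \<Otimes>\<^sub>M borel) (\<lambda>p. - K \<le> snd p \<and> snd p < f (fst p))" by measurable
    moreover have "sets (distribution X \<Otimes>\<^sub>M lborel) = sets (borel \<Otimes>\<^sub>M borel)"
      by (intro sets_pair_measure_cong) auto
    ultimately show ?thesis by (simp add: E_def pred_def space_pair_measure)
  qed
  interpret pair_sigma_finite "distribution X" lborel ..
  have "emeasure (distribution X \<Otimes>\<^sub>M lborel) E \<le> emeasure (distribution X \<Otimes>\<^sub>M lborel) (UNIV \<times> {-K..K})"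
    using K by (intro emeasure_mono) (force simp: E_def abs_le_iff intro: less_imp_le order_trans less_le_trans)+
  also have "\<dots> < \<infinity>"
    using emeasure_space_1 by (simp add: lborel.emeasure_pair_measure_Times emeasure_lborel_Icc_eq)
  finally have intE: "integrable (distribution X \<Otimes>\<^sub>M lborel) (case_prod (\<lambda>s t. indicator E (s, t) :: real))"
    using E by (simp add: integrable_indicator_iff)
  have inner1: "(\<integral>t. indicator E (s, t) \<partial>lborel) = f s + K" for s
  proof -
    have "indicator E (s, t) = (indicator {-K..<f s} t :: real)" for t by (auto simp: E_def indicator_def)
    then show ?thesis using K[of s] by (simp add: abs_le_iff)
  qed
  have inner2: "(\<integral>s. indicator E (s, t) \<partial>distribution X) = indicator {-K..K} t *\<^sub>R survival (f \<circ> X) t" for t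
  proof -
    have "f s \<le> K" for s using K[of s] by simp
    then have "indicator E (s, t) = indicator {-K..K} t * (indicator {s. t < f s} s :: real)" for s
      by (auto simp: E_def indicator_def) (meson less_imp_le less_le_trans)
    then show ?thesis using measure_distribution_mono[OF X f, of t] by simp
  qed
  have "integral\<^sup>L (distribution X) f + K = (\<integral>s. f s + K \<partial>distribution X)"
    using intf prob_space by simp
  also have "\<dots> = (\<integral>s. (\<integral>t. indicator E (s, t) \<partial>lborel) \<partial>distribution X)"
    by (simp only: inner1)
  also have "\<dots> = (\<integral>t. (\<integral>s. indicator E (s, t) \<partial>distribution X) \<partial>lborel)"
    by (rule Fubini_integral[OF intE, symmetric])
  also have "\<dots> = choquet F \<mu> (f \<circ> X) + K"
    using choquet_eq[OF fX _ K0] K by (simp add: inner2 set_lebesgue_integral_def)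
  finally show "choquet F \<mu> (f \<circ> X) = integral\<^sup>L (distribution X) f" by simp
qed

text \<open>
  Comonotonicity makes \<open>X\<close> a nondecreasing 1-Lipschitz function \<open>f\<close> of \<open>X + Y\<close>, with \<open>f\<close> given by the
  McShane formula; then \<open>Y\<close> is the nondecreasing function \<open>s - f s\<close> of \<open>s = X + Y\<close>.
\<close>

lemma comonotonic_factorization:
  assumes X: "bounded_measurable F X" and com: "comonotonic F X Y"
  obtains f where "mono f" "mono (\<lambda>s. s - f s)" "\<And>\<omega>. \<omega> \<in> space F \<Longrightarrow> f (X \<omega> + Y \<omega>) = X \<omega>"
proof -
  define W where "W \<omega> = X \<omega> + Y \<omega>" for \<omega>
  define h where "h s \<omega> = X \<omega> + max 0 (s - W \<omega>)" for s \<omega>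
  define f where "f s = (INF \<omega>\<in>space F. h s \<omega>)" for s
  have ne: "space F \<noteq> {}" using mu_empty mu_space by (metis zero_neq_one)
  obtain K where K: "\<And>\<omega>. \<omega> \<in> space F \<Longrightarrow> \<bar>X \<omega>\<bar> \<le> K" by (rule bounded_measurableD[OF X]) blast
  have bdd: "bdd_below (h s ` space F)" for s
    by (rule bdd_belowI2[of _ "-K"]) (use K in \<open>force simp: h_def abs_le_iff\<close>)
  have lower: "f s \<le> h s \<omega>" if "\<omega> \<in> space F" for s \<omega>
    unfolding f_def by (rule cINF_lower[OF bdd that])
  have "mono f"
  proof (rule monoI)
    fix s r :: real assume "s \<le> r"
    show "f s \<le> f r" unfolding f_def
      by (rule cINF_mono[OF ne bdd]) (use \<open>s \<le> r\<close> in \<open>force simp: h_def\<close>)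
  qed
  moreover have "mono (\<lambda>s. s - f s)"
  proof (rule monoI)
    fix s r :: real assume sr: "s \<le> r"
    have "f r - (r - s) \<le> f s" unfolding f_def[of s]
    proof (rule cINF_greatest[OF ne])
      fix \<omega> assume "\<omega> \<in> space F"
      have "h r \<omega> \<le> h s \<omega> + (r - s)" using sr by (auto simp: h_def)
      then show "f r - (r - s) \<le> h s \<omega>" using lower[OF \<open>\<omega> \<in> space F\<close>, of r] by simp
    qed
    then show "s - f s \<le> r - f r" by simp
  qed
  moreover have "f (X \<omega> + Y \<omega>) = X \<omega>" if \<omega>: "\<omega> \<in> space F" for \<omega>
  proof (rule antisym)
    show "f (X \<omega> + Y \<omega>) \<le> X \<omega>" using lower[OF \<omega>, of "X \<omega> + Y \<omega>"] by (simp add: h_def W_def)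
    show "X \<omega> \<le> f (X \<omega> + Y \<omega>)" unfolding f_def
    proof (rule cINF_greatest[OF ne])
      fix \<omega>' assume "\<omega>' \<in> space F"
      then have prod: "0 \<le> (X \<omega> - X \<omega>') * (Y \<omega> - Y \<omega>')" using com \<omega> by (auto simp: comonotonic_def)
      show "X \<omega> \<le> h (X \<omega> + Y \<omega>) \<omega>'"
      proof (cases "X \<omega> \<le> X \<omega>'")
        case True
        then show ?thesis by (simp add: h_def)
      next
        \<comment> \<open>As \<open>Y\<close> does not drop either, the increment of
          \<open>W\<close> is at least that of \<open>X\<close>, so the penalty in \<open>h\<close>
          makes up for the smaller value.\<close>
        case False
        then have "Y \<omega>' \<le> Y \<omega>" using prod by (simp add: zero_le_mult_iff)
        then show ?thesis by (simp add: h_def W_def)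
      qed
    qed
  qed
  ultimately show ?thesis by (rule that)
qed

lemma choquet_comonotonic_add:
  assumes X: "bounded_measurable F X" and Y: "bounded_measurable F Y" and com: "comonotonic F X Y"
  shows "choquet F \<mu> (\<lambda>\<omega>. X \<omega> + Y \<omega>) = choquet F \<mu> X + choquet F \<mu> Y"
proof -
  obtain f where f: "mono f" "mono (\<lambda>s. s - f s)" "\<And>\<omega>. \<omega> \<in> space F \<Longrightarrow> f (X \<omega> + Y \<omega>) = X \<omega>"
    by (rule comonotonic_factorization[OF X com]) blast
  let ?W = "\<lambda>\<omega>. X \<omega> + Y \<omega>"
  have W: "bounded_measurable F ?W" by (rule bounded_measurable_add[OF X Y])
  obtain L where L: "0 < L" "\<And>\<omega>. \<omega> \<in> space F \<Longrightarrow> \<bar>?W \<omega>\<bar> \<le> L" using bounded_measurableD[OF W] by blast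
  \<comment> \<open>\<open>f\<close> need not be bounded on the line; clamping to an interval around
    the range of \<open>X + Y\<close> makes the factors bounded without changing them on that
    range.\<close>
  define c where "c s = max (-L) (min L s)" for s
  have "mono c" "\<And>s. \<bar>c s\<bar> \<le> L" using L(1) by (auto simp: c_def mono_def)
  moreover have "continuous_on UNIV c" unfolding c_def by (intro continuous_intros)
  moreover have "c (?W \<omega>) = ?W \<omega>" if "\<omega> \<in> space F" for \<omega>
    using L(2)[OF that] by (auto simp: c_def)
  ultimately have c: "mono c" "continuous_on UNIV c" "\<And>s. \<bar>c s\<bar> \<le> L"
    "\<And>\<omega>. \<omega> \<in> space F \<Longrightarrow> c (?W \<omega>) = ?W \<omega>" by blast+
  define p where "p s = f (c s)" for s
  define q where "q s = c s - f (c s)" for s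
  have lip: "\<bar>f s - f r\<bar> \<le> \<bar>s - r\<bar>" for s r
    using monoD[OF f(1), of s r] monoD[OF f(1), of r s] monoD[OF f(2), of s r] monoD[OF f(2), of r s]
    by (cases "s \<le> r") auto
  have "continuous_on UNIV f"
    unfolding continuous_on_iff using lip by (metis dist_real_def le_less_trans)
  then have p: "mono p" "continuous_on UNIV p" and q: "mono q" "continuous_on UNIV q"
    unfolding p_def q_def
    using c(1,2) f monoD[OF f(1)] monoD[OF f(2)] monoD[OF c(1)]
    by (auto intro!: monoI continuous_on_compose2[of UNIV f] continuous_on_diff)
  define K where "K = \<bar>f 0\<bar> + L"
  have K: "\<bar>p s\<bar> \<le> K" "\<bar>q s\<bar> \<le> K + L" for s
    using lip[of "c s" 0] c(3)[of s] by (auto simp: p_def q_def K_def)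
  note P = choquet_eq_integral_distribution[OF W p K(1)]
  note Q = choquet_eq_integral_distribution[OF W q K(2)]
  note C = choquet_eq_integral_distribution[OF W c(1,2,3)]
  have "choquet F \<mu> ?W = choquet F \<mu> (c \<circ> ?W)" using c by (intro choquet_cong) simp
  also have "\<dots> = integral\<^sup>L (distribution ?W) (\<lambda>s. p s + q s)" using C(2) by (simp add: p_def q_def)
  also have "\<dots> = choquet F \<mu> (p \<circ> ?W) + choquet F \<mu> (q \<circ> ?W)" using P Q by simp
  also have "choquet F \<mu> (p \<circ> ?W) = choquet F \<mu> X"
    using c f by (intro choquet_cong) (simp add: p_def)
  also have "choquet F \<mu> (q \<circ> ?W) = choquet F \<mu> Y"
    using c f by (intro choquet_cong) (simp add: q_def)
  finally show ?thesis .
qed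

end

section \<open>Certainty equivalents\<close>

locale atomless_subalgebra =
  fixes F P :: "'a measure"
  assumes subalgebra: "subalgebra F P" and prob_space: "prob_space P" and atomless: "atomless P"
begin

sublocale P: prob_space P by (rule prob_space)

lemma space_eq: "space P = space F" and sets_subset: "sets P \<subseteq> sets F"
  using subalgebra by (auto simp: subalgebra_def)

lemma setsD: "A \<in> sets P \<Longrightarrow> A \<in> sets F"
  using sets_subset by blast

lemma P_01: "measure P A \<in> {0..1}"
  using P.prob_le_1 by simp

lemma subset_with_prob:
  assumes "A \<in> sets P" "0 \<le> p" "p \<le> measure P A"
  obtains B where "B \<in> sets P" "B \<subseteq> A" "measure P B = p"
proof -
  have "p \<in> {measure P B |B. B \<in> sets P \<and> B \<subseteq> A}"
    using atomless assms by (auto simp: atomless_def)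
  then show ?thesis using that by blast
qed

text \<open>Atomlessness concerns subsets, so the missing probability is cut out of the
  complement.\<close>

lemma superset_with_prob:
  assumes "A \<in> sets P" "measure P A \<le> p" "p \<le> 1"
  obtains B where "B \<in> sets P" "A \<subseteq> B" "measure P B = p"
proof -
  have "space P - A \<in> sets P" "p - measure P A \<le> measure P (space P - A)"
    using assms P.prob_compl[of A] by auto
  then obtain C where C: "C \<in> sets P" "C \<subseteq> space P - A" "measure P C = p - measure P A"
    using subset_with_prob[of "space P - A" "p - measure P A"] assms by auto
  have "measure P (A \<union> C) = p"
    using C assms by (subst P.finite_measure_Union) auto
  then show ?thesis using that[of "A \<union> C"] C assms by auto
qed

lemma binary_act_in: assumes "A \<in> sets F" shows "binary_act F x A y \<in> acts F"
proof -
  have "(\<lambda>\<omega>. if \<omega> \<in> A then x else y) \<in> borel_measurable F" using assms by measurable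
  then have "binary_act F x A y \<in> borel_measurable F"
    by (rule measurable_cong[THEN iffD2, rotated]) (simp add: binary_act_def)
  then show ?thesis
    by (auto simp: acts_def binary_act_def bounded_iff intro!: exI[of _ "max \<bar>x\<bar> \<bar>y\<bar>"])
qed

lemma binary_act_in_P: assumes "A \<in> sets P" shows "binary_act F x A y \<in> acts P"
proof -
  have "(\<lambda>\<omega>. if \<omega> \<in> A then x else y) \<in> borel_measurable P" using assms by measurable
  then have "binary_act F x A y \<in> borel_measurable P"
    by (rule measurable_cong[THEN iffD2, rotated]) (simp add: binary_act_def space_eq)
  then show ?thesis
    by (auto simp: acts_def binary_act_def bounded_iff space_eq intro!: exI[of _ "max \<bar>x\<bar> \<bar>y\<bar>"])
qed

lemma acts_subset: assumes "X \<in> acts P" shows "X \<in> acts F"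
proof -
  have "X \<in> borel_measurable P" using assms by (simp add: acts_def)
  then have "X \<in> borel_measurable F" by (rule measurable_from_subalg[OF subalgebra])
  then show ?thesis using assms by (simp add: acts_def space_eq)
qed

lemma act_bounded_measurable: "X \<in> acts F \<Longrightarrow> bounded_measurable F X"
  by (auto simp: acts_def bounded_measurable_def)

lemma act_bound:
  assumes "X \<in> acts F" obtains K where "0 < K" "\<And>\<omega>. \<omega> \<in> space F \<Longrightarrow> \<bar>X \<omega>\<bar> \<le> K"
  by (rule bounded_measurableD[OF act_bounded_measurable[OF assms]]) (rule that)

lemma restrict_act:
  assumes "bounded_measurable F X" shows "restrict X (space F) \<in> acts F"
proof -
  have "restrict X (space F) \<in> borel_measurable F \<longleftrightarrow> X \<in> borel_measurable F"
    by (rule measurable_cong) simp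
  then show ?thesis using assms by (auto simp: acts_def bounded_measurable_def)
qed

lemma binary_act_same: "binary_act F c A c = const_act F c"
  by (auto simp: binary_act_def const_act_def)

lemma const_act_in: "const_act F c \<in> acts F" "const_act F c \<in> acts P"
  using binary_act_in[of "{}" c c] binary_act_in_P[of "{}" c c] by (simp_all add: binary_act_same)

lemma coin_flipsD: "A \<in> coin_flips P \<Longrightarrow> A \<in> sets P" "A \<in> coin_flips P \<Longrightarrow> measure P A = 1/2"
  by (auto simp: coin_flips_def)

lemma coin_flips_nonempty: "coin_flips P \<noteq> {}"
proof -
  obtain B where "B \<in> sets P" "measure P B = 1/2"
    using subset_with_prob[of "space P" "1/2"] P.prob_space by auto
  then show ?thesis by (auto simp: coin_flips_def)
qed

lemma comonotonic_const: "comonotonic F X (const_act F c)" "comonotonic F (const_act F c) X"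
  by (auto simp: comonotonic_def const_act_def)

lemma comonotonic_binary:
  assumes "y \<le> x" "y' \<le> x'"
  shows "comonotonic F (binary_act F x A y) (binary_act F x' A y')"
proof -
  have "0 \<le> (x - y) * (x' - y')" "0 \<le> (y - x) * (y' - x')"
    using assms by (simp_all add: mult_nonpos_nonpos)
  then show ?thesis by (simp add: comonotonic_def binary_act_def)
qed

end

text \<open>The axioms under which \<open>cert_equiv\<close> and \<open>half_mix\<close> are well
  defined. Both directions of the theorem pass through this locale, the converse after deriving the
  four axioms.\<close>

locale regular_preference = atomless_subalgebra F P for F P :: "'a measure" +
  fixes R :: "'a pref"
  assumes preference: "preference F R"
    and RC: "axiom_RC P R" and M: "axiom_M F R" and SRM: "axiom_SRM P R" and C: "axiom_C F R"
begin

lemma pref_total: "X \<in> acts F \<Longrightarrow> Y \<in> acts F \<Longrightarrow> R X Y \<or> R Y X"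
  using preference by (auto simp: preference_def)

lemma pref_trans: "R X Y \<Longrightarrow> R Y Z \<Longrightarrow> X \<in> acts F \<Longrightarrow> Y \<in> acts F \<Longrightarrow> Z \<in> acts F \<Longrightarrow> R X Z"
  using preference unfolding preference_def transp_on_def by blast

lemma pref_mono: "X \<in> acts F \<Longrightarrow> Y \<in> acts F \<Longrightarrow> (\<And>\<omega>. \<omega> \<in> space F \<Longrightarrow> Y \<omega> \<le> X \<omega>) \<Longrightarrow> R X Y"
  using M by (auto simp: axiom_M_def)

lemma pref_closed:
  assumes Xs: "\<And>n::nat. Xs n \<in> acts F" and X: "X \<in> acts F" and Y: "Y \<in> acts F"
    and bound: "\<And>n \<omega>. \<omega> \<in> space F \<Longrightarrow> \<bar>Xs n \<omega>\<bar> \<le> K"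
    and lim: "\<And>\<omega>. \<omega> \<in> space F \<Longrightarrow> (\<lambda>n. Xs n \<omega>) \<longlonglongrightarrow> X \<omega>"
  shows "(\<And>n. R (Xs n) Y) \<Longrightarrow> R X Y" "(\<And>n. R Y (Xs n)) \<Longrightarrow> R Y X"
proof -
  have cl: "B_closed F {Z \<in> acts F. R Y Z}" "B_closed F {Z \<in> acts F. R Z Y}"
    using C Y by (auto simp: axiom_C_def)
  have bd: "\<exists>K. \<forall>n. \<forall>\<omega>\<in>space F. \<bar>Xs n \<omega>\<bar> \<le> K" and lm: "\<forall>\<omega>\<in>space F. (\<lambda>n. Xs n \<omega>) \<longlonglongrightarrow> X \<omega>"
    using bound lim by blast+
  show "R X Y" if "\<And>n. R (Xs n) Y"
  proof -
    have "\<forall>n. Xs n \<in> {Z \<in> acts F. R Z Y}" using that Xs by blast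
    then show ?thesis using cl(2) X bd lm unfolding B_closed_def by blast
  qed
  show "R Y X" if "\<And>n. R Y (Xs n)"
  proof -
    have "\<forall>n. Xs n \<in> {Z \<in> acts F. R Y Z}" using that Xs by blast
    then show ?thesis using cl(1) X bd lm unfolding B_closed_def by blast
  qed
qed

lemma strict_dominance:
  assumes X: "X \<in> acts P" and Y: "Y \<in> acts P"
    and ge: "\<And>\<omega>. \<omega> \<in> space F \<Longrightarrow> Y \<omega> \<le> X \<omega>" and gt: "A \<in> sets P" "0 < measure P A" "\<And>\<omega>. \<omega> \<in> A \<Longrightarrow> Y \<omega> < X \<omega>"
  shows "\<not> R Y X"
proof -
  have "{\<omega> \<in> space P. Y \<omega> \<le> X \<omega>} = space P" using ge by (auto simp: space_eq)
  then have 1: "measure P {\<omega> \<in> space P. Y \<omega> \<le> X \<omega>} = 1" by (simp add: P.prob_space)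
  have meas: "{\<omega> \<in> space P. Y \<omega> < X \<omega>} \<in> sets P"
    using X Y unfolding acts_def by (intro borel_measurable_less) auto
  have "A \<subseteq> {\<omega> \<in> space P. Y \<omega> < X \<omega>}" using gt sets.sets_into_space by blast
  then have "0 < measure P {\<omega> \<in> space P. Y \<omega> < X \<omega>}"
    using P.finite_measure_mono[OF _ meas] gt(2) by (meson less_le_trans)
  with 1 have "strictly R X Y" using SRM X Y by (auto simp: axiom_SRM_def)
  then show ?thesis by (simp add: strictly_def)
qed

lemma const_pref_iff: "R (const_act F c) (const_act F d) \<longleftrightarrow> d \<le> c"
proof -
  have "\<not> R (const_act F c) (const_act F d)" if "c < d"
    using that P.prob_space sets.top[of P]
    by (intro strict_dominance[of _ _ "space P"] const_act_in) (simp_all add: const_act_def space_eq)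
  moreover have "R (const_act F c) (const_act F d)" if "d \<le> c"
    using that by (intro pref_mono const_act_in) (auto simp: const_act_def)
  ultimately show ?thesis by (meson not_le)
qed

text \<open>The certainty equivalent is the infimum of the constants weakly preferred to
  \<open>X\<close>. Closedness is applied to constants tending to it from above and, by completeness
  of the preference, from below.\<close>

lemma certainty_equivalent_exists:
  assumes X: "X \<in> acts F"
  shows "\<exists>!c. indiff R X (const_act F c)"
proof -
  obtain K where K: "0 < K" "\<And>\<omega>. \<omega> \<in> space F \<Longrightarrow> \<bar>X \<omega>\<bar> \<le> K" by (rule act_bound[OF X]) blast
  define S where "S = {c. R (const_act F c) X}"
  have KS: "K \<in> S" unfolding S_def mem_Collect_eq
    using K(2) by (intro pref_mono X const_act_in) (force simp: const_act_def)
  have lowK: "R X (const_act F (-K))"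
    using K(2) by (intro pref_mono X const_act_in) (force simp: const_act_def)
  have lower: "-K \<le> c" if "c \<in> S" for c
    using that lowK pref_trans[of "const_act F c" X "const_act F (-K)"] X const_act_in
    by (simp add: S_def const_pref_iff)
  have up: "d \<in> S" if "c \<in> S" "c \<le> d" for c d
    using that pref_trans[of "const_act F d" "const_act F c" X] X const_act_in
    by (simp add: S_def const_pref_iff)
  have bdd: "bdd_below S" using lower by (rule bdd_belowI)
  define c where "c = Inf S"
  have inv: "(\<lambda>n. inverse (real (Suc n))) \<longlonglongrightarrow> 0" by (rule LIMSEQ_inverse_real_of_nat)
  have invb: "0 < inverse (real (Suc n))" "inverse (real (Suc n)) \<le> 1" for n
    by (auto simp: inverse_le_1_iff)
  have "R (const_act F c) X"
  proof (rule pref_closed(1))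
    fix n
    have "c < c + inverse (real (Suc n))" using invb by simp
    then obtain d where "d \<in> S" "d < c + inverse (real (Suc n))"
      using cInf_less_iff[OF _ bdd] KS unfolding c_def by blast
    then show "R (const_act F (c + inverse (real (Suc n)))) X"
      using up[of d "c + inverse (real (Suc n))"] by (simp add: S_def)
    fix \<omega> assume "\<omega> \<in> space F"
    then have "const_act F (c + inverse (real (Suc n))) \<omega> = c + inverse (real (Suc n))"
      by (simp add: const_act_def)
    then show "\<bar>const_act F (c + inverse (real (Suc n))) \<omega>\<bar> \<le> \<bar>c\<bar> + 1"
      using invb(1)[of n] invb(2)[of n] by linarith
  next
    fix \<omega> assume "\<omega> \<in> space F"
    then show "(\<lambda>n. const_act F (c + inverse (real (Suc n))) \<omega>) \<longlonglongrightarrow> const_act F c \<omega>"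
      using tendsto_add[OF tendsto_const inv, of c] by (simp add: const_act_def)
  qed (use X const_act_in in auto)
  moreover have "R X (const_act F c)"
  proof (rule pref_closed(2))
    fix n
    have "c - inverse (real (Suc n)) \<notin> S"
      using cInf_lower[OF _ bdd, of "c - inverse (real (Suc n))"] invb(1)[of n]
      unfolding c_def[symmetric] by linarith
    then show "R X (const_act F (c - inverse (real (Suc n))))"
      using pref_total[OF X const_act_in(1)] by (auto simp: S_def)
    fix \<omega> assume "\<omega> \<in> space F"
    then have "const_act F (c - inverse (real (Suc n))) \<omega> = c - inverse (real (Suc n))"
      by (simp add: const_act_def)
    then show "\<bar>const_act F (c - inverse (real (Suc n))) \<omega>\<bar> \<le> \<bar>c\<bar> + 1"
      using invb(1)[of n] invb(2)[of n] by linarith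
  next
    fix \<omega> assume "\<omega> \<in> space F"
    then show "(\<lambda>n. const_act F (c - inverse (real (Suc n))) \<omega>) \<longlonglongrightarrow> const_act F c \<omega>"
      using tendsto_diff[OF tendsto_const inv, of c] by (simp add: const_act_def)
  qed (use X const_act_in in auto)
  ultimately have "indiff R X (const_act F c)" by (simp add: indiff_def)
  moreover have "d = c" if "indiff R X (const_act F d)" "indiff R X (const_act F c)" for d
    using that pref_trans[of "const_act F d" X "const_act F c"] pref_trans[of "const_act F c" X "const_act F d"]
      X const_act_in by (simp add: indiff_def const_pref_iff)
  ultimately show ?thesis by blast
qed

abbreviation ce :: "('a \<Rightarrow> real) \<Rightarrow> real" where
  "ce \<equiv> cert_equiv F R"

lemma indiff_ce: "X \<in> acts F \<Longrightarrow> indiff R X (const_act F (ce X))"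
  unfolding cert_equiv_def by (rule theI') (rule certainty_equivalent_exists)

lemma ce_unique: "X \<in> acts F \<Longrightarrow> indiff R X (const_act F c) \<Longrightarrow> ce X = c"
  using certainty_equivalent_exists indiff_ce by blast

lemma ce_const [simp]: "ce (const_act F c) = c"
  by (rule ce_unique) (auto simp: const_act_in indiff_def const_pref_iff)

lemma pref_iff:
  assumes X: "X \<in> acts F" and Y: "Y \<in> acts F"
  shows "R X Y \<longleftrightarrow> ce Y \<le> ce X"
proof -
  note i = indiff_ce[OF X] indiff_ce[OF Y] const_act_in(1)
  have "R X Y \<longleftrightarrow> R (const_act F (ce X)) (const_act F (ce Y))"
    using i X Y pref_trans unfolding indiff_def by meson
  then show ?thesis by (simp add: const_pref_iff)
qed

lemma indiff_iff: "X \<in> acts F \<Longrightarrow> Y \<in> acts F \<Longrightarrow> indiff R X Y \<longleftrightarrow> ce X = ce Y"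
  unfolding indiff_def using pref_iff[of X Y] pref_iff[of Y X] by auto

lemma ce_mono: "X \<in> acts F \<Longrightarrow> Y \<in> acts F \<Longrightarrow> (\<And>\<omega>. \<omega> \<in> space F \<Longrightarrow> X \<omega> \<le> Y \<omega>) \<Longrightarrow> ce X \<le> ce Y"
  using pref_mono pref_iff by blast

lemma ce_strict:
  assumes "X \<in> acts P" "Y \<in> acts P" "\<And>\<omega>. \<omega> \<in> space F \<Longrightarrow> X \<omega> \<le> Y \<omega>"
    "A \<in> sets P" "0 < measure P A" "\<And>\<omega>. \<omega> \<in> A \<Longrightarrow> X \<omega> < Y \<omega>"
  shows "ce X < ce Y"
proof -
  have "\<not> R X Y" by (rule strict_dominance[OF assms(2,1,3-6)])
  then show ?thesis using pref_iff[OF acts_subset[OF assms(1)] acts_subset[OF assms(2)]] by simp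
qed

text \<open>B-closedness only says that bounded limits of sequences inside a preference set remain
  there. A failure of convergence yields a subsequence on the wrong side of a constant
  \<open>c\<close>, which closedness contradicts.\<close>

lemma ce_tendsto:
  assumes Xs: "\<And>n::nat. Xs n \<in> acts F" and X: "X \<in> acts F"
    and bound: "\<And>n \<omega>. \<omega> \<in> space F \<Longrightarrow> \<bar>Xs n \<omega>\<bar> \<le> K"
    and lim: "\<And>\<omega>. \<omega> \<in> space F \<Longrightarrow> (\<lambda>n. Xs n \<omega>) \<longlonglongrightarrow> X \<omega>"
  shows "(\<lambda>n. ce (Xs n)) \<longlonglongrightarrow> ce X"
proof -
  have sub: "\<exists>r :: nat \<Rightarrow> nat. strict_mono r \<and> (\<forall>k. \<not> Q (r k))"
    if "\<not> eventually Q sequentially" for Q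
  proof -
    have "infinite {n. \<not> Q n}"
      using that by (simp add: frequently_cofinite[symmetric] cofinite_eq_sequentially not_eventually)
    then show ?thesis
      using strict_mono_enumerate enumerate_in_set by (metis mem_Collect_eq)
  qed
  have lim': "(\<lambda>k. Xs (r k) \<omega>) \<longlonglongrightarrow> X \<omega>" if "strict_mono r" "\<omega> \<in> space F" for r \<omega>
    using LIMSEQ_subseq_LIMSEQ[OF lim[OF that(2)] that(1)] by (simp add: comp_def)
  show ?thesis
  proof (rule order_tendstoI; rule ccontr)
    fix c assume c: "c < ce X" and not: "\<not> eventually (\<lambda>n. c < ce (Xs n)) sequentially"
    obtain r :: "nat \<Rightarrow> nat" where r: "strict_mono r" "\<forall>k. \<not> c < ce (Xs (r k))" using sub[OF not] by blast
    have "R (const_act F c) X"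
      by (rule pref_closed(2)[of "\<lambda>k. Xs (r k)" _ _ K])
        (use r(2) in \<open>simp_all add: Xs X bound lim'[OF r(1)] const_act_in pref_iff not_less\<close>)
    then show False using c pref_iff[OF const_act_in(1) X] by simp
  next
    fix c assume c: "ce X < c" and not: "\<not> eventually (\<lambda>n. ce (Xs n) < c) sequentially"
    obtain r :: "nat \<Rightarrow> nat" where r: "strict_mono r" "\<forall>k. \<not> ce (Xs (r k)) < c" using sub[OF not] by blast
    have "R X (const_act F c)"
      by (rule pref_closed(1)[of "\<lambda>k. Xs (r k)" _ _ K])
        (use r(2) in \<open>simp_all add: Xs X bound lim'[OF r(1)] const_act_in pref_iff not_less\<close>)
    then show False using c pref_iff[OF X const_act_in(1)] by simp
  qed
qed

lemma ce_distribution: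
  assumes "X \<in> acts P" "Y \<in> acts P"
    "\<And>x. measure P {\<omega> \<in> space P. X \<omega> > x} = measure P {\<omega> \<in> space P. Y \<omega> > x}"
  shows "ce X = ce Y"
proof -
  have "indiff R X Y"
    using RC[unfolded axiom_RC_def, rule_format, OF assms(1,2)] assms(3) by simp
  then show ?thesis using indiff_iff[OF acts_subset acts_subset] assms(1,2) by simp
qed

text \<open>The level events of both acts are among the whole space, the event, its complement and
  the empty set, with equal probabilities.\<close>

lemma ce_binary_distribution:
  assumes A: "A \<in> sets P" and B: "B \<in> sets P" and eq: "measure P A = measure P B"
  shows "ce (binary_act F x A y) = ce (binary_act F x B y)"
proof (rule ce_distribution)
  fix t
  have ev: "{\<omega> \<in> space P. binary_act F x A y \<omega> > t} =
     (if t < x then if t < y then space P else A else if t < y then space P - A else {})" if "A \<in> sets P" for A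
    using sets.sets_into_space[OF that] by (auto simp: binary_act_def space_eq)
  show "measure P {\<omega> \<in> space P. binary_act F x A y \<omega> > t} = measure P {\<omega> \<in> space P. binary_act F x B y \<omega> > t}"
    using A B eq by (simp add: ev P.prob_compl)
qed (use A B binary_act_in_P in auto)

end

section \<open>Subjective mixtures\<close>

context regular_preference
begin

text \<open>By RC every coin flip gives the same value, see \<open>ce_coin_flip\<close>, so one
  chosen event suffices and the quantifiers over coin flips disappear.\<close>

definition bet :: "real \<Rightarrow> real \<Rightarrow> real" where
  "bet x y = ce (binary_act F x (SOME A. A \<in> coin_flips P) y)"

lemma ce_coin_flip:
  assumes "A \<in> coin_flips P" shows "ce (binary_act F x A y) = bet x y"
proof -
  have "(SOME A. A \<in> coin_flips P) \<in> coin_flips P"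
    using coin_flips_nonempty by (simp add: some_in_eq)
  then show ?thesis unfolding bet_def using assms
    by (intro ce_binary_distribution) (simp_all add: coin_flipsD)
qed

lemma coin_flip_obtain:
  obtains A where "A \<in> sets P" "A \<in> sets F" "measure P A = 1/2" "measure P (space P - A) = 1/2"
    "\<And>x y. bet x y = ce (binary_act F x A y)"
proof -
  obtain A where A: "A \<in> coin_flips P" using coin_flips_nonempty by blast
  note c = coin_flipsD[OF A]
  show ?thesis
    by (rule that[OF c(1) setsD[OF c(1)] c(2) _ ce_coin_flip[OF A, symmetric]])
      (use c P.prob_compl[OF c(1)] in simp)
qed

lemma bet_same [simp]: "bet x x = x"
  by (simp add: bet_def binary_act_same)

lemma bet_strict1: assumes "x < x'" shows "bet x y < bet x' y"
proof -
  obtain A where A: "A \<in> sets P" "measure P A = 1/2" "\<And>x y. bet x y = ce (binary_act F x A y)"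
    by (rule coin_flip_obtain) blast
  have sub: "A \<subseteq> space F" using sets.sets_into_space[OF A(1)] by (simp add: space_eq)
  show ?thesis unfolding A(3)
  proof (rule ce_strict[OF binary_act_in_P[OF A(1)] binary_act_in_P[OF A(1)] _ A(1)])
    show "0 < measure P A" by (simp add: A(2))
  qed (use assms sub in \<open>auto simp: binary_act_def\<close>)
qed

lemma bet_strict2: assumes "y < y'" shows "bet x y < bet x y'"
proof -
  obtain A where A: "A \<in> sets P" "measure P (space P - A) = 1/2" "\<And>x y. bet x y = ce (binary_act F x A y)"
    by (rule coin_flip_obtain) blast
  have c: "space P - A \<in> sets P" using A(1) by auto
  show ?thesis unfolding A(3)
  proof (rule ce_strict[OF binary_act_in_P[OF A(1)] binary_act_in_P[OF A(1)] _ c])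
    show "0 < measure P (space P - A)" by (simp only: A(2))
  qed (use assms in \<open>auto simp: binary_act_def space_eq\<close>)
qed

lemma bet_less_iff1 [simp]: "bet x y < bet x' y \<longleftrightarrow> x < x'"
  by (metis bet_strict1 less_asym linorder_neqE)

lemma bet_less_iff2 [simp]: "bet x y < bet x y' \<longleftrightarrow> y < y'"
  by (metis bet_strict2 less_asym linorder_neqE)

lemma bet_le_iff1 [simp]: "bet x y \<le> bet x' y \<longleftrightarrow> x \<le> x'"
  by (simp add: linorder_not_less[symmetric])

lemma bet_le_iff2 [simp]: "bet x y \<le> bet x y' \<longleftrightarrow> y \<le> y'"
  by (simp add: linorder_not_less[symmetric])

lemma bet_eq_iff1 [simp]: "bet x y = bet x' y \<longleftrightarrow> x = x'"
  by (simp add: eq_iff)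

lemma bet_eq_iff2 [simp]: "bet x y = bet x y' \<longleftrightarrow> y = y'"
  by (simp add: eq_iff)

lemma bet_mono: "x \<le> x' \<Longrightarrow> y \<le> y' \<Longrightarrow> bet x y \<le> bet x' y'"
  by (rule order_trans[of _ "bet x' y"]) simp_all

lemma bet_strict: "x < x' \<Longrightarrow> y < y' \<Longrightarrow> bet x y < bet x' y'"
  by (rule less_trans[of _ "bet x' y"]) simp_all

lemma bet_internal: "y \<le> x \<Longrightarrow> y \<le> bet x y" "y \<le> x \<Longrightarrow> bet x y \<le> x"
  using bet_le_iff1[of y y x] bet_le_iff2[of x y x] by simp_all

lemma bet_tendsto:
  assumes x: "xs \<longlonglongrightarrow> x" and y: "ys \<longlonglongrightarrow> y"
  shows "(\<lambda>n::nat. bet (xs n) (ys n)) \<longlonglongrightarrow> bet x y"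
proof -
  obtain A where A: "A \<in> sets F" "\<And>x y. bet x y = ce (binary_act F x A y)"
    by (rule coin_flip_obtain) blast
  have "Bseq xs" "Bseq ys" using x y by (auto intro: convergent_imp_Bseq convergentI)
  then obtain K L where K: "\<And>n. \<bar>xs n\<bar> \<le> K" and L: "\<And>n. \<bar>ys n\<bar> \<le> L"
    by (auto simp: Bseq_def)
  show ?thesis unfolding A(2)
  proof (rule ce_tendsto)
    show "\<bar>binary_act F (xs n) A (ys n) \<omega>\<bar> \<le> max K L" if "\<omega> \<in> space F" for n \<omega>
      using that K[of n] L[of n] by (simp add: binary_act_def le_max_iff_disj)
    show "(\<lambda>n. binary_act F (xs n) A (ys n) \<omega>) \<longlonglongrightarrow> binary_act F x A y \<omega>" if "\<omega> \<in> space F" for \<omega>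
      using that x y by (simp add: binary_act_def)
  qed (use A in \<open>auto intro: binary_act_in\<close>)
qed

lemma continuous_bet:
  assumes "continuous_on S f" "continuous_on S g"
  shows "continuous_on S (\<lambda>x::real. bet (f x) (g x))"
  unfolding continuous_on_sequentially comp_def
proof (intro ballI allI impI)
  fix x a assume "a \<in> S" and xs: "(\<forall>n. x n \<in> S) \<and> x \<longlonglongrightarrow> a"
  then have "(\<lambda>n. f (x n)) \<longlonglongrightarrow> f a" "(\<lambda>n. g (x n)) \<longlonglongrightarrow> g a"
    using assms by (auto simp: continuous_on_sequentially comp_def)
  then show "(\<lambda>n. bet (f (x n)) (g (x n))) \<longlonglongrightarrow> bet (f a) (g a)" by (rule bet_tendsto)
qed

abbreviation mix :: "real \<Rightarrow> real \<Rightarrow> real" where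
  "mix \<equiv> half_mix F P R"

section \<open>Existence, uniqueness and continuity of the mixture\<close>

text \<open>Replacing every certainty equivalent of a coin flip by \<open>bet\<close> turns the
  indifference into an equation between reals.\<close>

lemma half_mix_ordered_eq:
  "half_mix_ordered F P R x y = (THE z. z \<in> {y..x} \<and> bet x y = bet (bet x z) (bet z y))"
proof -
  have "(\<forall>A\<in>coin_flips P. indiff R (binary_act F x A y)
             (binary_act F (ce (binary_act F x A z)) A (ce (binary_act F z A y))))
      \<longleftrightarrow> bet x y = bet (bet x z) (bet z y)" for z
    using coin_flips_nonempty
    by (auto simp: indiff_iff binary_act_in setsD coin_flipsD ce_coin_flip)
  then show ?thesis unfolding half_mix_ordered_def by simp
qed

text \<open>As \<open>z\<close> grows both inner bets grow, so the right side is strictly increasing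
  and continuous in \<open>z\<close>; at \<open>z = y\<close> and \<open>z = x\<close> it lies on
  either side of \<open>bet x y\<close>.\<close>

lemma mix_exists:
  assumes xy: "y \<le> x"
  shows "\<exists>!z. z \<in> {y..x} \<and> bet x y = bet (bet x z) (bet z y)"
proof -
  have "\<exists>z\<ge>y. z \<le> x \<and> bet (bet x z) (bet z y) = bet x y"
  proof (rule IVT')
    show "bet (bet x y) (bet y y) \<le> bet x y" "bet x y \<le> bet (bet x x) (bet x y)"
      using bet_internal[OF xy] by simp_all
    show "continuous_on {y..x} (\<lambda>z. bet (bet x z) (bet z y))"
      by (intro continuous_bet continuous_intros)
  qed (rule xy)
  moreover have "z = w" if "bet (bet x z) (bet z y) = bet (bet x w) (bet w y)" for z w
    using that bet_strict[of "bet x z" "bet x w" "bet z y" "bet w y"]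
      bet_strict[of "bet x w" "bet x z" "bet w y" "bet z y"]
    by (cases z w rule: linorder_cases) auto
  ultimately show ?thesis by (metis atLeastAtMost_iff)
qed

lemma mix_commute: "mix x y = mix y x"
  by (auto simp: half_mix_def)

lemma mix_ordered:
  assumes "y \<le> x"
  shows mix_in: "mix x y \<in> {y..x}"
    and mix_eq: "bet x y = bet (bet x (mix x y)) (bet (mix x y) y)"
proof -
  have "mix x y = (THE z. z \<in> {y..x} \<and> bet x y = bet (bet x z) (bet z y))"
    using assms by (simp add: half_mix_def half_mix_ordered_eq)
  then show "mix x y \<in> {y..x}" "bet x y = bet (bet x (mix x y)) (bet (mix x y) y)"
    using theI'[OF mix_exists[OF assms]] by simp_all
qed

lemma mix_unique:
  assumes "y \<le> x" "z \<in> {y..x}" "bet x y = bet (bet x z) (bet z y)" shows "mix x y = z"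
  using mix_exists[OF assms(1)] assms mix_ordered[OF assms(1)] by blast

lemma mix_idem: "mix x x = x"
  using mix_in[of x x] by simp

lemma mix_between: "min x y \<le> mix x y" "mix x y \<le> max x y"
  using mix_in[of x y] mix_in[of y x] by (cases "x \<le> y"; force simp: mix_commute[of x y])+

lemma mix_strict_internal: assumes "y < x" shows "y < mix x y" "mix x y < x"
proof -
  have m: "mix x y \<in> {y..x}" "bet x y = bet (bet x (mix x y)) (bet (mix x y) y)"
    using mix_ordered[of y x] assms by simp_all
  have "bet x y < x" "y < bet x y" using assms bet_strict2[of y x x] bet_strict1[of y x y] by simp_all
  then have "mix x y \<noteq> y" "mix x y \<noteq> x" using m(2) by (metis bet_same bet_eq_iff1 bet_eq_iff2 less_irrefl)+
  then show "y < mix x y" "mix x y < x" using m(1) by auto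
qed

text \<open>An implicit function argument. By strict monotonicity of \<open>bet\<close>, the sign of
  \<open>bet (bet a c) (bet c b) - bet a b\<close> tells on which side of \<open>mix a b\<close> the
  number \<open>c\<close> lies, and a strict sign survives small changes of \<open>a\<close> and
  \<open>b\<close>.\<close>

lemma mix_tendsto_ordered:
  assumes x: "xs \<longlonglongrightarrow> x" and y: "ys \<longlonglongrightarrow> y" and ge: "\<And>n. ys n \<le> xs n"
  shows "(\<lambda>n::nat. mix (xs n) (ys n)) \<longlonglongrightarrow> mix x y"
proof -
  have xy: "y \<le> x" by (rule LIMSEQ_le[OF y x]) (use ge in auto)
  have lim: "(\<lambda>n. bet (bet (xs n) c) (bet c (ys n)) - bet (xs n) (ys n)) \<longlonglongrightarrow>
      bet (bet x c) (bet c y) - bet x y" for c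
    by (intro tendsto_diff bet_tendsto x y tendsto_const)
  have smaller: "bet (bet a c) (bet c b) < bet a b \<longleftrightarrow> c < mix a b" if "b \<le> a" for a b c
    using mix_eq[OF that] bet_strict[of "bet a c" "bet a (mix a b)" "bet c b" "bet (mix a b) b"]
      bet_strict[of "bet a (mix a b)" "bet a c" "bet (mix a b) b" "bet c b"]
    by (cases c "mix a b" rule: linorder_cases) auto
  have greater: "bet a b < bet (bet a c) (bet c b) \<longleftrightarrow> mix a b < c" if "b \<le> a" for a b c
    using mix_eq[OF that] bet_strict[of "bet a c" "bet a (mix a b)" "bet c b" "bet (mix a b) b"]
      bet_strict[of "bet a (mix a b)" "bet a c" "bet (mix a b) b" "bet c b"]
    by (cases c "mix a b" rule: linorder_cases) auto
  show ?thesis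
  proof (rule order_tendstoI)
    fix c assume "c < mix x y"
    then have "bet (bet x c) (bet c y) - bet x y < 0" using smaller[OF xy] by simp
    then have "eventually (\<lambda>n. bet (bet (xs n) c) (bet c (ys n)) - bet (xs n) (ys n) < 0) sequentially"
      using order_tendstoD(2)[OF lim] by blast
    then show "eventually (\<lambda>n. c < mix (xs n) (ys n)) sequentially"
      by eventually_elim (simp add: smaller ge)
  next
    fix c assume "mix x y < c"
    then have "0 < bet (bet x c) (bet c y) - bet x y" using greater[OF xy] by simp
    then have "eventually (\<lambda>n. 0 < bet (bet (xs n) c) (bet c (ys n)) - bet (xs n) (ys n)) sequentially"
      using order_tendstoD(1)[OF lim] by blast
    then show "eventually (\<lambda>n. mix (xs n) (ys n) < c) sequentially"
      by eventually_elim (simp add: greater ge)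
  qed
qed

text \<open>With maximum and minimum, which are continuous, the ordered case covers all
  pairs.\<close>

lemma mix_max_min: "mix (max x y) (min x y) = mix x y"
  by (auto simp: max_def min_def mix_commute)

lemma continuous_mix: "continuous_on UNIV (\<lambda>p. mix (fst p) (snd p))"
  unfolding continuous_on_sequentially comp_def
proof (intro ballI allI impI)
  fix p :: "nat \<Rightarrow> real \<times> real" and a assume "(\<forall>n. p n \<in> UNIV) \<and> p \<longlonglongrightarrow> a"
  then have "(\<lambda>n. fst (p n)) \<longlonglongrightarrow> fst a" "(\<lambda>n. snd (p n)) \<longlonglongrightarrow> snd a"
    by (auto intro: tendsto_fst tendsto_snd)
  then have "(\<lambda>n. mix (max (fst (p n)) (snd (p n))) (min (fst (p n)) (snd (p n)))) \<longlonglongrightarrow>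
      mix (max (fst a) (snd a)) (min (fst a) (snd a))"
    by (intro mix_tendsto_ordered tendsto_max tendsto_min) auto
  then show "(\<lambda>n. mix (fst (p n)) (snd (p n))) \<longlonglongrightarrow> mix (fst a) (snd a)"
    by (simp only: mix_max_min)
qed

lemma half_mix_act_in:
  assumes X: "X \<in> acts F" and Y: "Y \<in> acts F"
  shows "half_mix_act F P R X Y \<in> acts F"
proof -
  obtain K where K: "\<And>\<omega>. \<omega> \<in> space F \<Longrightarrow> \<bar>X \<omega>\<bar> \<le> K" by (rule act_bound[OF X]) blast
  obtain L where L: "\<And>\<omega>. \<omega> \<in> space F \<Longrightarrow> \<bar>Y \<omega>\<bar> \<le> L" by (rule act_bound[OF Y]) blast
  have "X \<in> borel_measurable F" "Y \<in> borel_measurable F" using X Y by (simp_all add: acts_def)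
  then have "(\<lambda>\<omega>. mix (X \<omega>) (Y \<omega>)) \<in> borel_measurable F"
    using borel_measurable_continuous_Pair[OF _ _ continuous_mix, of X F Y] by simp
  moreover have "\<bar>mix (X \<omega>) (Y \<omega>)\<bar> \<le> max K L" if "\<omega> \<in> space F" for \<omega>
    using K[OF that] L[OF that] mix_between[of "X \<omega>" "Y \<omega>"] by linarith
  ultimately show ?thesis unfolding half_mix_act_def by (intro restrict_act bounded_measurableI)
qed

end

section \<open>Mixtures under comonotonic independence\<close>

locale comonotonic_independent_preference = regular_preference F P R for F P :: "'a measure" and R +
  assumes SCI: "axiom_SCI F P R"
begin

lemma half_mix_act_commute: "half_mix_act F P R X Y = half_mix_act F P R Y X"
  unfolding half_mix_act_def by (simp add: mix_commute)

lemma ce_half_mix_const: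
  assumes X: "X \<in> acts F" and Z: "Z \<in> acts F" and com: "comonotonic F X Z"
  shows "ce (half_mix_act F P R X Z) = ce (half_mix_act F P R (const_act F (ce X)) Z)"
proof -
  have "indiff R X (const_act F (ce X))" by (rule indiff_ce[OF X])
  then have "indiff R (half_mix_act F P R X Z) (half_mix_act F P R (const_act F (ce X)) Z)"
    using SCI[unfolded axiom_SCI_def, rule_format, OF X const_act_in(1) Z] com comonotonic_const by blast
  then show ?thesis using X Z const_act_in half_mix_act_in by (simp add: indiff_iff)
qed

lemma ce_half_mix_act:
  assumes X: "X \<in> acts F" and Z: "Z \<in> acts F" and com: "comonotonic F X Z"
  shows "ce (half_mix_act F P R X Z) = mix (ce X) (ce Z)"
proof -
  have "ce (half_mix_act F P R X Z) = ce (half_mix_act F P R Z (const_act F (ce X)))"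
    using ce_half_mix_const[OF X Z com] by (simp add: half_mix_act_commute)
  also have "\<dots> = ce (half_mix_act F P R (const_act F (ce Z)) (const_act F (ce X)))"
    by (rule ce_half_mix_const[OF Z const_act_in(1) comonotonic_const(1)])
  also have "half_mix_act F P R (const_act F (ce Z)) (const_act F (ce X)) = const_act F (mix (ce X) (ce Z))"
    by (auto simp: half_mix_act_def const_act_def mix_commute[of "ce X"])
  finally show ?thesis by simp
qed

text \<open>Bets on one event are comonotonic if both pay at least as much on \<open>A\<close> as
  off it; this is where the order conditions come from.\<close>

lemma mix_bet:
  assumes "y \<le> x" "y' \<le> x'"
  shows "bet (mix x x') (mix y y') = mix (bet x y) (bet x' y')"
proof -
  obtain A where A: "A \<in> sets F" "\<And>x y. bet x y = ce (binary_act F x A y)"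
    by (rule coin_flip_obtain) blast
  have "half_mix_act F P R (binary_act F x A y) (binary_act F x' A y') =
      binary_act F (mix x x') A (mix y y')"
    by (auto simp: half_mix_act_def binary_act_def)
  then show ?thesis unfolding A(2)
    using ce_half_mix_act[OF binary_act_in[OF A(1)] binary_act_in[OF A(1)] comonotonic_binary[OF assms]]
    by simp
qed

text \<open>
  The pair \<open>(x, b)\<close> with \<open>y < b\<close> is indifferent to \<open>(x', y)\<close>; mixing both with the constant \<open>y\<close> keeps
  the indifference, and since the second coordinate goes down from \<open>mix b y > y\<close> to \<open>y\<close>, the first
  one has to go up.
\<close>

lemma mix_locally_increasing:
  assumes yx: "y < x" and x: "x < x'" "bet x' y \<le> x"
  shows "mix x y < mix x' y"
proof -
  have "\<exists>b\<ge>y. b \<le> x \<and> bet x b = bet x' y"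
    by (rule IVT') (use assms in \<open>auto intro: continuous_bet continuous_intros\<close>)
  then obtain b where b: "y \<le> b" "b \<le> x" "bet x b = bet x' y" by blast
  have "b \<noteq> y" using b x by auto
  then have "y < b" using b by simp
  have "bet (mix x y) (mix b y) = mix (bet x b) (bet y y)" using b by (intro mix_bet) auto
  also have "\<dots> = bet (mix x' y) (mix y y)" using assms b by (subst mix_bet) auto
  finally have eq: "bet (mix x y) (mix b y) = bet (mix x' y) y" by (simp add: mix_idem)
  have "bet (mix x y) y < bet (mix x y) (mix b y)" using mix_strict_internal[OF \<open>y < b\<close>] by simp
  then show ?thesis using eq by simp
qed

text \<open>Mirror image of the preceding lemma: \<open>y\<close> is now the better payoff, the
  first coordinate rises from \<open>mix b y\<close> to \<open>y\<close>, so the second must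
  fall.\<close>

lemma mix_locally_decreasing:
  assumes yx: "x < y" and x: "x' < x" "x \<le> bet y x'"
  shows "mix x' y < mix x y"
proof -
  have "\<exists>b\<ge>x. b \<le> y \<and> bet b x = bet y x'"
    by (rule IVT') (use assms in \<open>auto intro: continuous_bet continuous_intros\<close>)
  then obtain b where b: "x \<le> b" "b \<le> y" "bet b x = bet y x'" by blast
  have "b \<noteq> y" using b x by auto
  then have "b < y" using b by simp
  have "bet (mix b y) (mix x y) = mix (bet b x) (bet y y)" using b by (intro mix_bet) auto
  also have "\<dots> = bet (mix y y) (mix x' y)" using assms b by (subst mix_bet) auto
  finally have eq: "bet (mix b y) (mix x y) = bet y (mix x' y)" by (simp add: mix_idem)
  have "bet (mix b y) (mix x y) < bet y (mix x y)"
    using mix_strict_internal[OF \<open>b < y\<close>] by (simp add: mix_commute)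
  then show ?thesis using eq by simp
qed

lemma continuous_mix1: "continuous_on S (\<lambda>x. mix x y)"
  by (rule continuous_on_compose2[OF continuous_mix, of S "\<lambda>x. (x, y)", simplified])
    (intro continuous_intros)

text \<open>From local to global by compactness: a maximiser other than \<open>t\<close> could be
  improved by \<open>mix_locally_increasing\<close> or, at \<open>y\<close> itself, by internality
  of the mixture.\<close>

lemma mix_strict_above:
  assumes "y \<le> s" "s < t" shows "mix s y < mix t y"
proof -
  have "\<exists>m\<in>{s..t}. \<forall>x\<in>{s..t}. mix x y \<le> mix m y"
    by (rule continuous_attains_sup) (use assms continuous_mix1 in auto)
  then obtain m where m: "m \<in> {s..t}" "\<And>x. x \<in> {s..t} \<Longrightarrow> mix x y \<le> mix m y" by blast
  \<comment> \<open>Proved for every maximiser, to be used again for \<open>s\<close>: equal values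
    at \<open>s\<close> and \<open>t\<close> would make \<open>s\<close> a maximiser as
    well.\<close>
  have "m = t" if m: "m \<in> {s..t}" "\<And>x. x \<in> {s..t} \<Longrightarrow> mix x y \<le> mix m y" for m
  proof (rule ccontr)
    assume "m \<noteq> t"
    then have mt: "m < t" using m by simp
    show False
    proof (cases "m = y")
      case True
      then have "mix m y < mix t y" using mix_strict_internal[of y t] mt by (simp add: mix_idem)
      then show False using m(2)[of t] assms by simp
    next
      case False
      then have "y < m" using m assms by simp
      \<comment> \<open>The local lemma reaches only points with \<open>bet x y \<le> m\<close>. If
        \<open>t\<close> is too far, the point where \<open>bet x y = m\<close> is taken; it lies
        beyond \<open>m\<close> since \<open>bet m y < m\<close>.\<close>
      have "\<exists>x. m < x \<and> x \<le> t \<and> bet x y \<le> m"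
      proof (cases "bet t y \<le> m")
        case True
        then show ?thesis using mt by auto
      next
        case False
        have "\<exists>x\<ge>m. x \<le> t \<and> bet x y = m"
          by (rule IVT') (use False mt \<open>y < m\<close> bet_internal(2)[of y m] in
            \<open>auto intro: continuous_bet continuous_intros\<close>)
        then obtain x where x: "m \<le> x" "x \<le> t" "bet x y = m" by blast
        then have "x \<noteq> m" using \<open>y < m\<close> bet_strict2[of y m m] by auto
        then show ?thesis using x by (intro exI[of _ x]) auto
      qed
      then obtain x where "m < x" "x \<le> t" "bet x y \<le> m" by blast
      then show False using mix_locally_increasing[OF \<open>y < m\<close>, of x] m(2)[of x] m(1) by auto
    qed
  qed
  note max_only = this
  then have "m = t" using m by blast
  have "mix s y \<le> mix t y" using m \<open>m = t\<close> assms by auto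
  moreover have "mix s y \<noteq> mix t y"
    using max_only[of s] m \<open>m = t\<close> assms by auto
  ultimately show ?thesis by simp
qed

text \<open>The same with minimisers, for arguments up to \<open>y\<close>.\<close>

lemma mix_strict_below:
  assumes "t \<le> y" "s < t" shows "mix s y < mix t y"
proof -
  have "\<exists>m\<in>{s..t}. \<forall>x\<in>{s..t}. mix m y \<le> mix x y"
    by (rule continuous_attains_inf) (use assms continuous_mix1 in auto)
  then obtain m where m: "m \<in> {s..t}" "\<And>x. x \<in> {s..t} \<Longrightarrow> mix m y \<le> mix x y" by blast
  have "m = s" if m: "m \<in> {s..t}" "\<And>x. x \<in> {s..t} \<Longrightarrow> mix m y \<le> mix x y" for m
  proof (rule ccontr)
    assume "m \<noteq> s"
    then have mt: "s < m" using m by simp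
    show False
    proof (cases "m = y")
      case True
      then have "mix s y < mix m y" using mix_strict_internal[of s y] mt by (simp add: mix_idem mix_commute)
      then show False using m(2)[of s] assms by simp
    next
      case False
      then have "m < y" using m assms by simp
      have "\<exists>x. s \<le> x \<and> x < m \<and> m \<le> bet y x"
      proof (cases "m \<le> bet y s")
        case True
        then show ?thesis using mt by auto
      next
        case False
        have "\<exists>x\<ge>s. x \<le> m \<and> bet y x = m"
          by (rule IVT') (use False mt \<open>m < y\<close> bet_internal(1)[of m y] in
            \<open>auto intro: continuous_bet continuous_intros\<close>)
        then obtain x where x: "s \<le> x" "x \<le> m" "bet y x = m" by blast
        then have "x \<noteq> m" using \<open>m < y\<close> bet_strict1[of m y m] by auto
        then show ?thesis using x by (intro exI[of _ x]) auto
      qed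
      then obtain x where "s \<le> x" "x < m" "m \<le> bet y x" by blast
      then show False using mix_locally_decreasing[OF \<open>m < y\<close>, of x] m(2)[of x] m(1) by auto
    qed
  qed
  note min_only = this
  then have "m = s" using m by blast
  have "mix s y \<le> mix t y" using m \<open>m = s\<close> assms by auto
  moreover have "mix s y \<noteq> mix t y"
    using min_only[of t] m \<open>m = s\<close> assms by auto
  ultimately show ?thesis by simp
qed

lemma mix_strict: assumes "x < x'" shows "mix x y < mix x' y"
proof -
  consider "y \<le> x" | "x' \<le> y" | "x < y" "y < x'" by linarith
  then show ?thesis
  proof cases
    case 3
    then have "mix x y < mix y y" "mix y y < mix x' y"
      by (auto intro: mix_strict_above mix_strict_below)
    then show ?thesis by simp
  qed (use assms mix_strict_above mix_strict_below in auto)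
qed

text \<open>Mixing the defining equations of \<open>mix x y\<close> and \<open>mix z w\<close> by
  means of \<open>mix_bet\<close> gives precisely the defining equation of the mixture of
  \<open>mix x z\<close> and \<open>mix y w\<close>, solved by \<open>mix a b\<close>; uniqueness
  concludes.\<close>

lemma mix_medial_ordered:
  assumes "y \<le> x" "w \<le> z"
  shows "mix (mix x y) (mix z w) = mix (mix x z) (mix y w)"
proof -
  define a b where "a = mix x y" and "b = mix z w"
  have le1: "mix p q \<le> mix p' q" if "p \<le> p'" for p p' q
    using mix_strict[of p p' q] that by (cases "p = p'") auto
  have le: "mix p q \<le> mix p' q'" if "p \<le> p'" "q \<le> q'" for p p' q q'
    using le1[OF that(1), of q] le1[OF that(2), of p'] by (simp add: mix_commute)
  have a: "y \<le> a" "a \<le> x" and b: "w \<le> b" "b \<le> z"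
    using mix_in assms by (auto simp: a_def b_def)
  have "bet (mix x z) (mix y w) = mix (bet x y) (bet z w)" by (rule mix_bet[OF assms])
  also have "\<dots> = mix (bet (bet x a) (bet a y)) (bet (bet z b) (bet b w))"
    using mix_eq assms by (simp add: a_def b_def)
  also have "\<dots> = bet (mix (bet x a) (bet z b)) (mix (bet a y) (bet b w))"
    using a b by (intro mix_bet[symmetric]) (auto intro: order_trans[OF bet_internal(2) bet_internal(1)])
  also have "\<dots> = bet (bet (mix x z) (mix a b)) (bet (mix a b) (mix y w))"
    using a b by (simp add: mix_bet)
  finally have "mix (mix x z) (mix y w) = mix a b"
    using a b assms by (intro mix_unique) (auto intro: le)
  then show ?thesis by (simp add: a_def b_def)
qed

text \<open>Mediality is available only for pairs ordered as in \<open>mix_medial_ordered\<close>.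
  Commutativity permutes the four arguments until such pairs appear: \<open>top\<close> treats a
  largest \<open>x\<close>, \<open>half\<close> removes the order of \<open>z\<close> and
  \<open>w\<close>, and swapping inside the pairs removes the last condition.\<close>

sublocale real_mean mix
proof
  have top: "mix (mix x y) (mix z w) = mix (mix x z) (mix y w)"
    if le: "y \<le> x" "z \<le> w" "w \<le> x" for x y z w
  proof (cases "y \<le> w")
    \<comment> \<open>Both sides are compared with the third pairing
      \<open>mix (mix x w) (mix y z)\<close>.\<close>
    case True
    then show ?thesis
      using mix_medial_ordered[of y x z w] mix_medial_ordered[of z x y w] le
      by (simp add: mix_commute)
  next
    case False
    then show ?thesis using mix_medial_ordered[of z x w y] le by (simp add: mix_commute)
  qed
  have half: "mix (mix x y) (mix z w) = mix (mix x z) (mix y w)" if yx: "y \<le> x" for x y z w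
  proof (cases "w \<le> z")
    case True
    then show ?thesis by (rule mix_medial_ordered[OF yx])
  next
    case False
    then show ?thesis using top[of y x z w] top[of z w y x] yx
      by (cases "w \<le> x") (simp_all add: mix_commute)
  qed
  show "mix (mix x y) (mix z w) = mix (mix x z) (mix y w)" for x y z w
    using half[of y x z w] half[of x y w z] by (cases "y \<le> x") (simp_all add: mix_commute)
qed (use mix_commute mix_idem mix_strict continuous_mix1 in auto)

end

section \<open>Comonotonically additive functionals\<close>

text \<open>Monotone, normalised, comonotonically additive functionals, as in Schmeidler's
  characterisation of the Choquet integral. Homogeneity is derived below for powers of 1/2.\<close>

definition comonotonic_functional :: "'a measure \<Rightarrow> (('a \<Rightarrow> real) \<Rightarrow> real) \<Rightarrow> bool" where
  "comonotonic_functional F V \<longleftrightarrow>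
     (\<forall>X Y. bounded_measurable F X \<longrightarrow> bounded_measurable F Y \<longrightarrow>
        (\<forall>\<omega>\<in>space F. X \<omega> \<le> Y \<omega>) \<longrightarrow> V X \<le> V Y) \<and>
     (\<forall>X Y. bounded_measurable F X \<longrightarrow> bounded_measurable F Y \<longrightarrow> comonotonic F X Y \<longrightarrow>
        V (\<lambda>\<omega>. X \<omega> + Y \<omega>) = V X + V Y) \<and>
     (\<forall>c. V (\<lambda>\<omega>. c) = c)"

lemma
  assumes "comonotonic_functional F V"
  shows comonotonic_functional_mono: "\<And>X Y. bounded_measurable F X \<Longrightarrow> bounded_measurable F Y \<Longrightarrow>
      (\<And>\<omega>. \<omega> \<in> space F \<Longrightarrow> X \<omega> \<le> Y \<omega>) \<Longrightarrow> V X \<le> V Y"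
    and comonotonic_functional_add: "\<And>X Y. bounded_measurable F X \<Longrightarrow> bounded_measurable F Y \<Longrightarrow>
      comonotonic F X Y \<Longrightarrow> V (\<lambda>\<omega>. X \<omega> + Y \<omega>) = V X + V Y"
    and comonotonic_functional_const: "\<And>c. V (\<lambda>\<omega>. c) = c"
  using assms unfolding comonotonic_functional_def by blast+

lemma bounded_measurable_const: "bounded_measurable F (\<lambda>\<omega>. c)"
  by (rule bounded_measurableI[where K = "\<bar>c\<bar>"]) auto

lemma bounded_measurable_indicator:
  assumes "A \<in> sets F" shows "bounded_measurable F (\<lambda>\<omega>. c * indicator A \<omega>)"
proof (rule bounded_measurableI[where K = "\<bar>c\<bar>"])
  show "(\<lambda>\<omega>. c * indicator A \<omega>) \<in> borel_measurable F"
    by (intro borel_measurable_times borel_measurable_const borel_measurable_indicator assms)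
qed (auto simp: indicator_def)

lemma bounded_measurable_staircase:
  assumes "\<And>i. A i \<in> sets F"
  shows "bounded_measurable F (\<lambda>\<omega>. \<Sum>i<N::nat. c * indicator (A i) \<omega>)"
proof (induction N)
  case (Suc N)
  then show ?case using bounded_measurable_add[OF Suc bounded_measurable_indicator[OF assms]] by simp
qed (simp add: bounded_measurable_const)

text \<open>A profile is comonotonic with itself, so doubling is an instance of additivity.\<close>

lemma comonotonic_functional_halve:
  assumes V: "comonotonic_functional F V" and X: "bounded_measurable F X"
  shows "V (\<lambda>\<omega>. X \<omega> / 2) = V X / 2"
proof -
  let ?H = "\<lambda>\<omega>. X \<omega> / 2"
  have "bounded_measurable F (\<lambda>\<omega>. X \<omega> / 2)"
  proof -
    obtain K where "\<And>\<omega>. \<omega> \<in> space F \<Longrightarrow> \<bar>X \<omega>\<bar> \<le> K" by (rule bounded_measurableD[OF X]) blast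
    then show ?thesis using X
      by (intro bounded_measurableI[where K = "K / 2"]) (auto simp: bounded_measurable_def)
  qed
  moreover have "comonotonic F ?H ?H" by (auto simp: comonotonic_def)
  ultimately have "V (\<lambda>\<omega>. ?H \<omega> + ?H \<omega>) = V ?H + V ?H" by (intro comonotonic_functional_add[OF V])
  then show ?thesis by simp
qed

lemma comonotonic_functional_dyadic:
  assumes V: "comonotonic_functional F V" and A: "A \<in> sets F"
  shows "V (\<lambda>\<omega>. (1/2)^n * indicator A \<omega>) = (1/2)^n * V (indicator A)"
proof (induction n)
  case (Suc n)
  have "V (\<lambda>\<omega>. (1/2)^n * indicator A \<omega> / 2) = V (\<lambda>\<omega>. (1/2)^n * indicator A \<omega>) / 2"
    by (rule comonotonic_functional_halve[OF V bounded_measurable_indicator[OF A]])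
  then show ?case using Suc by simp
qed simp

text \<open>Along a decreasing sequence of events each indicator is comonotonic with the sum of the
  earlier ones, so additivity splits the sum one event at a time.\<close>

lemma comonotonic_functional_staircase:
  assumes V: "comonotonic_functional F V" and A: "\<And>i. A i \<in> sets F" "decseq A"
  shows "V (\<lambda>\<omega>. \<Sum>i<N. (1/2)^n * indicator (A i) \<omega>) = (\<Sum>i<N. (1/2)^n * V (indicator (A i)))"
proof (induction N)
  case 0
  then show ?case using comonotonic_functional_const[OF V, of 0] by simp
next
  case (Suc N)
  let ?c = "(1/2)^n :: real"
  let ?S = "\<lambda>\<omega>. \<Sum>i<N. ?c * indicator (A i) \<omega>" and ?I = "\<lambda>\<omega>. ?c * indicator (A N) \<omega>"
  \<comment> \<open>A point of \<open>A N\<close> lies in all earlier events, so the partial sum is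
    maximal there.\<close>
  have top: "?S \<omega>' \<le> ?S \<omega>" if "\<omega> \<in> A N" for \<omega> \<omega>'
  proof (rule sum_mono)
    fix i assume "i \<in> {..<N}"
    then have "A N \<subseteq> A i" using decseqD[OF A(2), of i N] by simp
    then show "?c * indicator (A i) \<omega>' \<le> ?c * indicator (A i) \<omega>" using that by (auto simp: indicator_def)
  qed
  have "comonotonic F ?S ?I" unfolding comonotonic_def
  proof (intro ballI)
    fix \<omega> \<omega>'
    consider "\<omega> \<in> A N \<longleftrightarrow> \<omega>' \<in> A N" | "\<omega> \<in> A N" "\<omega>' \<notin> A N" | "\<omega> \<notin> A N" "\<omega>' \<in> A N"
      by blast
    then show "0 \<le> (?S \<omega> - ?S \<omega>') * (?I \<omega> - ?I \<omega>')"
    proof cases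
      case 1
      then have "?I \<omega> = ?I \<omega>'" by (simp add: indicator_def)
      then show ?thesis by simp
    next
      case 2
      then show ?thesis using top[of \<omega> \<omega>'] by (intro mult_nonneg_nonneg) simp_all
    next
      case 3
      then show ?thesis using top[of \<omega>' \<omega>] by (intro mult_nonpos_nonpos) simp_all
    qed
  qed
  then have "V (\<lambda>\<omega>. ?S \<omega> + ?I \<omega>) = V ?S + V ?I"
    by (intro comonotonic_functional_add[OF V] bounded_measurable_staircase bounded_measurable_indicator A)
  then show ?case using Suc comonotonic_functional_dyadic[OF V A(1)] by simp
qed

text \<open>The number of grid points \<open>i * h\<close> strictly below \<open>v\<close> is the
  ceiling of \<open>v / h\<close>, which exceeds \<open>v / h\<close> by at most 1.\<close>

lemma staircase_approx:
  assumes h: "0 < h" and v: "0 \<le> v" "v \<le> real N * h"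
  shows "v \<le> (\<Sum>i<N. h * of_bool (real i * h < v))" "(\<Sum>i<N. h * of_bool (real i * h < v)) \<le> v + h"
proof -
  define k where "k = nat \<lceil>v / h\<rceil>"
  have k: "real i * h < v \<longleftrightarrow> i < k" for i
  proof -
    have "real i * h < v \<longleftrightarrow> real i < v / h" using h by (simp add: field_simps)
    also have "\<dots> \<longleftrightarrow> int i < \<lceil>v / h\<rceil>" by (simp add: less_ceiling_iff)
    also have "\<dots> \<longleftrightarrow> i < k" unfolding k_def by linarith
    finally show ?thesis .
  qed
  have "k \<le> N" using v h unfolding k_def by (simp add: nat_le_iff ceiling_le_iff field_simps)
  then have "{..<N} \<inter> {i. i < k} = {..<k}" by auto
  then have "(\<Sum>i<N. h * of_bool (real i * h < v)) = h * real k"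
    by (simp add: k sum_distrib_left[symmetric] of_bool_def sum.If_cases)
  moreover have "v / h \<le> real k" "real k \<le> v / h + 1"
  proof -
    have "0 \<le> \<lceil>v / h\<rceil>" using v h by (simp add: less_le_trans[of "-1" 0])
    then have "real k = of_int \<lceil>v / h\<rceil>" by (simp add: k_def)
    then show "v / h \<le> real k" "real k \<le> v / h + 1" by linarith+
  qed
  ultimately show "v \<le> (\<Sum>i<N. h * of_bool (real i * h < v))" "(\<Sum>i<N. h * of_bool (real i * h < v)) \<le> v + h"
    using h by (simp_all add: field_simps)
qed

text \<open>Staircases approximate every profile up to the step height \<open>h\<close>, and both
  functionals agree on staircases because these are sums of multiples of indicators. The height is a
  power of 1/2, as only such multiples have been evaluated.\<close>

lemma comonotonic_functional_unique:
  assumes V: "comonotonic_functional F V" and W: "comonotonic_functional F W"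
    and eq: "\<And>A. A \<in> sets F \<Longrightarrow> V (indicator A) = W (indicator A)"
    and X: "bounded_measurable F X"
  shows "V X = W X"
proof -
  \<comment> \<open>An inequality suffices: the assumptions are symmetric in the two
    functionals.\<close>
  have le: "V X \<le> W X" if V: "comonotonic_functional F V" and W: "comonotonic_functional F W"
    and eq: "\<And>A. A \<in> sets F \<Longrightarrow> V (indicator A) = W (indicator A)" for V W
  proof -
    obtain K0 where K0: "\<And>\<omega>. \<omega> \<in> space F \<Longrightarrow> \<bar>X \<omega>\<bar> \<le> K0" by (rule bounded_measurableD[OF X]) blast
    obtain K :: nat where "K0 \<le> real K" using real_arch_simple by blast
    then have K: "\<bar>X \<omega>\<bar> \<le> real K" if "\<omega> \<in> space F" for \<omega> using K0[OF that] by simp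
    \<comment> \<open>Shifting by \<open>K\<close> makes the profile nonnegative; additivity with a
      constant removes the shift at the end.\<close>
    let ?Y = "\<lambda>\<omega>. X \<omega> + real K"
    have Y: "bounded_measurable F ?Y" by (rule bounded_measurable_add[OF X bounded_measurable_const])
    have "V ?Y \<le> W ?Y + (1/2)^n" for n
    proof -
      define h :: real where "h = (1/2)^n"
      \<comment> \<open>The shifted profile takes values up to \<open>2 * K\<close>, so this many
        steps of height \<open>h\<close> reach its top.\<close>
      define N where "N = 2 * K * 2 ^ n"
      define A where "A i = {\<omega> \<in> space F. real i * h < ?Y \<omega>}" for i
      let ?S = "\<lambda>\<omega>. \<Sum>i<N. h * indicator (A i) \<omega>"
      have h: "0 < h" "real N * h = 2 * real K" by (simp_all add: h_def N_def power_divide)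
      have A: "\<And>i. A i \<in> sets F"
        using Y unfolding A_def bounded_measurable_def borel_measurable_iff_greater by blast
      have dec: "decseq A"
      proof (rule decseq_SucI)
        fix i
        have "real i * h \<le> real (Suc i) * h" using h by simp
        then show "A (Suc i) \<subseteq> A i" unfolding A_def by (auto simp del: of_nat_Suc)
      qed
      have S: "bounded_measurable F ?S" by (rule bounded_measurable_staircase[OF A])
      have bounds: "?Y \<omega> \<le> ?S \<omega>" "?S \<omega> \<le> ?Y \<omega> + h" if "\<omega> \<in> space F" for \<omega>
      proof -
        have S_eq: "?S \<omega> = (\<Sum>i<N. h * of_bool (real i * h < ?Y \<omega>))"
          using that by (intro sum.cong refl) (simp add: A_def indicator_def)
        have "0 \<le> ?Y \<omega>" "?Y \<omega> \<le> real N * h" using K[OF that] unfolding h(2) by linarith+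
        then show "?Y \<omega> \<le> ?S \<omega>" "?S \<omega> \<le> ?Y \<omega> + h"
          unfolding S_eq by (rule staircase_approx[OF h(1)])+
      qed
      have "V ?Y \<le> V ?S" by (rule comonotonic_functional_mono[OF V Y S]) (rule bounds)
      also have "V ?S = W ?S"
        unfolding h_def comonotonic_functional_staircase[OF V A dec] comonotonic_functional_staircase[OF W A dec]
        by (simp only: eq[OF A])
      also have "\<dots> \<le> W (\<lambda>\<omega>. ?Y \<omega> + h)"
        by (rule comonotonic_functional_mono[OF W S bounded_measurable_add[OF Y bounded_measurable_const]])
          (rule bounds)
      also have "\<dots> = W ?Y + h"
        using comonotonic_functional_add[OF W Y bounded_measurable_const, of h]
          comonotonic_functional_const[OF W] by (simp add: comonotonic_def)
      finally show ?thesis by (simp add: h_def)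
    qed
    moreover have "(\<lambda>n. W ?Y + (1/2)^n) \<longlonglongrightarrow> W ?Y + 0"
      by (intro tendsto_add tendsto_const LIMSEQ_power_zero) simp
    ultimately have "V ?Y \<le> W ?Y + 0" by (intro LIMSEQ_le_const) auto
    moreover have "V ?Y = V X + real K" "W ?Y = W X + real K"
      using comonotonic_functional_add[OF V X bounded_measurable_const, of "real K"]
        comonotonic_functional_add[OF W X bounded_measurable_const, of "real K"]
        comonotonic_functional_const[OF V] comonotonic_functional_const[OF W]
      by (simp_all add: comonotonic_def)
    ultimately show ?thesis by simp
  qed
  show ?thesis using le[OF V W eq] le[OF W V eq[symmetric]] by simp
qed

lemma (in continuous_capacity_space) comonotonic_functional_choquet:
  "comonotonic_functional F (choquet F \<mu>)"
  unfolding comonotonic_functional_def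
  using choquet_mono choquet_comonotonic_add choquet_const by blast

lemma (in continuous_capacity_space) choquet_indicator:
  assumes "A \<in> sets F" shows "choquet F \<mu> (indicator A) = \<mu> A"
proof -
  have "(indicator A :: 'a \<Rightarrow> real) = (\<lambda>\<omega>. if \<omega> \<in> A then 1 else 0)" by (auto simp: indicator_def)
  then show ?thesis using choquet_binary[OF assms, of 0 1] by simp
qed

section \<open>From the axioms to the representation\<close>

context comonotonic_independent_preference
begin

context
  fixes u :: "real \<Rightarrow> real"
  assumes u_strict: "strict_mono u" and u_cont: "continuous_on UNIV u"
    and u_jensen: "jensen_on UNIV u" and u_0: "u 0 = 0"
begin

lemma u_less [simp]: "u x < u y \<longleftrightarrow> x < y" and u_le [simp]: "u x \<le> u y \<longleftrightarrow> x \<le> y"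
  and u_eq [simp]: "u x = u y \<longleftrightarrow> x = y"
  using u_strict by (auto simp: strict_mono_less strict_mono_less_eq strict_mono_eq)

lemma u_mix: "u (mix x y) = (u x + u y) / 2"
  using jensen_onD[OF u_jensen] by simp

section \<open>Utility profiles as scaled acts\<close>

text \<open>By the intermediate value theorem \<open>u\<close> attains every value of modulus at
  most \<open>radius\<close>, even on \<open>{- 1..1}\<close>; 1 and -1 are arbitrary points on the
  two sides of 0.\<close>

definition radius :: real where "radius = min (u 1) (- u (- 1))"

lemma radius_pos: "0 < radius"
proof -
  have "u 0 < u 1" "u (- 1) < u 0" by simp_all
  then show ?thesis unfolding u_0 radius_def by simp
qed

text \<open>An inverse of \<open>u\<close> near 0. Clamping keeps it defined and nondecreasing on
  the whole line, hence measurable.\<close>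

definition uinv :: "real \<Rightarrow> real" where
  "uinv t = (SOME x. u x = max (- radius) (min radius t))"

lemma u_uinv: "u (uinv t) = max (- radius) (min radius t)"
proof -
  let ?c = "max (- radius) (min radius t)"
  have "u (- 1) \<le> ?c" "?c \<le> u 1" using radius_pos by (auto simp: radius_def)
  then have "\<exists>x\<ge>- 1. x \<le> 1 \<and> u x = ?c"
    by (intro IVT') (auto intro: continuous_on_subset[OF u_cont])
  then have "\<exists>x. u x = ?c" by blast
  then show ?thesis unfolding uinv_def by (rule someI_ex)
qed

lemma u_uinv_inside: "\<bar>t\<bar> \<le> radius \<Longrightarrow> u (uinv t) = t"
  by (auto simp: u_uinv abs_le_iff)

lemma uinv_mono: "s \<le> t \<Longrightarrow> uinv s \<le> uinv t"
  by (subst u_le[symmetric]) (auto simp: u_uinv)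

lemma uinv_0 [simp]: "uinv 0 = 0"
  using u_uinv_inside[of 0] radius_pos u_0 by (metis abs_zero less_imp_le u_eq)

text \<open>
  Utility profiles \<open>W\<close> need not take values in the range of \<open>u\<close>, but \<open>W / 2 ^ n\<close> does for large \<open>n\<close>,
  and \<open>scaled_value\<close> is then independent of \<open>n\<close>.
\<close>

definition scaled_act :: "nat \<Rightarrow> ('a \<Rightarrow> real) \<Rightarrow> 'a \<Rightarrow> real" where
  "scaled_act n W = (\<lambda>\<omega>\<in>space F. uinv (W \<omega> / 2 ^ n))"

definition scaled_value :: "nat \<Rightarrow> ('a \<Rightarrow> real) \<Rightarrow> real" where
  "scaled_value n W = 2 ^ n * u (ce (scaled_act n W))"

text \<open>The clamping in \<open>uinv\<close> does not act on \<open>W / 2 ^ n\<close>.\<close>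

definition fits :: "nat \<Rightarrow> ('a \<Rightarrow> real) \<Rightarrow> bool" where
  "fits n W \<longleftrightarrow> (\<forall>\<omega>\<in>space F. \<bar>W \<omega>\<bar> \<le> radius * 2 ^ n)"

lemma fitsD: "fits n W \<Longrightarrow> \<omega> \<in> space F \<Longrightarrow> \<bar>W \<omega> / 2 ^ n\<bar> \<le> radius"
  by (auto simp: fits_def field_simps)

lemma scaled_act_in:
  assumes W: "bounded_measurable F W"
  shows "scaled_act n W \<in> acts F"
  unfolding scaled_act_def
proof (intro restrict_act bounded_measurableI)
  have "uinv \<in> borel_measurable borel" by (rule borel_measurable_mono) (auto intro: monoI uinv_mono)
  moreover have "(\<lambda>\<omega>. W \<omega> / 2 ^ n) \<in> borel_measurable F" using W by (auto simp: bounded_measurable_def)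
  ultimately show "(\<lambda>\<omega>. uinv (W \<omega> / 2 ^ n)) \<in> borel_measurable F"
    by (rule measurable_compose[rotated])
  fix \<omega>
  have "- 1 \<le> uinv t" "uinv t \<le> 1" for t
    using radius_pos by (subst u_le[symmetric], auto simp: u_uinv radius_def)+
  then show "\<bar>uinv (W \<omega> / 2 ^ n)\<bar> \<le> 1" by (simp add: abs_le_iff minus_le_iff)
qed

lemma fits_exists:
  assumes "bounded_measurable F W"
  obtains n where "\<And>k. n \<le> k \<Longrightarrow> fits k W"
proof -
  obtain K where K: "\<And>\<omega>. \<omega> \<in> space F \<Longrightarrow> \<bar>W \<omega>\<bar> \<le> K" by (rule bounded_measurableD[OF assms]) blast
  obtain n where n: "K / radius < 2 ^ n" using real_arch_pow[of 2 "K / radius"] by auto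
  have "fits k W" if "n \<le> k" for k
  proof -
    have "(2::real) ^ n \<le> 2 ^ k" using that by (rule power_increasing) simp
    then have "K / radius \<le> 2 ^ k" using n by linarith
    then have "K \<le> radius * 2 ^ k" using radius_pos by (simp add: field_simps)
    then show ?thesis using K unfolding fits_def by (meson order_trans)
  qed
  then show ?thesis using that by blast
qed

text \<open>A mixture averages utilities, so mixing the acts for \<open>X / 2 ^ n\<close> and
  \<open>Y / 2 ^ n\<close> yields the act for \<open>(X + Y) / 2 ^ Suc n\<close>; the exponent
  increases by one to absorb the factor 1/2.\<close>

lemma scaled_value_add:
  assumes X: "bounded_measurable F X" and Y: "bounded_measurable F Y" and com: "comonotonic F X Y"
    and fits: "fits n X" "fits n Y"
  shows "scaled_value (Suc n) (\<lambda>\<omega>. X \<omega> + Y \<omega>) = scaled_value n X + scaled_value n Y"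
proof -
  let ?X = "scaled_act n X" and ?Y = "scaled_act n Y"
  have "comonotonic F ?X ?Y" unfolding comonotonic_def
  proof (intro ballI)
    fix \<omega> \<omega>' assume w: "\<omega> \<in> space F" "\<omega>' \<in> space F"
    then have "0 \<le> (X \<omega> - X \<omega>') * (Y \<omega> - Y \<omega>')" using com by (auto simp: comonotonic_def)
    then consider "X \<omega>' \<le> X \<omega>" "Y \<omega>' \<le> Y \<omega>" | "X \<omega> \<le> X \<omega>'" "Y \<omega> \<le> Y \<omega>'"
      by (auto simp: zero_le_mult_iff)
    then show "0 \<le> (?X \<omega> - ?X \<omega>') * (?Y \<omega> - ?Y \<omega>')"
    proof cases
      case 1
      then show ?thesis using w
        by (intro mult_nonneg_nonneg) (auto simp: scaled_act_def intro!: uinv_mono divide_right_mono)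
    next
      case 2
      then show ?thesis using w
        by (intro mult_nonpos_nonpos) (auto simp: scaled_act_def intro!: uinv_mono divide_right_mono)
    qed
  qed
  then have "ce (half_mix_act F P R ?X ?Y) = mix (ce ?X) (ce ?Y)"
    by (intro ce_half_mix_act scaled_act_in X Y)
  moreover have "half_mix_act F P R ?X ?Y = scaled_act (Suc n) (\<lambda>\<omega>. X \<omega> + Y \<omega>)"
    unfolding half_mix_act_def scaled_act_def
  proof (rule restrict_ext)
    fix \<omega> assume w: "\<omega> \<in> space F"
    note b = fitsD[OF fits(1) w] fitsD[OF fits(2) w]
    have eq: "(X \<omega> + Y \<omega>) / 2 ^ Suc n = (X \<omega> / 2 ^ n + Y \<omega> / 2 ^ n) / 2" by (simp add: field_simps)
    have "\<bar>(X \<omega> + Y \<omega>) / 2 ^ Suc n\<bar> \<le> radius" unfolding eq using b by (simp add: abs_le_iff field_simps)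
    then have "u (mix (uinv (X \<omega> / 2 ^ n)) (uinv (Y \<omega> / 2 ^ n))) = u (uinv ((X \<omega> + Y \<omega>) / 2 ^ Suc n))"
      by (simp only: u_mix u_uinv_inside b eq)
    then have "mix (uinv (X \<omega> / 2 ^ n)) (uinv (Y \<omega> / 2 ^ n)) = uinv ((X \<omega> + Y \<omega>) / 2 ^ Suc n)"
      by (simp only: u_eq)
    then show "mix ((\<lambda>\<omega>\<in>space F. uinv (X \<omega> / 2 ^ n)) \<omega>) ((\<lambda>\<omega>\<in>space F. uinv (Y \<omega> / 2 ^ n)) \<omega>)
        = uinv ((X \<omega> + Y \<omega>) / 2 ^ Suc n)" using w by simp
  qed
  ultimately show ?thesis by (simp add: scaled_value_def u_mix distrib_left)
qed

lemma scaled_value_const: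
  assumes "\<bar>c\<bar> \<le> radius * 2 ^ n"
  shows "scaled_value n (\<lambda>\<omega>. c) = c"
proof -
  have "\<bar>c / 2 ^ n\<bar> \<le> radius" using assms by (simp add: field_simps)
  then have "u (uinv (c / 2 ^ n)) = c / 2 ^ n" by (rule u_uinv_inside)
  moreover have "scaled_act n (\<lambda>\<omega>. c) = const_act F (uinv (c / 2 ^ n))"
    by (simp add: scaled_act_def const_act_def)
  ultimately show ?thesis by (simp add: scaled_value_def)
qed

text \<open>Add the zero profile, which is comonotonic with everything and has value 0.\<close>

lemma scaled_value_Suc:
  assumes X: "bounded_measurable F X" and fits: "fits n X"
  shows "scaled_value (Suc n) X = scaled_value n X"
proof -
  have "scaled_value (Suc n) (\<lambda>\<omega>. X \<omega> + 0) = scaled_value n X + scaled_value n (\<lambda>\<omega>. 0)"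
    using radius_pos
    by (intro scaled_value_add X bounded_measurable_const fits) (auto simp: comonotonic_def fits_def)
  then show ?thesis using radius_pos by (simp add: scaled_value_const)
qed

text \<open>By \<open>val_eq\<close> every fitting exponent gives this value; the least one is just
  a canonical choice.\<close>

definition val :: "('a \<Rightarrow> real) \<Rightarrow> real" where
  "val W = scaled_value (LEAST n. \<forall>k\<ge>n. fits k W) W"

lemma val_eq:
  assumes W: "bounded_measurable F W" and n: "fits n W"
  shows "val W = scaled_value n W"
proof -
  have suc: "fits (Suc k) W" if "fits k W" for k
  proof -
    have "radius * 2 ^ k \<le> radius * 2 ^ Suc k" using radius_pos by simp
    then show ?thesis using that unfolding fits_def by (meson order_trans)
  qed
  have up: "fits k W \<and> scaled_value k W = scaled_value j W" if "j \<le> k" "fits j W" for j k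
    using that by (induction k rule: dec_induct) (auto simp: scaled_value_Suc[OF W] suc)
  define L where "L = (LEAST n. \<forall>k\<ge>n. fits k W)"
  have "\<forall>k\<ge>L. fits k W" unfolding L_def by (rule LeastI[of _ n]) (use up n in blast)
  then have "fits L W" by blast
  then have "scaled_value L W = scaled_value n W"
    using up[of L n] up[of n L] n by (cases "L \<le> n") auto
  then show ?thesis by (simp add: val_def L_def)
qed

lemma comonotonic_functional_val: "comonotonic_functional F val"
  unfolding comonotonic_functional_def
proof (intro conjI allI impI)
  fix X Y assume X: "bounded_measurable F X" and Y: "bounded_measurable F Y"
  obtain i where i: "\<And>k. i \<le> k \<Longrightarrow> fits k X" by (rule fits_exists[OF X]) blast
  obtain j where j: "\<And>k. j \<le> k \<Longrightarrow> fits k Y" by (rule fits_exists[OF Y]) blast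
  have XY: "bounded_measurable F (\<lambda>\<omega>. X \<omega> + Y \<omega>)" by (rule bounded_measurable_add[OF X Y])
  obtain l where l: "\<And>k. l \<le> k \<Longrightarrow> fits k (\<lambda>\<omega>. X \<omega> + Y \<omega>)" by (rule fits_exists[OF XY]) blast
  define n where "n = max i (max j l)"
  have n: "fits n X" "fits n Y" "fits (Suc n) (\<lambda>\<omega>. X \<omega> + Y \<omega>)"
    by (auto simp: n_def intro!: i j l)
  show "val X \<le> val Y" if le: "\<forall>\<omega>\<in>space F. X \<omega> \<le> Y \<omega>"
  proof -
    have "ce (scaled_act n X) \<le> ce (scaled_act n Y)"
      by (intro ce_mono scaled_act_in X Y)
        (use le in \<open>auto simp: scaled_act_def intro!: uinv_mono divide_right_mono\<close>)
    then show ?thesis using val_eq[OF X n(1)] val_eq[OF Y n(2)] by (simp add: scaled_value_def)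
  qed
  show "val (\<lambda>\<omega>. X \<omega> + Y \<omega>) = val X + val Y" if com: "comonotonic F X Y"
    using scaled_value_add[OF X Y com n(1,2)] val_eq[OF X n(1)] val_eq[OF Y n(2)] val_eq[OF XY n(3)]
    by simp
next
  fix c
  have c: "bounded_measurable F (\<lambda>\<omega>. c)" by (rule bounded_measurable_const)
  obtain i where i: "\<And>k. i \<le> k \<Longrightarrow> fits k (\<lambda>\<omega>. c)" by (rule fits_exists[OF c]) blast
  have "space F \<noteq> {}" using P.not_empty by (simp add: space_eq)
  then have "\<bar>c\<bar> \<le> radius * 2 ^ i" using i[of i] by (auto simp: fits_def)
  then show "val (\<lambda>\<omega>. c) = c" using val_eq[OF c i[of i]] scaled_value_const by simp
qed

text \<open>\<open>u o X\<close> may leave the domain on which \<open>uinv\<close> is exact. Mixing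
  \<open>X\<close> repeatedly with the constant 0 halves both the utilities and the utility of the
  certainty equivalent until the profile fits; injectivity of \<open>u\<close> then identifies the
  result with the scaled act.\<close>

lemma val_utility:
  assumes X: "X \<in> acts F"
  shows "val (u \<circ> X) = u (ce X)"
proof -
  have uX: "bounded_measurable F (u \<circ> X)"
    by (rule bounded_measurable_compose[OF act_bounded_measurable[OF X] u_cont])
  obtain n where "\<And>k. n \<le> k \<Longrightarrow> fits k (u \<circ> X)" by (rule fits_exists[OF uX]) blast
  then have n: "fits n (u \<circ> X)" by simp
  have "\<exists>Y\<in>acts F. (\<forall>\<omega>\<in>space F. u (Y \<omega>) = u (X \<omega>) / 2 ^ k) \<and> u (ce Y) = u (ce X) / 2 ^ k" for k
  proof (induction k)
    case 0
    show ?case using X by (intro bexI[of _ X]) auto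
  next
    case (Suc k)
    then obtain Y where Y: "Y \<in> acts F" "\<And>\<omega>. \<omega> \<in> space F \<Longrightarrow> u (Y \<omega>) = u (X \<omega>) / 2 ^ k"
      "u (ce Y) = u (ce X) / 2 ^ k" by blast
    let ?Z = "half_mix_act F P R Y (const_act F 0)"
    have "u (?Z \<omega>) = u (X \<omega>) / 2 ^ Suc k" if "\<omega> \<in> space F" for \<omega>
      using that Y(2)[OF that] by (simp add: half_mix_act_def const_act_def u_mix u_0)
    moreover have "u (ce ?Z) = u (ce X) / 2 ^ Suc k"
      using ce_half_mix_act[OF Y(1) const_act_in(1) comonotonic_const(1)] Y(3) by (simp add: u_mix u_0)
    ultimately show ?case using half_mix_act_in[OF Y(1) const_act_in(1)] by blast
  qed
  then obtain Y where Y: "Y \<in> acts F" "\<And>\<omega>. \<omega> \<in> space F \<Longrightarrow> u (Y \<omega>) = u (X \<omega>) / 2 ^ n"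
      "u (ce Y) = u (ce X) / 2 ^ n" by blast
  have "Y = scaled_act n (u \<circ> X)"
  proof (rule extensionalityI[of _ "space F"])
    show "Y \<in> extensional (space F)" using Y by (simp add: acts_def)
    show "scaled_act n (u \<circ> X) \<in> extensional (space F)" by (simp add: scaled_act_def)
    fix \<omega> assume w: "\<omega> \<in> space F"
    have "u (uinv ((u \<circ> X) \<omega> / 2 ^ n)) = (u \<circ> X) \<omega> / 2 ^ n"
      by (rule u_uinv_inside[OF fitsD[OF n w]])
    then have "u (Y \<omega>) = u (scaled_act n (u \<circ> X) \<omega>)" using Y(2)[OF w] w by (simp add: scaled_act_def)
    then show "Y \<omega> = scaled_act n (u \<circ> X) \<omega>" by simp
  qed
  then show ?thesis using val_eq[OF uX n] Y(3) by (simp add: scaled_value_def)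
qed

section \<open>The capacity on events\<close>

definition mu :: "'a set \<Rightarrow> real" where "mu A = val (indicator A)"

text \<open>Expressing \<open>mu\<close> through bets with one fixed prize \<open>a\<close> carries
  properties of certainty equivalents over to events. The exponent is chosen so that
  \<open>1 / 2 ^ n\<close> does not exceed \<open>radius\<close>.\<close>

lemma mu_eq:
  obtains n a where "0 < a" "\<And>A. A \<in> sets F \<Longrightarrow> mu A = 2 ^ n * u (ce (binary_act F a A 0))"
proof -
  obtain n where n: "1 / radius < 2 ^ n" using real_arch_pow[of 2 "1 / radius"] by auto
  then have n1: "1 \<le> radius * 2 ^ n" using radius_pos by (simp add: field_simps)
  define a where "a = uinv (1 / 2 ^ n)"
  have "u a = 1 / 2 ^ n" unfolding a_def using n1 by (intro u_uinv_inside) (simp add: field_simps)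
  then have "u 0 < u a" unfolding u_0 by simp
  then have "0 < a" by simp
  moreover have "mu A = 2 ^ n * u (ce (binary_act F a A 0))" if A: "A \<in> sets F" for A
  proof -
    have "bounded_measurable F (indicator A)" using bounded_measurable_indicator[OF A, of 1] by simp
    moreover have "fits n (indicator A)" using n1 radius_pos by (auto simp: fits_def indicator_def)
    ultimately have "mu A = scaled_value n (indicator A)" unfolding mu_def by (rule val_eq)
    moreover have "scaled_act n (indicator A) = binary_act F a A 0"
      by (auto simp: scaled_act_def binary_act_def a_def indicator_def)
    ultimately show ?thesis by (simp add: scaled_value_def)
  qed
  ultimately show ?thesis by (rule that)
qed

lemma u_ce_tendsto:
  assumes "(\<lambda>n::nat. ce (Xs n)) \<longlonglongrightarrow> ce X" shows "(\<lambda>n. u (ce (Xs n))) \<longlonglongrightarrow> u (ce X)"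
  using continuous_on_tendsto_compose[OF u_cont assms] by simp

text \<open>Eventually constant membership covers increasing and decreasing sequences alike; it
  makes the bets converge pointwise, and they are bounded by the prize.\<close>

lemma mu_tendsto:
  assumes A: "\<And>n::nat. A n \<in> sets F" and B: "B \<in> sets F"
    and ev: "\<And>\<omega>. \<omega> \<in> space F \<Longrightarrow> eventually (\<lambda>n. \<omega> \<in> A n \<longleftrightarrow> \<omega> \<in> B) sequentially"
  shows "(\<lambda>n. mu (A n)) \<longlonglongrightarrow> mu B"
proof -
  obtain n a where a: "0 < a" "\<And>A. A \<in> sets F \<Longrightarrow> mu A = 2 ^ n * u (ce (binary_act F a A 0))"
    by (rule mu_eq) blast
  have "(\<lambda>n. ce (binary_act F a (A n) 0)) \<longlonglongrightarrow> ce (binary_act F a B 0)"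
  proof (rule ce_tendsto)
    fix \<omega> assume w: "\<omega> \<in> space F"
    show "\<bar>binary_act F a (A n) 0 \<omega>\<bar> \<le> a" for n using a(1) w by (simp add: binary_act_def)
    show "(\<lambda>n. binary_act F a (A n) 0 \<omega>) \<longlonglongrightarrow> binary_act F a B 0 \<omega>"
    proof (rule tendsto_eventually)
      show "eventually (\<lambda>n. binary_act F a (A n) 0 \<omega> = binary_act F a B 0 \<omega>) sequentially"
        using ev[OF w] by eventually_elim (use w in \<open>simp add: binary_act_def\<close>)
    qed
  qed (use A B binary_act_in in auto)
  then have "(\<lambda>k. 2 ^ n * u (ce (binary_act F a (A k) 0))) \<longlonglongrightarrow> 2 ^ n * u (ce (binary_act F a B 0))"
    by (intro tendsto_mult tendsto_const u_ce_tendsto)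
  then show ?thesis by (simp add: a(2) A B)
qed

lemma continuous_capacity_mu: "continuous_capacity F mu"
  unfolding continuous_capacity_def capacity_def
proof (intro conjI ballI allI impI)
  note V = comonotonic_functional_val
  have "(indicator {} :: 'a \<Rightarrow> real) = (\<lambda>\<omega>. 0)" by auto
  then show "mu {} = 0" using comonotonic_functional_const[OF V, of 0] by (simp add: mu_def)
  have ind: "bounded_measurable F (indicator A)" if "A \<in> sets F" for A
    using bounded_measurable_indicator[OF that, of 1] by simp
  show "mu (space F) = 1"
  proof -
    have "val (indicator (space F)) = val (\<lambda>\<omega>. 1)"
      by (intro antisym comonotonic_functional_mono[OF V] ind bounded_measurable_const) auto
    then show ?thesis using comonotonic_functional_const[OF V, of 1] by (simp add: mu_def)
  qed
  show "mu A \<le> mu B" if "A \<in> sets F" "B \<in> sets F" "A \<subseteq> B" for A B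
    unfolding mu_def using that
    by (intro comonotonic_functional_mono[OF V] ind) (auto simp: indicator_def)
  fix A :: "nat \<Rightarrow> 'a set" assume A: "range A \<subseteq> sets F"
  show "(\<lambda>n. mu (A n)) \<longlonglongrightarrow> mu (\<Union>n. A n)" if inc: "incseq A"
  proof (rule mu_tendsto)
    fix \<omega>
    show "eventually (\<lambda>n. \<omega> \<in> A n \<longleftrightarrow> \<omega> \<in> (\<Union>n. A n)) sequentially"
    proof (cases "\<omega> \<in> (\<Union>n. A n)")
      case True
      then obtain k where "\<omega> \<in> A k" by blast
      then have "\<omega> \<in> A n" if "k \<le> n" for n using incseqD[OF inc that] by blast
      then show ?thesis unfolding eventually_sequentially using True by blast
    qed auto
  qed (use A in auto)
  show "(\<lambda>n. mu (A n)) \<longlonglongrightarrow> mu (\<Inter>n. A n)" if dec: "decseq A"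
  proof (rule mu_tendsto)
    fix \<omega>
    show "eventually (\<lambda>n. \<omega> \<in> A n \<longleftrightarrow> \<omega> \<in> (\<Inter>n. A n)) sequentially"
    proof (cases "\<omega> \<in> (\<Inter>n. A n)")
      case False
      then obtain k where "\<omega> \<notin> A k" by blast
      then have "\<omega> \<notin> A n" if "k \<le> n" for n using decseqD[OF dec that] by blast
      then show ?thesis unfolding eventually_sequentially using False by blast
    qed auto
  qed (use A in auto)
qed

interpretation mu: continuous_capacity_space F mu
  by unfold_locales (rule continuous_capacity_mu)

lemma mu_cong_prob: "A \<in> sets P \<Longrightarrow> B \<in> sets P \<Longrightarrow> measure P A = measure P B \<Longrightarrow> mu A = mu B"
  by (rule mu_eq) (simp add: setsD ce_binary_distribution[of A B])

text \<open>\<open>A\<close> need not be contained in \<open>B\<close>. RC permits replacing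
  \<open>B\<close> by a superset of \<open>A\<close> with the same probability, and SRM applies to
  the difference.\<close>

lemma mu_strict:
  assumes A: "A \<in> sets P" and B: "B \<in> sets P" and lt: "measure P A < measure P B"
  shows "mu A < mu B"
proof -
  obtain C where C: "C \<in> sets P" "A \<subseteq> C" "measure P C = measure P B"
    using superset_with_prob[OF A, of "measure P B"] lt P.prob_le_1 by auto
  obtain n a where a: "0 < a" "\<And>A. A \<in> sets F \<Longrightarrow> mu A = 2 ^ n * u (ce (binary_act F a A 0))"
    by (rule mu_eq) blast
  have "measure P (C - A) = measure P C - measure P A" by (rule P.finite_measure_Diff[OF C(1) A C(2)])
  then have pos: "0 < measure P (C - A)" using lt C by simp
  have D: "C - A \<in> sets P" using A C by auto
  have "ce (binary_act F a A 0) < ce (binary_act F a C 0)"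
  proof (rule ce_strict[OF binary_act_in_P[OF A] binary_act_in_P[OF C(1)] _ D pos])
    fix \<omega> assume "\<omega> \<in> space F"
    then show "binary_act F a A 0 \<omega> \<le> binary_act F a C 0 \<omega>" using C a by (auto simp: binary_act_def)
  next
    fix \<omega> assume "\<omega> \<in> C - A"
    then show "binary_act F a A 0 \<omega> < binary_act F a C 0 \<omega>"
      using C a sets.sets_into_space[OF C(1)] by (auto simp: binary_act_def space_eq)
  qed
  then have "mu A < mu C" by (simp add: a(2) setsD A C)
  then show ?thesis using mu_cong_prob[OF C(1) B C(3)] by simp
qed

section \<open>The distortion\<close>

text \<open>The \<open>g\<close> of the representation; by \<open>mu_cong_prob\<close> the choice of
  the event does not matter.\<close>

definition distort :: "real \<Rightarrow> real" where
  "distort p = mu (SOME A. A \<in> sets P \<and> measure P A = p)"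

lemma distort_eq: assumes "A \<in> sets P" shows "distort (measure P A) = mu A"
proof -
  have "(SOME B. B \<in> sets P \<and> measure P B = measure P A) \<in> sets P \<and>
      measure P (SOME B. B \<in> sets P \<and> measure P B = measure P A) = measure P A"
    by (rule someI[of _ A]) (use assms in simp)
  then show ?thesis unfolding distort_def using assms by (intro mu_cong_prob) auto
qed

lemma prob_surj:
  assumes "p \<in> {0..1}" obtains A where "A \<in> sets P" "measure P A = p"
  using subset_with_prob[of "space P" p] assms P.prob_space by auto

lemma distort_0: "distort 0 = 0"
  using distort_eq[of "{}"] by simp

lemma distort_1: "distort 1 = 1"
  using distort_eq[OF sets.top] P.prob_space by (simp add: space_eq)

lemma distort_strict: "strict_mono_on {0..1} distort"
proof (rule strict_mono_onI)
  fix p q :: real assume p: "p \<in> {0..1}" and q: "q \<in> {0..1}" and "p < q"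
  obtain A where A: "A \<in> sets P" "measure P A = p" by (rule prob_surj[OF p])
  obtain B where B: "B \<in> sets P" "measure P B = q" by (rule prob_surj[OF q])
  show "distort p < distort q" using mu_strict[OF A(1) B(1)] \<open>p < q\<close> distort_eq[OF A(1)] distort_eq[OF B(1)] A B
    by simp
qed

lemma distort_01: "distort ` {0..1} \<subseteq> {0..1}"
  using strict_mono_on_leD[OF distort_strict] distort_0 distort_1 by (force simp: image_subset_iff)

text \<open>Atomlessness provides an increasing chain of events with probabilities tending to
  \<open>p\<close> from below; continuity of \<open>mu\<close> along it excludes a jump from the
  left.\<close>

lemma distort_left:
  assumes p: "0 < p" "p \<le> 1" and c: "c < distort p"
  obtains q where "0 \<le> q" "q < p" "c < distort q"
proof -
  \<comment> \<open>\<open>r\<close> starts at 0 and increases to \<open>p\<close> without reaching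
    it.\<close>
  define r where "r n = p - p * inverse (real (Suc n))" for n
  have inv: "0 < inverse (real (Suc n))" "inverse (real (Suc n)) \<le> 1"
      "inverse (real (Suc (Suc n))) \<le> inverse (real (Suc n))" for n
    by (auto simp: inverse_le_1_iff intro: le_imp_inverse_le)
  have r: "0 \<le> r n" "r n < p" "r n \<le> r (Suc n)" for n
    using inv[of n] p by (simp_all add: r_def del: of_nat_Suc)
  have "\<exists>A. \<forall>n. (A n \<in> sets P \<and> measure P (A n) = r n) \<and> A n \<subseteq> A (Suc n)"
  proof (rule dependent_nat_choice)
    show "\<exists>A. A \<in> sets P \<and> measure P A = r 0"
      using prob_surj[of "r 0"] r[of 0] p by (metis atLeastAtMost_iff less_imp_le order_trans)
    show "\<exists>B. (B \<in> sets P \<and> measure P B = r (Suc n)) \<and> A \<subseteq> B"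
      if "A \<in> sets P \<and> measure P A = r n" for A n
      using superset_with_prob[of A "r (Suc n)"] that r(2)[of "Suc n"] r(3)[of n] p by auto
  qed
  then obtain A where A: "\<And>n. A n \<in> sets P" "\<And>n. measure P (A n) = r n" "\<And>n. A n \<subseteq> A (Suc n)" by blast
  have inc: "incseq A" using A(3) by (rule incseq_SucI)
  have rg: "range A \<subseteq> sets P" using A(1) by blast
  have U: "(\<Union>n. A n) \<in> sets P" using rg by blast
  have "r \<longlonglongrightarrow> p - p * 0" unfolding r_def
    by (intro tendsto_diff tendsto_mult tendsto_const LIMSEQ_inverse_real_of_nat)
  moreover have "r \<longlonglongrightarrow> measure P (\<Union>n. A n)"
    using P.finite_Lim_measure_incseq[OF rg inc] by (simp add: A(2))
  ultimately have "measure P (\<Union>n. A n) = p" using LIMSEQ_unique by fastforce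
  then have "c < mu (\<Union>n. A n)" using c distort_eq[OF U] by simp
  moreover have "(\<lambda>n. mu (A n)) \<longlonglongrightarrow> mu (\<Union>n. A n)"
    using rg sets_subset by (intro mu.mu_incseq inc) blast
  ultimately have "eventually (\<lambda>n. c < mu (A n)) sequentially" by (auto dest: order_tendstoD)
  then obtain n where "c < mu (A n)" using eventually_happens'[OF sequentially_bot] by blast
  then have "c < distort (r n)" using distort_eq[OF A(1)] A(2) by metis
  then show ?thesis using that r by blast
qed

text \<open>The mirror image: a decreasing chain with probabilities that start at 1 and tend to
  \<open>p\<close>.\<close>

lemma distort_right:
  assumes p: "0 \<le> p" "p < 1" and c: "distort p < c"
  obtains q where "p < q" "q \<le> 1" "distort q < c"
proof -
  define r where "r n = p + (1 - p) * inverse (real (Suc n))" for n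
  have inv: "0 < inverse (real (Suc n))" "inverse (real (Suc n)) \<le> 1"
      "inverse (real (Suc (Suc n))) \<le> inverse (real (Suc n))" for n
    by (auto simp: inverse_le_1_iff intro: le_imp_inverse_le)
  have r: "r n \<le> 1" "p < r n" "r (Suc n) \<le> r n" for n
  proof -
    have "(1 - p) * inverse (real (Suc n)) \<le> (1 - p) * 1" using inv p by (intro mult_left_mono) auto
    then show "r n \<le> 1" by (simp add: r_def del: of_nat_Suc)
    show "p < r n" "r (Suc n) \<le> r n" using inv[of n] p by (simp_all add: r_def del: of_nat_Suc)
  qed
  have "\<exists>A. \<forall>n. (A n \<in> sets P \<and> measure P (A n) = r n) \<and> A (Suc n) \<subseteq> A n"
  proof (rule dependent_nat_choice)
    show "\<exists>A. A \<in> sets P \<and> measure P A = r 0"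
      using prob_surj[of "r 0"] r[of 0] p by (metis atLeastAtMost_iff less_imp_le order_trans)
    show "\<exists>B. (B \<in> sets P \<and> measure P B = r (Suc n)) \<and> B \<subseteq> A"
      if "A \<in> sets P \<and> measure P A = r n" for A n
      using subset_with_prob[of A "r (Suc n)"] that r(2)[of "Suc n"] r(3)[of n] p by auto
  qed
  then obtain A where A: "\<And>n. A n \<in> sets P" "\<And>n. measure P (A n) = r n" "\<And>n. A (Suc n) \<subseteq> A n" by blast
  have dec: "decseq A" using A(3) by (rule decseq_SucI)
  have rg: "range A \<subseteq> sets P" using A(1) by blast
  have U: "(\<Inter>n. A n) \<in> sets P" using rg by (intro sets.countable_INT) auto
  have "r \<longlonglongrightarrow> p + (1 - p) * 0" unfolding r_def
    by (intro tendsto_add tendsto_mult tendsto_const LIMSEQ_inverse_real_of_nat)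
  moreover have "r \<longlonglongrightarrow> measure P (\<Inter>n. A n)"
    using P.finite_Lim_measure_decseq[OF rg dec] by (simp add: A(2))
  ultimately have "measure P (\<Inter>n. A n) = p" using LIMSEQ_unique by fastforce
  then have "mu (\<Inter>n. A n) < c" using c distort_eq[OF U] by simp
  moreover have "(\<lambda>n. mu (A n)) \<longlonglongrightarrow> mu (\<Inter>n. A n)"
    using rg sets_subset by (intro mu.mu_decseq dec) blast
  ultimately have "eventually (\<lambda>n. mu (A n) < c) sequentially" by (auto dest: order_tendstoD)
  then obtain n where "mu (A n) < c" using eventually_happens'[OF sequentially_bot] by blast
  then have "distort (r n) < c" using distort_eq[OF A(1)] A(2) by metis
  then show ?thesis using that r by blast
qed

lemma distort_mono: "p \<in> {0..1} \<Longrightarrow> q \<in> {0..1} \<Longrightarrow> p \<le> q \<Longrightarrow> distort p \<le> distort q"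
  by (rule strict_mono_on_leD[OF distort_strict])

lemma distort_continuous: "continuous_on {0..1} distort"
  unfolding continuous_on_def
proof (intro ballI order_tendstoI)
  fix p c :: real assume p: "p \<in> {0..1}" and c: "c < distort p"
  have in01: "eventually (\<lambda>q. q \<in> {0..1}) (at p within {0..1})"
    by (simp add: eventually_at_filter)
  show "eventually (\<lambda>q. c < distort q) (at p within {0..1})"
  proof (cases "p = 0")
    case True
    show ?thesis using in01
      by eventually_elim (use distort_mono[OF p] True c in \<open>auto intro: less_le_trans\<close>)
  next
    case False
    then obtain r where r: "0 \<le> r" "r < p" "c < distort r" using distort_left[OF _ _ c] p by auto
    have "eventually (\<lambda>q. r < q) (at p within {0..1})"
      by (rule order_tendstoD(1)[OF tendsto_ident_at r(2)])
    then show ?thesis using in01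
      by eventually_elim (use r p distort_mono[of r] in \<open>auto intro: less_le_trans\<close>)
  qed
next
  fix p c :: real assume p: "p \<in> {0..1}" and c: "distort p < c"
  have in01: "eventually (\<lambda>q. q \<in> {0..1}) (at p within {0..1})"
    by (simp add: eventually_at_filter)
  show "eventually (\<lambda>q. distort q < c) (at p within {0..1})"
  proof (cases "p = 1")
    case True
    show ?thesis using in01
      by eventually_elim (use distort_mono[OF _ p] True c in \<open>auto intro: le_less_trans\<close>)
  next
    case False
    then obtain r where r: "p < r" "r \<le> 1" "distort r < c" using distort_right[OF _ _ c] p by auto
    have "eventually (\<lambda>q. q < r) (at p within {0..1})"
      by (rule order_tendstoD(2)[OF tendsto_ident_at r(1)])
    then show ?thesis using in01
      proof eventually_elim
      case (elim q)
      then have "distort q \<le> distort r" using r p by (intro distort_mono) auto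
      then show ?case using r by simp
    qed
  qed
qed

section \<open>Assembling the representation\<close>

lemma representation:
  "\<exists>g \<nu>. distortion g \<and> strict_mono_on {0..1} g \<and> continuous_on {0..1} g \<and>
       continuous_capacity F \<nu> \<and> risk_conforming P \<nu> \<and>
       (\<forall>X\<in>acts F. \<forall>Y\<in>acts F.
          R X Y \<longleftrightarrow> choquet F (g \<circ> \<nu>) (u \<circ> X) \<ge> choquet F (g \<circ> \<nu>) (u \<circ> Y))"
proof -
  define ginv where "ginv = the_inv_into {0..1} distort"
  have inj: "inj_on distort {0..1}" using distort_strict by (rule strict_mono_on_imp_inj_on)
  have inv_distort: "ginv (distort p) = p" if "p \<in> {0..1}" for p
    unfolding ginv_def by (rule the_inv_into_f_f[OF inj that])
  have surj: "distort ` {0..1} = {0..1}"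
  proof
    show "{0..1} \<subseteq> distort ` {0..1}"
    proof
      fix y :: real assume "y \<in> {0..1}"
      then have "\<exists>x\<ge>0. x \<le> 1 \<and> distort x = y"
        using distort_0 distort_1 distort_continuous by (intro IVT') auto
      then show "y \<in> distort ` {0..1}" by force
    qed
  qed (rule distort_01)
  have distort_inv: "ginv y \<in> {0..1}" "distort (ginv y) = y" if "y \<in> {0..1}" for y
    using that surj inv_distort by (metis imageE)+
  have inv_mono: "ginv x \<le> ginv y" if "x \<in> {0..1}" "y \<in> {0..1}" "x \<le> y" for x y
  proof (rule ccontr)
    assume "\<not> ginv x \<le> ginv y"
    then have "distort (ginv y) < distort (ginv x)"
      by (intro strict_mono_onD[OF distort_strict] distort_inv that) simp
    then show False using that by (simp add: distort_inv)
  qed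
  \<comment> \<open>A continuous injection on a compact interval has a continuous inverse; this
    gives continuity of the capacity \<open>\<nu>\<close>.\<close>
  have inv_cont: "continuous_on {0..1} ginv"
    using continuous_on_inv[OF distort_continuous compact_Icc, of ginv] inv_distort surj by simp
  define \<nu> where "\<nu> A = ginv (mu A)" for A
  have tend: "(\<lambda>n. \<nu> (A n)) \<longlonglongrightarrow> \<nu> B"
    if "(\<lambda>n::nat. mu (A n)) \<longlonglongrightarrow> mu B" "\<And>n. A n \<in> sets F" "B \<in> sets F" for A B
    unfolding \<nu>_def
    by (rule continuous_on_tendsto_compose[OF inv_cont that(1)]) (use that mu.mu_01 in auto)
  have "continuous_capacity F \<nu>" unfolding continuous_capacity_def capacity_def
  proof (intro conjI ballI allI impI)
    show "\<nu> {} = 0" "\<nu> (space F) = 1"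
      using inv_distort[of 0] inv_distort[of 1] by (simp_all add: \<nu>_def distort_0 distort_1)
    show "\<nu> A \<le> \<nu> B" if "A \<in> sets F" "B \<in> sets F" "A \<subseteq> B" for A B
      unfolding \<nu>_def using that by (intro inv_mono mu.mu_01 mu.mu_mono)
    fix A :: "nat \<Rightarrow> 'a set" assume A: "range A \<subseteq> sets F"
    show "(\<lambda>n. \<nu> (A n)) \<longlonglongrightarrow> \<nu> (\<Union>n. A n)" if "incseq A"
      by (rule tend[OF mu.mu_incseq[OF A that]]) (use A in auto)
    show "(\<lambda>n. \<nu> (A n)) \<longlonglongrightarrow> \<nu> (\<Inter>n. A n)" if "decseq A"
      by (rule tend[OF mu.mu_decseq[OF A that]]) (use A in auto)
  qed
  moreover have "risk_conforming P \<nu>" unfolding risk_conforming_def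
    using distort_eq inv_distort P_01 by (metis \<nu>_def)
  moreover have "distortion distort"
    using distort_01 distort_0 distort_1 distort_strict unfolding distortion_def
    by (auto simp: image_subset_iff intro: strict_mono_on_imp_mono_on)
  moreover have val: "choquet F (distort \<circ> \<nu>) (u \<circ> X) = u (ce X)" if X: "X \<in> acts F" for X
  proof -
    have uX: "bounded_measurable F (u \<circ> X)"
      by (rule bounded_measurable_compose[OF act_bounded_measurable[OF X] u_cont])
    \<comment> \<open>\<open>distort\<close> undoes \<open>ginv\<close> on [0, 1], so the composite
      is \<open>mu\<close> on measurable sets, in particular on the level sets that
      \<open>choquet\<close> evaluates.\<close>
    have "(distort \<circ> \<nu>) {\<omega> \<in> space F. t < (u \<circ> X) \<omega>} = mu {\<omega> \<in> space F. t < (u \<circ> X) \<omega>}" for t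
    proof -
      have "u \<circ> X \<in> borel_measurable F" using uX by (simp add: bounded_measurable_def)
      then show ?thesis
        by (simp only: comp_apply[of distort \<nu>] \<nu>_def) (intro distort_inv mu.mu_01 mu.survival_sets)
    qed
    then have "choquet F (distort \<circ> \<nu>) (u \<circ> X) = choquet F mu (u \<circ> X)" by (simp add: choquet_def)
    \<comment> \<open>Both functionals take the value \<open>mu A\<close> on the indicator of
      \<open>A\<close>.\<close>
    also have "\<dots> = val (u \<circ> X)"
      by (rule comonotonic_functional_unique[OF mu.comonotonic_functional_choquet
            comonotonic_functional_val _ uX]) (simp add: mu.choquet_indicator mu_def)
    also have "\<dots> = u (ce X)" by (rule val_utility[OF X])
    finally show ?thesis .
  qed
  ultimately show ?thesis using distort_strict distort_continuous
    by (intro exI[of _ distort] exI[of _ \<nu>]) (simp add: val pref_iff)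
qed

end

lemma utility_representation:
  "\<exists>(u :: real \<Rightarrow> real) g \<nu>. continuous_on UNIV u \<and> strict_mono u \<and>
       distortion g \<and> strict_mono_on {0..1} g \<and> continuous_on {0..1} g \<and>
       continuous_capacity F \<nu> \<and> risk_conforming P \<nu> \<and>
       (\<forall>X\<in>acts F. \<forall>Y\<in>acts F.
          R X Y \<longleftrightarrow> choquet F (g \<circ> \<nu>) (u \<circ> X) \<ge> choquet F (g \<circ> \<nu>) (u \<circ> Y))"
proof -
  obtain u where u: "strict_mono u" "continuous_on UNIV u" "jensen_on UNIV u" "u 0 = 0"
    by (rule jensen_utility)
  show ?thesis using representation[OF u] u(1,2) by blast
qed

end

section \<open>From the representation to the axioms\<close>

locale distorted_expected_utility = atomless_subalgebra F P for F P :: "'a measure" +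
  fixes R :: "'a pref" and u g :: "real \<Rightarrow> real" and \<nu> :: "'a set \<Rightarrow> real"
  assumes preference: "preference F R"
    and u_cont: "continuous_on UNIV u" and u_strict: "strict_mono u"
    and g_distortion: "distortion g" and g_strict: "strict_mono_on {0..1} g"
    and g_cont: "continuous_on {0..1} g"
    and nu_cont: "continuous_capacity F \<nu>" and nu_P: "risk_conforming P \<nu>"
    and representation: "\<And>X Y. X \<in> acts F \<Longrightarrow> Y \<in> acts F \<Longrightarrow>
          R X Y \<longleftrightarrow> choquet F (g \<circ> \<nu>) (u \<circ> X) \<ge> choquet F (g \<circ> \<nu>) (u \<circ> Y)"
begin

lemma u_less [simp]: "u x < u y \<longleftrightarrow> x < y" and u_le [simp]: "u x \<le> u y \<longleftrightarrow> x \<le> y"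
  and u_eq [simp]: "u x = u y \<longleftrightarrow> x = y"
  using u_strict by (auto simp: strict_mono_less strict_mono_less_eq strict_mono_eq)

lemma g_0 [simp]: "g 0 = 0" and g_1 [simp]: "g 1 = 1"
  using g_distortion by (auto simp: distortion_def)

lemma g_mono: "p \<in> {0..1} \<Longrightarrow> q \<in> {0..1} \<Longrightarrow> p \<le> q \<Longrightarrow> g p \<le> g q"
  by (rule strict_mono_on_leD[OF g_strict])

interpretation nu: continuous_capacity_space F \<nu>
  by unfold_locales (rule nu_cont)

lemma continuous_capacity_distorted: "continuous_capacity F (g \<circ> \<nu>)"
  unfolding continuous_capacity_def capacity_def comp_def
proof (intro conjI ballI allI impI)
  show "g (\<nu> {}) = 0" "g (\<nu> (space F)) = 1" by simp_all
  show "g (\<nu> A) \<le> g (\<nu> B)" if "A \<in> sets F" "B \<in> sets F" "A \<subseteq> B" for A B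
    using that by (intro g_mono nu.mu_01 nu.mu_mono)
  have tend: "(\<lambda>n. g (\<nu> (A n))) \<longlonglongrightarrow> g (\<nu> B)"
    if "(\<lambda>n::nat. \<nu> (A n)) \<longlonglongrightarrow> \<nu> B" "\<And>n. A n \<in> sets F" "B \<in> sets F" for A B
    by (rule continuous_on_tendsto_compose[OF g_cont that(1)]) (use that nu.mu_01 in auto)
  fix A :: "nat \<Rightarrow> 'a set" assume A: "range A \<subseteq> sets F"
  show "(\<lambda>n. g (\<nu> (A n))) \<longlonglongrightarrow> g (\<nu> (\<Union>n. A n))" if "incseq A"
    by (rule tend[OF nu.mu_incseq[OF A that]]) (use A in auto)
  show "(\<lambda>n. g (\<nu> (A n))) \<longlonglongrightarrow> g (\<nu> (\<Inter>n. A n))" if "decseq A"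
    by (rule tend[OF nu.mu_decseq[OF A that]]) (use A in auto)
qed

sublocale continuous_capacity_space F "g \<circ> \<nu>"
  by unfold_locales (rule continuous_capacity_distorted)

definition value_of :: "('a \<Rightarrow> real) \<Rightarrow> real" where
  "value_of X = choquet F (g \<circ> \<nu>) (u \<circ> X)"

lemma pref_value: "X \<in> acts F \<Longrightarrow> Y \<in> acts F \<Longrightarrow> R X Y \<longleftrightarrow> value_of Y \<le> value_of X"
  by (simp add: representation value_of_def)

lemma utility_bounded_measurable: "X \<in> acts F \<Longrightarrow> bounded_measurable F (u \<circ> X)"
  by (rule bounded_measurable_compose[OF act_bounded_measurable u_cont])

lemma distorted_P: "A \<in> sets P \<Longrightarrow> (g \<circ> \<nu>) A = g (measure P A)"
  using nu_P by (simp add: risk_conforming_def)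

lemma utility_sets_P:
  assumes X: "X \<in> acts P" shows "{\<omega> \<in> space P. t < u (X \<omega>)} \<in> sets P"
proof -
  have "u \<in> borel_measurable borel" using u_cont by (rule borel_measurable_continuous_onI)
  moreover have "X \<in> borel_measurable P" using X by (simp add: acts_def)
  ultimately have "(\<lambda>\<omega>. u (X \<omega>)) \<in> borel_measurable P" by (rule measurable_compose[rotated])
  then show ?thesis unfolding borel_measurable_iff_greater by blast
qed

lemma survival_P:
  assumes X: "X \<in> acts P"
  shows "survival (u \<circ> X) t = g (measure P {\<omega> \<in> space P. t < u (X \<omega>)})"
  using distorted_P[OF utility_sets_P[OF X]] by (simp add: survival_def space_eq)

section \<open>The axioms RC, M, SRM and C\<close>

text \<open>A level \<open>t = u c\<close> of the utility is the level \<open>c\<close> of the act.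
  If \<open>t\<close> is not attained, the intermediate value theorem puts all utilities on one side
  of \<open>t\<close>, and the level events of both acts coincide.\<close>

lemma RC: "axiom_RC P R"
  unfolding axiom_RC_def
proof (intro ballI impI)
  fix X Y assume X: "X \<in> acts P" and Y: "Y \<in> acts P"
    and eq: "\<forall>x. measure P {\<omega> \<in> space P. X \<omega> > x} = measure P {\<omega> \<in> space P. Y \<omega> > x}"
  have "survival (u \<circ> X) t = survival (u \<circ> Y) t" for t
  proof (cases "\<exists>c. u c = t")
    case True
    then obtain c where "u c = t" by blast
    then have "t < u x \<longleftrightarrow> c < x" for x by auto
    then show ?thesis using eq by (simp add: survival_P[OF X] survival_P[OF Y])
  next
    case False
    have "(t < u x) = (t < u y)" for x y
    proof -
      have "t < u y" if "t < u x" for x y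
      proof (rule ccontr)
        assume n: "\<not> t < u y"
        then have "u y < u x" using that by linarith
        then have "\<exists>z\<ge>y. z \<le> x \<and> u z = t"
          using n that by (intro IVT') (auto intro: continuous_on_subset[OF u_cont])
        then show False using False by blast
      qed
      then show ?thesis by blast
    qed
    then have "t < u (X \<omega>) \<longleftrightarrow> t < u (Y \<omega>)" for \<omega> by blast
    then show ?thesis by (simp add: survival_def)
  qed
  then have "value_of X = value_of Y" unfolding value_of_def
    using acts_subset[OF X] acts_subset[OF Y]
    by (intro antisym choquet_mono_survival utility_bounded_measurable) simp_all
  then show "indiff R X Y" using acts_subset[OF X] acts_subset[OF Y] by (simp add: indiff_def pref_value)
qed

lemma M: "axiom_M F R"
  unfolding axiom_M_def
proof (intro ballI impI)
  fix X Y assume X: "X \<in> acts F" and Y: "Y \<in> acts F" and le: "\<forall>\<omega>\<in>space F. Y \<omega> \<le> X \<omega>"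
  then have "value_of Y \<le> value_of X" unfolding value_of_def
    by (intro choquet_mono utility_bounded_measurable) auto
  then show "R X Y" using X Y by (simp add: pref_value)
qed

text \<open>The increment of \<open>g\<close> over steps of length \<open>e\<close> is continuous
  and positive on a compact interval, so it has a positive minimum. A uniform \<open>d\<close> is
  what \<open>choquet_strict\<close> asks for.\<close>

lemma distortion_gap:
  assumes e: "0 < e" "e \<le> 1"
  obtains d where "0 < d" "\<And>p q. 0 \<le> p \<Longrightarrow> q \<le> 1 \<Longrightarrow> p + e \<le> q \<Longrightarrow> g p + d \<le> g q"
proof -
  have "\<exists>p\<in>{0..1 - e}. \<forall>q\<in>{0..1 - e}. g (p + e) - g p \<le> g (q + e) - g q"
  proof (rule continuous_attains_inf)
    show "continuous_on {0..1 - e} (\<lambda>p. g (p + e) - g p)"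
      by (intro continuous_on_diff continuous_on_compose2[OF g_cont, of _ "\<lambda>p. p + e"]
          continuous_on_compose2[OF g_cont, of _ "\<lambda>p. p"] continuous_intros) (use e in auto)
  qed (use e in auto)
  then obtain p0 where p0: "p0 \<in> {0..1 - e}"
    and min: "\<And>q. q \<in> {0..1 - e} \<Longrightarrow> g (p0 + e) - g p0 \<le> g (q + e) - g q" by blast
  show ?thesis
  proof (rule that)
    have "g p0 < g (p0 + e)" using p0 e by (intro strict_mono_onD[OF g_strict]) auto
    then show "0 < g (p0 + e) - g p0" by simp
    fix p q :: real assume pq: "0 \<le> p" "q \<le> 1" "p + e \<le> q"
    have "g (p + e) \<le> g q" using pq e by (intro g_mono) auto
    then show "g p + (g (p0 + e) - g p0) \<le> g q" using min[of p] pq by simp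
  qed
qed

text \<open>Rationals separate \<open>Y\<close> from \<open>X\<close> on an event
  \<open>E a b\<close> of positive probability. For every level between \<open>u a\<close> and
  \<open>u b\<close> this event lies outside the level event of \<open>Y\<close> and inside that of
  \<open>X\<close>, which gives a gap over a whole interval.\<close>

lemma SRM: "axiom_SRM P R"
  unfolding axiom_SRM_def
proof (intro ballI impI)
  fix X Y assume X: "X \<in> acts P" and Y: "Y \<in> acts P"
    and ge: "measure P {\<omega> \<in> space P. Y \<omega> \<le> X \<omega>} = 1"
    and gt: "0 < measure P {\<omega> \<in> space P. Y \<omega> < X \<omega>}"
  have mX: "X \<in> borel_measurable P" and mY: "Y \<in> borel_measurable P" using X Y by (simp_all add: acts_def)
  have "{\<omega> \<in> space P. Y \<omega> \<le> X \<omega>} \<in> sets P" using mX mY by (intro borel_measurable_le)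
  then have AE: "AE \<omega> in P. Y \<omega> \<le> X \<omega>"
    using ge P.prob_Collect_eq_1[of "\<lambda>\<omega>. Y \<omega> \<le> X \<omega>"] by simp
  define E where "E a b = {\<omega> \<in> space P. Y \<omega> \<le> a} \<inter> {\<omega> \<in> space P. b < X \<omega>}" for a b
  have E: "E a b \<in> sets P" for a b unfolding E_def
    using mX mY unfolding borel_measurable_iff_greater[of X] borel_measurable_iff_le[of Y] by blast
  \<comment> \<open>Otherwise the event \<open>Y < X\<close> would be covered by countably many null
    events.\<close>
  have "\<exists>a\<in>\<rat>. \<exists>b\<in>\<rat>. a < b \<and> 0 < measure P (E a b)"
  proof (rule ccontr)
    assume none: "\<not> ?thesis"
    define I where "I = {p \<in> \<rat> \<times> \<rat>. fst p < snd (p :: real \<times> real)}"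
    have "countable I" unfolding I_def
      by (rule countable_subset[of _ "\<rat> \<times> \<rat>"]) (auto intro: countable_rat)
    have null: "E (fst p) (snd p) \<in> null_sets P" if "p \<in> I" for p
    proof -
      have "\<not> 0 < measure P (E (fst p) (snd p))" using none that by (auto simp: I_def)
      then have "measure P (E (fst p) (snd p)) = 0" using measure_nonneg[of P] by (simp add: order_antisym)
      then show ?thesis using E by (simp add: null_sets_def P.emeasure_eq_measure)
    qed
    have U: "(\<Union>p\<in>I. E (fst p) (snd p)) \<in> null_sets P"
      by (rule null_sets_UN'[OF \<open>countable I\<close> null])
    have sub: "{\<omega> \<in> space P. Y \<omega> < X \<omega>} \<subseteq> (\<Union>p\<in>I. E (fst p) (snd p))"
    proof
      fix \<omega> assume w: "\<omega> \<in> {\<omega> \<in> space P. Y \<omega> < X \<omega>}"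
      then obtain a where a: "a \<in> \<rat>" "Y \<omega> < a" "a < X \<omega>" using Rats_dense_in_real by blast
      then obtain b where b: "b \<in> \<rat>" "a < b" "b < X \<omega>" using Rats_dense_in_real by blast
      have "(a, b) \<in> I" "\<omega> \<in> E a b" using a b w by (auto simp: I_def E_def)
      then show "\<omega> \<in> (\<Union>p\<in>I. E (fst p) (snd p))" by force
    qed
    have "measure P {\<omega> \<in> space P. Y \<omega> < X \<omega>} \<le> measure P (\<Union>p\<in>I. E (fst p) (snd p))"
      by (rule P.finite_measure_mono[OF sub null_setsD2[OF U]])
    also have "\<dots> = 0" by (rule measure_eq_0_null_sets[OF U])
    finally show False using gt by simp
  qed
  then obtain a b where ab: "a < b" "0 < measure P (E a b)" by blast
  obtain d where d: "0 < d" "\<And>p q. 0 \<le> p \<Longrightarrow> q \<le> 1 \<Longrightarrow> p + measure P (E a b) \<le> q \<Longrightarrow> g p + d \<le> g q"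
    by (rule distortion_gap[OF ab(2) P.prob_le_1]) blast
  let ?SX = "\<lambda>t. {\<omega> \<in> space P. t < u (X \<omega>)}" and ?SY = "\<lambda>t. {\<omega> \<in> space P. t < u (Y \<omega>)}"
  note SX = utility_sets_P[OF X] and SY = utility_sets_P[OF Y]
  have "value_of Y < value_of X" unfolding value_of_def
  proof (rule choquet_strict)
    show "bounded_measurable F (u \<circ> Y)" "bounded_measurable F (u \<circ> X)"
      using X Y by (auto intro: utility_bounded_measurable acts_subset)
    show "survival (u \<circ> Y) t \<le> survival (u \<circ> X) t" for t
    proof -
      have "measure P (?SY t) \<le> measure P (?SX t)"
      proof (rule P.finite_measure_mono_AE[OF _ SX])
        show "AE \<omega> in P. \<omega> \<in> ?SY t \<longrightarrow> \<omega> \<in> ?SX t"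
          using AE by eventually_elim (auto intro: less_le_trans)
      qed
      then show ?thesis unfolding survival_P[OF X] survival_P[OF Y] by (intro g_mono P_01)
    qed
    show "u a < u b" "0 < d" using ab d by simp_all
    fix t assume t: "u a \<le> t" "t \<le> u b"
    have "measure P (?SY t) + measure P (E a b) = measure P (?SY t \<union> E a b)"
    proof (rule P.finite_measure_Union[symmetric, OF SY E])
      show "?SY t \<inter> E a b = {}"
      proof (rule equals0I)
        fix \<omega> assume w: "\<omega> \<in> ?SY t \<inter> E a b"
        then have "u (Y \<omega>) \<le> u a" "t < u (Y \<omega>)" by (simp_all add: E_def)
        then show False using t(1) by linarith
      qed
    qed
    also have "\<dots> \<le> measure P (?SX t)"
    proof (rule P.finite_measure_mono_AE[OF _ SX])
      show "AE \<omega> in P. \<omega> \<in> ?SY t \<union> E a b \<longrightarrow> \<omega> \<in> ?SX t"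
        using AE
      proof eventually_elim
        case (elim \<omega>)
        have "t < u (X \<omega>)" if "t < u (Y \<omega>)"
        proof -
          have "u (Y \<omega>) \<le> u (X \<omega>)" using elim by simp
          with that show ?thesis by linarith
        qed
        moreover have "t < u (X \<omega>)" if "b < X \<omega>"
        proof -
          have "u b < u (X \<omega>)" using that by simp
          then show ?thesis using t by linarith
        qed
        ultimately show ?case by (auto simp: E_def)
      qed
    qed
    finally show "survival (u \<circ> Y) t + d \<le> survival (u \<circ> X) t"
      unfolding survival_P[OF X] survival_P[OF Y] by (intro d(2)) (simp_all add: P.prob_le_1)
  qed
  then show "strictly R X Y"
    using acts_subset[OF X] acts_subset[OF Y] by (simp add: strictly_def pref_value)
qed

lemma value_tendsto:
  assumes Xs: "\<And>n::nat. Xs n \<in> acts F" and X: "X \<in> acts F"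
    and bound: "\<And>n \<omega>. \<omega> \<in> space F \<Longrightarrow> \<bar>Xs n \<omega>\<bar> \<le> K"
    and lim: "\<And>\<omega>. \<omega> \<in> space F \<Longrightarrow> (\<lambda>n. Xs n \<omega>) \<longlonglongrightarrow> X \<omega>"
  shows "(\<lambda>n. value_of (Xs n)) \<longlonglongrightarrow> value_of X"
  unfolding value_of_def
proof (rule choquet_tendsto)
  show "u \<circ> Xs n \<in> borel_measurable F" "u \<circ> X \<in> borel_measurable F" for n
    using utility_bounded_measurable[OF Xs, of n] utility_bounded_measurable[OF X]
    by (simp_all add: bounded_measurable_def)
  fix \<omega> assume w: "\<omega> \<in> space F"
  show "(\<lambda>n. (u \<circ> Xs n) \<omega>) \<longlonglongrightarrow> (u \<circ> X) \<omega>"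
    using continuous_on_tendsto_compose[OF u_cont lim[OF w]] by simp
  fix n
  have "u (- K) \<le> u (Xs n \<omega>)" "u (Xs n \<omega>) \<le> u K" using bound[OF w, of n] by (simp_all add: abs_le_iff minus_le_iff)
  then show "\<bar>(u \<circ> Xs n) \<omega>\<bar> \<le> max \<bar>u (- K)\<bar> \<bar>u K\<bar>" unfolding comp_def by linarith
qed

lemma C: "axiom_C F R"
  unfolding axiom_C_def B_closed_def
proof (intro ballI conjI allI impI)
  fix X Xs Z
  assume X: "X \<in> acts F" and Z: "Z \<in> acts F"
    and bd: "\<exists>K. \<forall>n. \<forall>\<omega>\<in>space F. \<bar>Xs n \<omega>\<bar> \<le> K"
    and lim: "\<forall>\<omega>\<in>space F. (\<lambda>n::nat. Xs n \<omega>) \<longlonglongrightarrow> Z \<omega>"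
  obtain K where K: "\<And>n \<omega>. \<omega> \<in> space F \<Longrightarrow> \<bar>Xs n \<omega>\<bar> \<le> K" using bd by blast
  have V: "(\<lambda>n. value_of (Xs n)) \<longlonglongrightarrow> value_of Z" if "\<And>n. Xs n \<in> acts F"
    using lim by (intro value_tendsto[OF that Z K]) auto
  show "Z \<in> {Y \<in> acts F. R X Y}" if "\<forall>n. Xs n \<in> {Y \<in> acts F. R X Y}"
  proof -
    have a: "Xs n \<in> acts F" "value_of (Xs n) \<le> value_of X" for n
    proof -
      show Xn: "Xs n \<in> acts F" using that by blast
      have "R X (Xs n)" using that by blast
      then show "value_of (Xs n) \<le> value_of X" using X Xn by (simp add: pref_value)
    qed
    have "value_of Z \<le> value_of X" by (rule LIMSEQ_le_const2[OF V[OF a(1)]]) (use a(2) in auto)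
    then show ?thesis using X Z by (simp add: pref_value)
  qed
  show "Z \<in> {Y \<in> acts F. R Y X}" if "\<forall>n. Xs n \<in> {Y \<in> acts F. R Y X}"
  proof -
    have a: "Xs n \<in> acts F" "value_of X \<le> value_of (Xs n)" for n
    proof -
      show Xn: "Xs n \<in> acts F" using that by blast
      have "R (Xs n) X" using that by blast
      then show "value_of X \<le> value_of (Xs n)" using X Xn by (simp add: pref_value)
    qed
    have "value_of X \<le> value_of Z" by (rule LIMSEQ_le_const[OF V[OF a(1)]]) (use a(2) in auto)
    then show ?thesis using X Z by (simp add: pref_value)
  qed
qed

section \<open>The axioms RS and SCI\<close>

text \<open>From here on certainty equivalents and mixtures have their meaning, which RS and SCI
  presuppose.\<close>

sublocale regular_preference F P R
  by unfold_locales (rule preference RC M SRM C)+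

lemma value_const: "value_of (const_act F c) = u c"
proof -
  have "value_of (const_act F c) = choquet F (g \<circ> \<nu>) (\<lambda>\<omega>. u c)"
    unfolding value_of_def by (rule choquet_cong) (simp add: const_act_def)
  then show ?thesis by (simp add: choquet_const)
qed

lemma u_ce: "X \<in> acts F \<Longrightarrow> u (ce X) = value_of X"
  using indiff_ce[of X] const_act_in(1)[of "ce X"] value_const[of "ce X"]
  by (simp add: indiff_def pref_value)

lemma u_bet:
  assumes "y \<le> x" shows "u (bet x y) = u y + (u x - u y) * g (1/2)"
proof -
  obtain A where A: "A \<in> sets P" "A \<in> sets F" "measure P A = 1/2" "\<And>x y. bet x y = ce (binary_act F x A y)"
    by (rule coin_flip_obtain) blast
  have "u (bet x y) = value_of (binary_act F x A y)" unfolding A(4) by (rule u_ce[OF binary_act_in[OF A(2)]])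
  also have "\<dots> = choquet F (g \<circ> \<nu>) (\<lambda>\<omega>. if \<omega> \<in> A then u x else u y)"
    unfolding value_of_def by (rule choquet_cong) (simp add: binary_act_def)
  also have "\<dots> = u y + (u x - u y) * g (1/2)"
    using choquet_binary[OF A(2), of "u y" "u x"] distorted_P[OF A(1)] A(3) assms by simp
  finally show ?thesis .
qed

lemma g_half: "0 < g (1/2)" "g (1/2) < 1"
  using strict_mono_onD[OF g_strict, of 0 "1/2"] strict_mono_onD[OF g_strict, of "1/2" 1] by simp_all

text \<open>With \<open>p = g (1/2)\<close> both sides have utility
  \<open>p^2 * u x + p * (1 - p) * (u z + u z') + (1 - p)^2 * u y\<close>, symmetric in
  \<open>z\<close> and \<open>z'\<close>.\<close>

lemma RS: "axiom_RS F P R"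
  unfolding axiom_RS_def
proof (intro ballI allI impI)
  fix A and x y z z' :: real assume A: "A \<in> coin_flips P" and le: "y \<le> x" "z \<in> {y..x}" "z' \<in> {y..x}"
  \<comment> \<open>\<open>u_bet\<close> requires ordered payoffs, also for the outer bets.\<close>
  have "bet z' y \<le> z'" "z \<le> bet x z" "bet z y \<le> z" "z' \<le> bet x z'"
    "bet z' y \<le> bet x z" "bet z y \<le> bet x z'"
    using le bet_internal bet_mono[of z' x y z] bet_mono[of z x y z'] by auto
  then have "u (bet (bet x z) (bet z' y)) = u (bet (bet x z') (bet z y))"
    using le by (simp add: u_bet algebra_simps)
  then show "indiff R (binary_act F (ce (binary_act F x A z)) A (ce (binary_act F z' A y)))
      (binary_act F (ce (binary_act F x A z')) A (ce (binary_act F z A y)))"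
    using A by (simp add: indiff_iff binary_act_in setsD coin_flipsD ce_coin_flip)
qed

text \<open>The defining equation of the mixture reduces to
  \<open>p * (1 - p) * (2 * u z - (u x + u y)) = 0\<close>, and strictness of \<open>g\<close> keeps
  \<open>p\<close> away from 0 and 1.\<close>

lemma u_mix_ordered:
  assumes "y \<le> x" shows "u (mix x y) = (u x + u y) / 2"
proof -
  define p where "p = g (1/2)"
  define z where "z = mix x y"
  have z: "y \<le> z" "z \<le> x" "bet x y = bet (bet x z) (bet z y)"
    using mix_in[OF assms] mix_eq[OF assms] by (auto simp: z_def)
  have "bet z y \<le> bet x z" by (rule bet_mono[OF z(2,1)])
  then have "u y + (u x - u y) * p =
      u y + (u z - u y) * p + (u z + (u x - u z) * p - (u y + (u z - u y) * p)) * p"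
    using arg_cong[OF z(3), of u] z(1,2) assms by (simp add: u_bet p_def)
  then have "p * (1 - p) * (2 * u z - (u x + u y)) = 0" by (simp add: algebra_simps)
  then show ?thesis using g_half by (simp add: p_def z_def)
qed

lemma u_mix: "u (mix x y) = (u x + u y) / 2"
  using u_mix_ordered[of y x] u_mix_ordered[of x y] by (cases "y \<le> x") (auto simp: mix_commute)

lemma value_mix:
  assumes X: "X \<in> acts F" and Z: "Z \<in> acts F" and com: "comonotonic F X Z"
  shows "value_of (half_mix_act F P R X Z) = (value_of X + value_of Z) / 2"
proof -
  have "comonotonic F (u \<circ> X) (u \<circ> Z)" unfolding comonotonic_def
  proof (intro ballI)
    fix \<omega> \<omega>' assume "\<omega> \<in> space F" "\<omega>' \<in> space F"
    then have "0 \<le> (X \<omega> - X \<omega>') * (Z \<omega> - Z \<omega>')" using com by (auto simp: comonotonic_def)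
    then show "0 \<le> ((u \<circ> X) \<omega> - (u \<circ> X) \<omega>') * ((u \<circ> Z) \<omega> - (u \<circ> Z) \<omega>')"
      by (auto simp: zero_le_mult_iff)
  qed
  note uX = utility_bounded_measurable[OF X] and uZ = utility_bounded_measurable[OF Z]
  have "value_of (half_mix_act F P R X Z) = choquet F (g \<circ> \<nu>) (\<lambda>\<omega>. ((u \<circ> X) \<omega> + (u \<circ> Z) \<omega>) / 2)"
    unfolding value_of_def by (rule choquet_cong) (simp add: half_mix_act_def u_mix)
  also have "\<dots> = choquet F (g \<circ> \<nu>) (\<lambda>\<omega>. (u \<circ> X) \<omega> + (u \<circ> Z) \<omega>) / 2"
    by (rule comonotonic_functional_halve[OF comonotonic_functional_choquet bounded_measurable_add[OF uX uZ]])
  also have "\<dots> = (value_of X + value_of Z) / 2"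
    using choquet_comonotonic_add[OF uX uZ \<open>comonotonic F (u \<circ> X) (u \<circ> Z)\<close>] by (simp add: value_of_def)
  finally show ?thesis .
qed

lemma SCI: "axiom_SCI F P R"
  unfolding axiom_SCI_def
proof (intro ballI impI)
  fix X Y Z assume X: "X \<in> acts F" and Y: "Y \<in> acts F" and Z: "Z \<in> acts F"
    and com: "comonotonic F X Z" "comonotonic F Y Z" and "indiff R X Y"
  then have "value_of X = value_of Y" by (simp add: indiff_def pref_value)
  then have "value_of (half_mix_act F P R X Z) = value_of (half_mix_act F P R Y Z)"
    by (simp add: value_mix X Y Z com)
  then show "indiff R (half_mix_act F P R X Z) (half_mix_act F P R Y Z)"
    using half_mix_act_in X Y Z by (simp add: indiff_def pref_value)
qed

end

theorem theorem1:
  fixes F P :: "'a measure" and R :: "('a \<Rightarrow> real) \<Rightarrow> ('a \<Rightarrow> real) \<Rightarrow> bool"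
  assumes "subalgebra F P" and "prob_space P" and "atomless P" and "preference F R"
  shows "axiom_RC P R \<and> axiom_M F R \<and> axiom_SRM P R \<and> axiom_C F R \<and>
         axiom_RS F P R \<and> axiom_SCI F P R \<longleftrightarrow>
    (\<exists>(u :: real \<Rightarrow> real) (g :: real \<Rightarrow> real) (\<nu> :: 'a set \<Rightarrow> real).
       continuous_on UNIV u \<and> strict_mono u \<and>
       distortion g \<and> strict_mono_on {0..1} g \<and> continuous_on {0..1} g \<and>
       continuous_capacity F \<nu> \<and> risk_conforming P \<nu> \<and>
       (\<forall>X\<in>acts F. \<forall>Y\<in>acts F.
          R X Y \<longleftrightarrow> choquet F (g \<circ> \<nu>) (u \<circ> X) \<ge> choquet F (g \<circ> \<nu>) (u \<circ> Y)))"
proof -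
  interpret atomless_subalgebra F P using assms(1-3) by (rule atomless_subalgebra.intro)
  show ?thesis
  proof
    assume "axiom_RC P R \<and> axiom_M F R \<and> axiom_SRM P R \<and> axiom_C F R \<and>
         axiom_RS F P R \<and> axiom_SCI F P R"
    then interpret comonotonic_independent_preference F P R
      using assms(4) by unfold_locales auto
    show "\<exists>u g \<nu>. continuous_on UNIV u \<and> strict_mono u \<and>
       distortion g \<and> strict_mono_on {0..1} g \<and> continuous_on {0..1} g \<and>
       continuous_capacity F \<nu> \<and> risk_conforming P \<nu> \<and>
       (\<forall>X\<in>acts F. \<forall>Y\<in>acts F.
          R X Y \<longleftrightarrow> choquet F (g \<circ> \<nu>) (u \<circ> X) \<ge> choquet F (g \<circ> \<nu>) (u \<circ> Y))"
      by (rule utility_representation)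
  next
    assume "\<exists>u g \<nu>. continuous_on UNIV u \<and> strict_mono u \<and>
       distortion g \<and> strict_mono_on {0..1} g \<and> continuous_on {0..1} g \<and>
       continuous_capacity F \<nu> \<and> risk_conforming P \<nu> \<and>
       (\<forall>X\<in>acts F. \<forall>Y\<in>acts F.
          R X Y \<longleftrightarrow> choquet F (g \<circ> \<nu>) (u \<circ> X) \<ge> choquet F (g \<circ> \<nu>) (u \<circ> Y))"
    then obtain u g \<nu> where "continuous_on UNIV u" "strict_mono u"
       "distortion g" "strict_mono_on {0..1} g" "continuous_on {0..1} g"
       "continuous_capacity F \<nu>" "risk_conforming P \<nu>"
       "\<forall>X\<in>acts F. \<forall>Y\<in>acts F.
          R X Y \<longleftrightarrow> choquet F (g \<circ> \<nu>) (u \<circ> X) \<ge> choquet F (g \<circ> \<nu>) (u \<circ> Y)" by blast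
    then interpret distorted_expected_utility F P R u g \<nu>
      using assms(4) by unfold_locales auto
    show "axiom_RC P R \<and> axiom_M F R \<and> axiom_SRM P R \<and> axiom_C F R \<and>
         axiom_RS F P R \<and> axiom_SCI F P R"
      using RC M SRM C RS SCI by blast
  qed
qed

end
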